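(* (1) For integers $i,l\ge 0$ let $\langle\Theta\rangle^i_l\in H$ be defined by $$\langle\Theta\rangle_l^i=\begin{cases}\Theta^{(1-q)\gamma_i(\sigma)}\,\Theta^{q^i}, & 0\le i<l,\\[2pt] \theta\,\eta^{\,q^{i-1}(1-q)(i-l)-q^i}\,\Theta^{(1-q)\gamma_i(\sigma)}\,\Theta^{q^i}, & i\ge l.\end{cases}$$ Then the standard Drinfeld $\mathcal A$-modules are precisely the twists $\Psi^{(k)}$, $k=0,\dots,N-1$, where $\Psi=\Psi^{(0)}$ is given, for $0\le n\le N-1$, by $$\Psi_{T_n}=\eta^{nq^{-1}}\,\Theta^{\gamma_N(\sigma)-W_N}\,\bigl(\tau+\langle\Theta\rangle^{N-1}_{N-n}\bigr)\circ\cdots\circ\bigl(\tau+\langle\Theta\rangle^{1}_{N-n}\bigr)\circ\bigl(\tau+\langle\Theta\rangle^{0}_{N-n}\bigr).$$ (2) Let $U_\rho=\{u_{k,\mu}\}_{k\in\mathbb Z_N,\ \mu^{W_N}=1}$ be the set of roots of the equations $$x^{W_N}=\Bigl(\frac1{\eta^{(k)}-\theta}\Bigr)^{\gamma_N(\sigma)},\qquad k\in\mathbb Z_N,$$ labelled as in the context. There are exactly $N\cdot W_N$ distinct Hayes $\mathcal A$-modules, parameterized by $u_{k,\mu}\in U_\rho$. The Hayes module $\psi^{u_{k,\mu}}$ corresponding to $u_{k,\mu}$ is given, for $0\le n\le N-1$, by $$\psi^{u_{k,\mu}}_{T_n}=\bigl(\eta^{(k-1)}\bigr)^n\,\psi'_n\,\psi''_{N-n},$$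 where $$\psi'_n=\Bigl(\tau-\frac{\theta\,u_{k+N-1,\,\mu\eta_*^{n-1}}}{\eta^{(k+N-1)}}\Bigr)\circ\Bigl(\tau-\frac{\theta\,u_{k+N-2,\,\mu\eta_*^{n-2}}}{\eta^{(k+N-2)}}\Bigr)\circ\cdots\circ\Bigl(\tau-\frac{\theta\,u_{k+N-n,\,\mu}}{\eta^{(k+N-n)}}\Bigr)$$ (so $\psi'_0=1$) and $$\psi''_{N-n}=(\tau-u_{k+N-n-1,\mu})\circ(\tau-u_{k+N-n-2,\mu})\circ\cdots\circ(\tau-u_{k+1,\mu})\circ(\tau-u_{k,\mu}),$$ with $\eta_*=\eta^{\frac{1-q}{q}}$.
   Context: Let $\mathcal K=\mathbb F_q(t)$ and let $K=\mathbb F_q(\theta)$ be its copy via $\iota:t\mapsto\theta$. Let $\rho\in\mathbb F_q[t]$ be monic irreducible of degree $N\ge 2$, $\eta$ a root of $\rho$, and $\eta^{(i)}=\eta^{q^i}$ for $i\in\mathbb Z$ (depending only on $i$ mod $N$; $\eta^{q^{-1}}=\eta^{(-1)}$, so $\eta_*=(\eta^{(-1)})^{1-q}$, and $\eta_*^{W_N}=1$). Let $\mathcal A=H^0(\mathbb P^1-P_\rho,\mathcal O_{\mathbb P^1})$ be the ring of elements of $\mathcal K$ regular away from the place $P_\rho$ of $\rho$; it is generated over $\mathbb F_q$ by $T_i=t^i/\rho(t)$, $0\le i\le N-1$. Put $W_i=\frac{q^i-1}{q-1}$. Let $H=K(\eta)$, $\sigma\in\mathrm{Gal}(H/K)$: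 $\eta\mapsto\eta^q$, $\theta\mapsto\theta$; for $x\in H^*$, $x^{\sum a_i\sigma^i}=\prod\sigma^i(x)^{a_i}$. Put $\Theta=\frac1{\theta-\eta}$ and $\gamma_k(\sigma)=\sum_{i=0}^{k-1}q^i\sigma^{k-1-i}\in\mathbb Z[\sigma]$, $\gamma_0(\sigma)=0$. Standard modules. Let $L\supseteq H$ be a field. For $g\in L(t)$, $g^{(k)}$ is obtained by raising the coefficients in $L$ to the $q^k$-th power ($t$ fixed). Let $f(t)=\frac1{t-\eta}-\frac1{\theta-\eta}$, $\mathbf s_0=1$, $\mathbf s_i=f^{(0)}\cdots f^{(i-1)}$, an $L$-basis of $\mathcal A\otimes_{\mathbb F_q}L=L[\frac1{t-\eta^{(i)}}:0\le i\le N-1]$. $\Psi:\mathcal A\to L\{\tau\}$ ($\tau c=c^q\tau$) is the rank-one Drinfeld module with $\Psi_a=\sum_ic_i\tau^i$ where $a=\sum_ic_i\mathbf s_i$. The standard Drinfeld modules are those obtained in the same way from the shtuka functions $f^{\sigma^k}=\frac1{t-\eta^{(k)}}-\frac1{\theta-\eta^{(k)}}$; $\Psi^{(k)}$ denotes the $\sigma^k$-twist of $\Psi$ (apply $\sigma^k$ to coefficients). Labelling of $U_\rho$. Fix a root $u$ of $x^{W_N}=(-\Theta)^{\gamma_N(\sigma)}$, where $(-\Theta)^{\gamma_N(\sigma)}=(-1)^{W_N}\Theta^{\gamma_N(\sigma)}$, and for $k\ge 0$ and $\mu^{W_N}=1$ put $u_{k,\mu}=\mu^{q^k}\,\Theta^{(1-q)\gamma_k(\sigma)}\,u^{q^k}$;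 this depends only on $k$ mod $N$ and is a root of $x^{W_N}=\bigl(\frac1{\eta^{(k)}-\theta}\bigr)^{\gamma_N(\sigma)}$. Let $H^+=K(\eta,u)$. Hayes modules. Let $K_\rho$ be the completion of $K$ at the place of $\rho(\theta)$, containing $\mathbb F_q(\eta)$ with $\theta-\eta$ a uniformizer. Every $a\in K_\rho^*$ is uniquely $a=\mathrm{Sgn}_\eta(a)\,\rho(\theta)^{v(a)}\langle a\rangle_1$ with $\mathrm{Sgn}_\eta(a)\in\mathbb F_q(\eta)^*$, $v$ the normalized valuation and $\langle a\rangle_1$ a $1$-unit. A Hayes $\mathcal A$-module is a rank-one Drinfeld $\mathcal A$-module $\psi$ (over $H^+$, with $\mathcal A\to H^+$ given by $\iota$) for which there is $\sigma_\psi\in\mathrm{Gal}(\mathbb F_q(\eta)/\mathbb F_q)$ such that the leading coefficient of $\psi_a$ equals $\sigma_\psi(\mathrm{Sgn}_\eta(\iota(a)))$ for all nonzero $a\in\mathcal A$. *)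

theory Defs
  imports "HOL-Computational_Algebra.Computational_Algebra" "HOL-Library.FuncSet"
    "HOL-Library.Cardinality"
begin

(*
  Conventions.
  - The constant field with q elements is a finite field type 'f, with q = CARD('f). It is
    embedded by emb into a field type 'l, which plays the role of L. The elements theta, eta
    and u live in 'l, and K, F_q(eta), H and H^+ are subfields of 'l, given as sets.
  - The abstract function field F_q(t) is 'f poly fract, and L(t) is 'l poly fract.
  - An element (SUM i. c_i tau^i) of L{tau} is encoded as the polynomial with coefficients c_i,
    of type 'l poly; its product is skew_mult below, not the commutative product of 'l poly.
  - A map defined on A only is encoded as a total function that is extensional on A.
*)


definition field_embedding :: "('a::field \<Rightarrow> 'b::field) \<Rightarrow> bool" where
  "field_embedding h \<longleftrightarrow> h 1 = 1 \<and> (\<forall>x y. h (x + y) = h x + h y) \<and> (\<forall>x y. h (x * y) = h x * h y)"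

definition is_subfield :: "'a::field set \<Rightarrow> bool" where
  "is_subfield F \<longleftrightarrow> 1 \<in> F \<and> (\<forall>x\<in>F. \<forall>y\<in>F. x - y \<in> F \<and> x * y \<in> F) \<and> (\<forall>x\<in>F. inverse x \<in> F)"

definition adjoin :: "('f::field \<Rightarrow> 'l::field) \<Rightarrow> 'l set \<Rightarrow> 'l set" where
  "adjoin emb S = is_subfield hull (range emb \<union> S)"

(* Only the restriction to E of an element of gal E F is meaningful. *)
definition gal :: "'a::field set \<Rightarrow> 'a set \<Rightarrow> ('a \<Rightarrow> 'a) set" where
  "gal E F = {s. bij_betw s E E \<and> (\<forall>x\<in>E. \<forall>y\<in>E. s (x + y) = s x + s y \<and> s (x * y) = s x * s y) \<and>
                 (\<forall>x\<in>F. s x = x)}"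

(* x^P for P in Z[sigma], where P = (SUM i. a_i sigma^i) is encoded as an integer polynomial *)
definition gexp :: "('a::field \<Rightarrow> 'a) \<Rightarrow> 'a \<Rightarrow> int poly \<Rightarrow> 'a" where
  "gexp \<sigma> x P = (\<Prod>i\<le>degree P. ((\<sigma> ^^ i) x) powi (coeff P i))"

definition gam :: "nat \<Rightarrow> nat \<Rightarrow> int poly" where
  "gam q k = (\<Sum>i<k. monom (int q ^ i) (k - 1 - i))"

definition W :: "nat \<Rightarrow> nat \<Rightarrow> nat" where
  "W q i = (q ^ i - 1) div (q - 1)"

(* eta^{(i)} for an integer i, when eta has degree N over the field with q elements *)
definition conjg :: "nat \<Rightarrow> nat \<Rightarrow> 'a::field \<Rightarrow> int \<Rightarrow> 'a" where
  "conjg q N \<eta> i = \<eta> ^ (q ^ nat (i mod int N))"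


(* the extension to fractions of an injective ring homomorphism h into a field *)
definition fract_lift :: "('a::idom \<Rightarrow> 'b::field) \<Rightarrow> 'a fract \<Rightarrow> 'b" where
  "fract_lift h x = (THE y. \<exists>n d. d \<noteq> 0 \<and> x = Fraction_Field.Fract n d \<and> y = h n / h d)"

definition regular_at :: "'f::field poly \<Rightarrow> 'f poly fract \<Rightarrow> bool" where
  "regular_at \<pi> a \<longleftrightarrow> (\<exists>n d. \<not> \<pi> dvd d \<and> a = Fraction_Field.Fract n d)"

definition regular_at_infinity :: "'f::field poly fract \<Rightarrow> bool" where
  "regular_at_infinity a \<longleftrightarrow>
     (\<exists>n d. d \<noteq> 0 \<and> degree n \<le> degree d \<and> a = Fraction_Field.Fract n d)"

definition ringA :: "'f::field poly \<Rightarrow> 'f poly fract set" where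
  "ringA \<rho> = {a. regular_at_infinity a \<and>
                 (\<forall>\<pi>. irreducible \<pi> \<and> lead_coeff \<pi> = 1 \<and> \<pi> \<noteq> \<rho> \<longrightarrow> regular_at \<pi> a)}"

definition genT :: "'f::field poly \<Rightarrow> nat \<Rightarrow> 'f poly fract" where
  "genT \<rho> n = Fraction_Field.Fract (monom 1 n) \<rho>"

definition constA :: "'f::field \<Rightarrow> 'f poly fract" where
  "constA c = Fraction_Field.Fract [:c:] 1"

(* iota : F_q(t) \<rightarrow> K, t \<mapsto> theta *)
definition iota :: "('f::field \<Rightarrow> 'l::field) \<Rightarrow> 'l \<Rightarrow> 'f poly fract \<Rightarrow> 'l" where
  "iota emb \<theta> = fract_lift (\<lambda>p. poly (map_poly emb p) \<theta>)"

(* F_q(t) \<rightarrow> L(t) *)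
definition base_change :: "('f::field \<Rightarrow> 'l::field) \<Rightarrow> 'f poly fract \<Rightarrow> 'l poly fract" where
  "base_change emb = fract_lift (\<lambda>p. Fraction_Field.Fract (map_poly emb p) 1)"


(* The completion is F_q(eta)((X)) with X = theta - eta; the valuation is fls_subdegree. *)
definition K_rho :: "('f::field \<Rightarrow> 'l::field) \<Rightarrow> 'l \<Rightarrow> 'l fls set" where
  "K_rho emb \<eta> = {x. \<forall>n. fls_nth x n \<in> adjoin emb {\<eta>}}"

(* evaluation of a polynomial over F_q at theta = eta + X *)
definition eval_rho :: "('f::field \<Rightarrow> 'l::field) \<Rightarrow> 'l \<Rightarrow> 'f poly \<Rightarrow> 'l fls" where
  "eval_rho emb \<eta> p = poly (map_poly (\<lambda>c. fls_const (emb c)) p) (fls_const \<eta> + fls_X)"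

(* iota followed by the inclusion of K into its completion *)
definition iota_rho :: "('f::field \<Rightarrow> 'l::field) \<Rightarrow> 'l \<Rightarrow> 'f poly fract \<Rightarrow> 'l fls" where
  "iota_rho emb \<eta> = fract_lift (eval_rho emb \<eta>)"

definition one_unit :: "'l::field fls \<Rightarrow> bool" where
  "one_unit w \<longleftrightarrow> fls_subdegree w = 0 \<and> fls_nth w 0 = 1"

definition Sgn :: "('f::field \<Rightarrow> 'l::field) \<Rightarrow> 'f poly \<Rightarrow> 'l \<Rightarrow> 'l fls \<Rightarrow> 'l" where
  "Sgn emb \<rho> \<eta> x =
     (THE s. s \<in> adjoin emb {\<eta>} \<and> s \<noteq> 0 \<and>
        (\<exists>w\<in>K_rho emb \<eta>. one_unit w \<and>
           x = fls_const s * eval_rho emb \<eta> \<rho> powi fls_subdegree x * w))"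


(* the product of L{tau}, determined by tau c = c^q tau *)
definition skew_mult :: "nat \<Rightarrow> 'l::field poly \<Rightarrow> 'l poly \<Rightarrow> 'l poly" where
  "skew_mult q f g =
     (\<Sum>i\<le>degree f. \<Sum>j\<le>degree g. monom (coeff f i * coeff g j ^ (q ^ i)) (i + j))"

(* skew_prod q g m = g (m - 1) \<circ> ... \<circ> g 1 \<circ> g 0 in L{tau} *)
primrec skew_prod :: "nat \<Rightarrow> (nat \<Rightarrow> 'l::field poly) \<Rightarrow> nat \<Rightarrow> 'l poly" where
  "skew_prod q g 0 = 1"
| "skew_prod q g (Suc m) = skew_mult q (g m) (skew_prod q g m)"

(* Rank one means that the tau-degree of Phi_a is deg a = - deg(P_rho) v_rho(a); here
   v_rho is read off in the completion. *)
definition rank_one_Drinfeld ::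
  "('f::{field,finite} \<Rightarrow> 'l::field) \<Rightarrow> 'f poly \<Rightarrow> 'l \<Rightarrow> 'l \<Rightarrow> ('f poly fract \<Rightarrow> 'l poly) \<Rightarrow> bool" where
  "rank_one_Drinfeld emb \<rho> \<theta> \<eta> \<Phi> \<longleftrightarrow>
     \<Phi> \<in> extensional (ringA \<rho>) \<and>
     (\<forall>a\<in>ringA \<rho>. \<forall>b\<in>ringA \<rho>.
        \<Phi> (a + b) = \<Phi> a + \<Phi> b \<and> \<Phi> (a * b) = skew_mult CARD('f) (\<Phi> a) (\<Phi> b)) \<and>
     (\<forall>c. \<Phi> (constA c) = [:emb c:]) \<and>
     (\<forall>a\<in>ringA \<rho>. coeff (\<Phi> a) 0 = iota emb \<theta> a) \<and>
     (\<forall>a\<in>ringA \<rho>. a \<noteq> 0 \<longrightarrow>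
        int (degree (\<Phi> a)) = - int (degree \<rho>) * fls_subdegree (iota_rho emb \<eta> a))"


(* g^{(k)}: the coefficients in L are raised to the q^k-th power, t is fixed *)
definition coeff_frob :: "nat \<Rightarrow> nat \<Rightarrow> 'l::field poly fract \<Rightarrow> 'l poly fract" where
  "coeff_frob q k = fract_lift (\<lambda>p. Fraction_Field.Fract (map_poly (\<lambda>c. c ^ (q ^ k)) p) 1)"

(* f^{sigma^k} = 1/(t - eta^{(k)}) - 1/(theta - eta^{(k)}) *)
definition shtuka :: "nat \<Rightarrow> nat \<Rightarrow> 'l::field \<Rightarrow> 'l \<Rightarrow> int \<Rightarrow> 'l poly fract" where
  "shtuka q N \<theta> \<eta> k =
     Fraction_Field.Fract 1 [:- conjg q N \<eta> k, 1:]
     - Fraction_Field.Fract [:1 / (\<theta> - conjg q N \<eta> k):] 1"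

definition shtuka_basis :: "nat \<Rightarrow> 'l::field poly fract \<Rightarrow> nat \<Rightarrow> 'l poly fract" where
  "shtuka_basis q f i = (\<Prod>j<i. coeff_frob q j f)"

(* the Drinfeld module with Phi_a = (SUM i. c_i tau^i), where a = (SUM i. c_i s_i) *)
definition from_shtuka ::
  "('f::{field,finite} \<Rightarrow> 'l::field) \<Rightarrow> 'f poly \<Rightarrow> 'l \<Rightarrow> 'l \<Rightarrow> 'l poly fract \<Rightarrow>
   ('f poly fract \<Rightarrow> 'l poly) \<Rightarrow> bool" where
  "from_shtuka emb \<rho> \<theta> \<eta> f \<Phi> \<longleftrightarrow>
     rank_one_Drinfeld emb \<rho> \<theta> \<eta> \<Phi> \<and>
     (\<forall>a\<in>ringA \<rho>.
        base_change emb a =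
          (\<Sum>i\<le>degree (\<Phi> a). Fraction_Field.Fract [:coeff (\<Phi> a) i:] 1 * shtuka_basis CARD('f) f i))"

definition standard_modules ::
  "('f::{field,finite} \<Rightarrow> 'l::field) \<Rightarrow> 'f poly \<Rightarrow> 'l \<Rightarrow> 'l \<Rightarrow> ('f poly fract \<Rightarrow> 'l poly) set" where
  "standard_modules emb \<rho> \<theta> \<eta> =
     {\<Phi>. \<exists>k. from_shtuka emb \<rho> \<theta> \<eta> (shtuka CARD('f) (degree \<rho>) \<theta> \<eta> k) \<Phi>}"

(* the sigma^k-twist of a module with coefficients in the domain of sigma *)
definition twist ::
  "'f::field poly \<Rightarrow> ('l::field \<Rightarrow> 'l) \<Rightarrow> nat \<Rightarrow> ('f poly fract \<Rightarrow> 'l poly) \<Rightarrow> ('f poly fract \<Rightarrow> 'l poly)"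
  where
  "twist \<rho> \<sigma> k \<Phi> = (\<lambda>a\<in>ringA \<rho>. map_poly (\<sigma> ^^ k) (\<Phi> a))"

(* angle q N sigma theta eta l i is the bracket of Theta with lower index l and upper index i.
   The factor eta^(q^(i-1) (1-q) (i-l)) is written as a power of eta^{(i-1)}, which also makes
   sense for i = 0. *)
definition angle :: "nat \<Rightarrow> nat \<Rightarrow> ('l::field \<Rightarrow> 'l) \<Rightarrow> 'l \<Rightarrow> 'l \<Rightarrow> nat \<Rightarrow> nat \<Rightarrow> 'l" where
  "angle q N \<sigma> \<theta> \<eta> l i =
     (let \<Theta> = 1 / (\<theta> - \<eta>); x = gexp \<sigma> \<Theta> (smult (1 - int q) (gam q i)) * \<Theta> ^ (q ^ i)
      in if i < l then x
         else \<theta> * (conjg q N \<eta> (int i - 1) powi ((1 - int q) * (int i - int l))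
                   / conjg q N \<eta> (int i)) * x)"


definition Hayes_modules ::
  "('f::{field,finite} \<Rightarrow> 'l::field) \<Rightarrow> 'f poly \<Rightarrow> 'l \<Rightarrow> 'l \<Rightarrow> 'l \<Rightarrow> ('f poly fract \<Rightarrow> 'l poly) set" where
  "Hayes_modules emb \<rho> \<theta> \<eta> u =
     {\<psi>. rank_one_Drinfeld emb \<rho> \<theta> \<eta> \<psi> \<and>
         (\<forall>a\<in>ringA \<rho>. \<forall>i. coeff (\<psi> a) i \<in> adjoin emb {\<theta>, \<eta>, u}) \<and>
         (\<exists>s\<in>gal (adjoin emb {\<eta>}) (range emb). \<forall>a\<in>ringA \<rho>. a \<noteq> 0 \<longrightarrow>
            lead_coeff (\<psi> a) = s (Sgn emb \<rho> \<eta> (iota_rho emb \<eta> a)))}"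

definition U_rho :: "nat \<Rightarrow> nat \<Rightarrow> ('l::field \<Rightarrow> 'l) \<Rightarrow> 'l \<Rightarrow> 'l \<Rightarrow> 'l set" where
  "U_rho q N \<sigma> \<theta> \<eta> =
     {x. \<exists>k<N. x ^ W q N = gexp \<sigma> (1 / (conjg q N \<eta> (int k) - \<theta>)) (gam q N)}"

definition u_lab :: "nat \<Rightarrow> ('l::field \<Rightarrow> 'l) \<Rightarrow> 'l \<Rightarrow> 'l \<Rightarrow> 'l \<Rightarrow> nat \<Rightarrow> 'l \<Rightarrow> 'l" where
  "u_lab q \<sigma> \<theta> \<eta> u k \<mu> =
     \<mu> ^ (q ^ k) * gexp \<sigma> (1 / (\<theta> - \<eta>)) (smult (1 - int q) (gam q k)) * u ^ (q ^ k)"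

definition eta_star :: "nat \<Rightarrow> nat \<Rightarrow> 'l::field \<Rightarrow> 'l" where
  "eta_star q N \<eta> = conjg q N \<eta> (- 1) powi (1 - int q)"

definition psi' :: "nat \<Rightarrow> nat \<Rightarrow> ('l::field \<Rightarrow> 'l) \<Rightarrow> 'l \<Rightarrow> 'l \<Rightarrow> 'l \<Rightarrow> nat \<Rightarrow> 'l \<Rightarrow> nat \<Rightarrow> 'l poly" where
  "psi' q N \<sigma> \<theta> \<eta> u k \<mu> n =
     skew_prod q
       (\<lambda>m. [:- (\<theta> * u_lab q \<sigma> \<theta> \<eta> u (k + N - n + m) (\<mu> * eta_star q N \<eta> ^ m)
                 / conjg q N \<eta> (int (k + N - n + m))), 1:]) n"

definition psi'' :: "nat \<Rightarrow> ('l::field \<Rightarrow> 'l) \<Rightarrow> 'l \<Rightarrow> 'l \<Rightarrow> 'l \<Rightarrow> nat \<Rightarrow> 'l \<Rightarrow> nat \<Rightarrow> 'l poly" where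
  "psi'' q \<sigma> \<theta> \<eta> u k \<mu> m = skew_prod q (\<lambda>i. [:- u_lab q \<sigma> \<theta> \<eta> u (k + i) \<mu>, 1:]) m"

end

(*
  A skew polynomial P = SUM i. p_i tau^i is evaluated along the Frobenius orbit of theta by
  G(P)(j) = SUM i. p_i s_i(theta^(q^j)), where s_i = f^(0) ... f^(i-1) and f is a scalar multiple
  g of the shtuka function 1/(t - eta^(k)) - 1/(theta - eta^(k)). As s_i vanishes at t = theta^(q^j)
  exactly for j < i, the sequence G(P) determines P, and Newton interpolation shows that every
  a in the ring A has a unique P with G(P)(j) = a(theta^(q^j)) for all j. These P form a rank one
  Drinfeld module Dmod k g, because G is compatible with the skew product.

  Conversely, if psi has rank one, comparing leading coefficients of the psi_(t^i/rho) produces a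
  root eta^(k-1) of rho, and the element of L (x) A corresponding to 1/(t - eta^(k)) has tau-degree
  one, which gives g; commutativity of psi then forces psi = Dmod k g by induction on j. The
  standard modules are the ones with g = 1, and the Hayes condition says that 1/rho has leading
  coefficient 1.

  The factorisation of psi_(T_n) comes from multiplying up linear factors tau + a_m whose
  partial products evaluate to a constant times t^max(m-(N-n), 0) / PROD i<m. (t - eta^(k+i)).
  After N factors this is a constant times T_n, so the reciprocal of that constant is the
  leading coefficient of psi_(T_n).
*)
theory Submission
  imports Defs
begin

section \<open>Finite fields\<close>

text \<open>Evaluating at the points theta^(q^j) undoes the twist. Since s_(i+l) = s_i s_l^(i), and
  the value of s_l^(i) at theta^(q^j) is the q^i-th power of the value of s_l at theta^(q^(j-i)),
  the product P Q evaluates through the powers G(Q)(j-i)^(q^i). If G(Q)(j) = y^(q^j), these all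
  equal y^(q^j) and come out of the sum. An element a of A, having coefficients in F_q, gives
  exactly such an orbit, that of iota(a). What remains is a triangular linear system, which also
  shows in which subfield the coefficients lie. In the converse, commutativity alone determines the
  errors at a given j only up to a common factor; the image of 1/(t - eta^(k)) supplies the second
  relation. Its pole must lie one Frobenius step beyond the root eta^(k-1) given by the leading
  coefficients, for an image of degree D satisfies (eta^(k-1))^(q^D) = eta^(k). W_N = 1 + q + ... +
  q^(N-1) is the exponent with which g/(theta - eta^(k)) enters the constant reached after N linear
  factors. Setting that constant to 1 gives an equation of degree W_N for each k.\<close>

lemma mult_closed_power_card:
  fixes E :: "'a::field set"
  assumes "finite E" "0 \<in> E" "\<And>x y. x \<in> E \<Longrightarrow> y \<in> E \<Longrightarrow> x * y \<in> E" and c: "c \<in> E"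
  shows "c ^ card E = c"
proof (cases "c = 0")
  case True
  moreover have "card E > 0" using assms by (auto simp: card_gt_0_iff)
  ultimately show ?thesis by (simp add: power_0_left)
next
  case False
  define A where "A = E - {0}"
  \<comment> \<open>Multiplication by \<open>c\<close> permutes the nonzero elements, whose product
    is nonzero and can be cancelled.\<close>
  have inj: "inj_on (\<lambda>x. c * x) A" using False by (auto simp: inj_on_def)
  have sub: "(\<lambda>x. c * x) ` A \<subseteq> A" using assms False by (auto simp: A_def)
  have "finite A" using assms by (simp add: A_def)
  then have "bij_betw (\<lambda>x. c * x) A A"
    using inj sub by (simp add: bij_betw_def endo_inj_surj)
  then have "prod (\<lambda>x. x) A = (\<Prod>x\<in>A. c * x)"
    using prod.reindex_bij_betw[of "\<lambda>x. c * x" A A "\<lambda>x. x"] by simp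
  also have "\<dots> = c ^ card A * prod (\<lambda>x. x) A"
    by (simp add: prod.distrib)
  finally have "prod (\<lambda>x. x) A = c ^ card A * prod (\<lambda>x. x) A" .
  moreover have "prod (\<lambda>x. x) A \<noteq> 0"
    using \<open>finite A\<close> by (subst prod_zero_iff) (auto simp: A_def)
  ultimately have "c ^ card A = 1" by (metis mult_cancel_right1)
  moreover have "card E = Suc (card A)"
    using card_Suc_Diff1[of E 0] assms by (simp only: A_def)
  ultimately show ?thesis by (simp only: power_Suc mult_1_right)
qed

lemma finite_field_power_card:
  fixes c :: "'f::{field,finite}"
  shows "c ^ CARD('f) = c"
  by (rule mult_closed_power_card) auto

lemma card_field_ge_2: "CARD('f::{field,finite}) \<ge> 2"
proof -
  have "card {0, 1::'f} \<le> CARD('f)" by (rule card_mono) auto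
  then show ?thesis by simp
qed

locale fq_field =
  fixes emb :: "'f::{field,finite} \<Rightarrow> 'l::field" and q :: nat
  assumes q_eq: "q = CARD('f)" and emb: "field_embedding emb"
begin

lemma q_ge_2: "q \<ge> 2" using card_field_ge_2 q_eq by simp
lemma q_pos [simp]: "q > 0" using q_ge_2 by simp
lemma qpow_pos [simp]: "q ^ k > 0" by simp
lemma q_gt_1 [simp]: "q > 1" using q_ge_2 by simp

lemma emb_1 [simp]: "emb 1 = 1"
  and emb_add: "emb (x + y) = emb x + emb y"
  and emb_mult: "emb (x * y) = emb x * emb y"
  using emb by (auto simp: field_embedding_def)

lemma emb_0 [simp]: "emb 0 = 0"
  using emb_add[of 0 0] by (metis add_0 add_cancel_left_right)

lemma emb_power: "emb (x ^ n) = emb x ^ n"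
  by (induction n) (auto simp: emb_mult)

lemma emb_sum: "emb (sum f A) = (\<Sum>x\<in>A. emb (f x))"
  by (induction A rule: infinite_finite_induct) (auto simp: emb_add)

lemma emb_eq_0_iff [simp]: "emb x = 0 \<longleftrightarrow> x = 0"
proof
  assume *: "emb x = 0"
  show "x = 0"
  proof (rule ccontr)
    assume "x \<noteq> 0"
    then have "emb x * emb (inverse x) = 1" by (simp flip: emb_mult)
    then show False using * by simp
  qed
qed simp

lemma frob_Suc: "(x :: 'a::monoid_mult) ^ (q ^ Suc k) = (x ^ (q ^ k)) ^ q"
  by (simp add: power_mult[symmetric] mult.commute)

lemma emb_frob: "emb c ^ (q ^ k) = emb c"
proof (induction k)
  case (Suc k)
  have "emb c ^ (q ^ Suc k) = (emb c ^ (q ^ k)) ^ q" by (rule frob_Suc)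
  also have "\<dots> = emb (c ^ CARD('f))" by (simp only: Suc.IH) (simp only: emb_power q_eq)
  finally show ?case by (simp add: finite_field_power_card)
qed simp

definition ev :: "'f poly \<Rightarrow> 'l \<Rightarrow> 'l" where
  "ev p x = poly (map_poly emb p) x"

lemma ev_0 [simp]: "ev 0 x = 0" and ev_1 [simp]: "ev 1 x = 1"
  by (auto simp: ev_def)

lemma ev_pCons: "ev (pCons a p) x = emb a + x * ev p x"
  by (simp add: ev_def map_poly_pCons)

lemma ev_const [simp]: "ev [:a:] x = emb a"
  by (simp add: ev_pCons)

lemma ev_add: "ev (p + r) x = ev p x + ev r x"
  by (induction p r rule: poly_induct2) (auto simp: ev_pCons emb_add algebra_simps)

lemma ev_smult: "ev (smult a p) x = emb a * ev p x"
  by (induction p) (auto simp: ev_pCons emb_mult algebra_simps)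

lemma ev_minus: "ev (- p) x = - ev p x"
  using ev_add[of p "- p" x] by (simp add: eq_neg_iff_add_eq_0 add.commute)

lemma ev_diff: "ev (p - r) x = ev p x - ev r x"
  using ev_add[of p "- r" x] by (simp add: ev_minus)

lemma ev_mult: "ev (p * r) x = ev p x * ev r x"
  by (induction p) (auto simp: ev_pCons ev_add ev_smult algebra_simps)

lemma ev_power: "ev (p ^ n) x = ev p x ^ n"
  by (induction n) (auto simp: ev_mult)

lemma ev_monom: "ev (monom c n) x = emb c * x ^ n"
  by (simp add: ev_def map_poly_monom poly_monom)

lemma map_emb_mult: "map_poly emb (p * r) = map_poly emb p * map_poly emb r"
  by (rule poly_eqI) (simp add: coeff_map_poly coeff_mult emb_sum emb_mult)

lemma degree_map_emb [simp]: "degree (map_poly emb p) = degree p"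
  by (rule degree_map_poly) simp

lemma map_emb_eq_0_iff [simp]: "map_poly emb p = 0 \<longleftrightarrow> p = 0"
  by (simp add: poly_eq_iff coeff_map_poly)

text \<open>The polynomial $(X+1)^q - X^q - 1$ has degree less than $q$ and vanishes on the
  $q$ elements of the finite field.\<close>
lemma frob_add_one: "(x + 1) ^ q = x ^ q + (1 :: 'l)"
proof -
  define P where "P = [:1, 1:] ^ q - monom 1 q - (1 :: 'f poly)"
  have deg: "degree ([:1, 1:] ^ q :: 'f poly) = q"
    by (rule degree_linear_power)
  have "lead_coeff ([:1, 1:] ^ q :: 'f poly) = 1"
    by (simp only: lead_coeff_power) simp
  then have lc: "coeff ([:1, 1:] ^ q :: 'f poly) q = 1" by (simp only: deg)
  have "degree P \<le> q"
    unfolding P_def by (intro degree_diff_le) (auto simp: deg degree_monom_le)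
  moreover have "coeff P q = 0" by (simp add: P_def lc)
  ultimately have "degree P < q \<or> P = 0"
    by (metis le_neq_implies_less leading_coeff_0_iff)
  moreover have "poly P c = 0" for c
    using finite_field_power_card[of "c + 1"] finite_field_power_card[of c] q_eq
    by (simp add: P_def poly_monom poly_power add.commute)
  then have "{c. poly P c = 0} = UNIV" by auto
  then have "P \<noteq> 0 \<Longrightarrow> q \<le> degree P"
    using card_poly_roots_bound[of P] q_eq by simp
  ultimately have "P = 0" by force
  then have "ev P x = 0" by simp
  then have "ev ([:1, 1:] ^ q) x = ev (monom 1 q) x + 1"
    by (simp add: P_def ev_diff diff_eq_eq add.commute)
  then show ?thesis by (simp add: ev_power ev_pCons ev_monom add.commute)
qed

lemma frob_add_q: "(x + y) ^ q = x ^ q + (y :: 'l) ^ q"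
proof (cases "y = 0")
  case False
  have "x + y = (x / y + 1) * y" using False by (simp add: distrib_right)
  then have "(x + y) ^ q = (x / y + 1) ^ q * y ^ q" by (simp only: power_mult_distrib)
  also have "\<dots> = x ^ q + y ^ q"
    using False by (simp add: frob_add_one power_divide distrib_right)
  finally show ?thesis .
qed (simp add: power_0_left)

lemma frob_comp: "((x :: 'a::monoid_mult) ^ (q ^ k)) ^ (q ^ m) = x ^ (q ^ (k + m))"
  by (simp add: power_mult[symmetric] power_add)

lemma frob_add: "(x + y) ^ (q ^ k) = x ^ (q ^ k) + (y :: 'l) ^ (q ^ k)"
  by (induction k) (simp_all only: frob_Suc frob_add_q power_0 power_one_right)

lemma frob_0 [simp]: "(0 :: 'l) ^ (q ^ k) = 0"
  by (simp add: power_0_left)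

lemma frob_minus: "(- x) ^ (q ^ k) = - ((x :: 'l) ^ (q ^ k))"
  using frob_add[of x "- x" k] by (simp add: eq_neg_iff_add_eq_0 add.commute)

lemma frob_diff: "(x - y) ^ (q ^ k) = x ^ (q ^ k) - (y :: 'l) ^ (q ^ k)"
  using frob_add[of x "- y" k] by (simp add: frob_minus)

lemma frob_minus_q: "(- x) ^ q = - ((x :: 'l) ^ q)"
  using frob_minus[of x 1] by simp

lemma frob_diff_q: "(x - y) ^ q = x ^ q - (y :: 'l) ^ q"
  using frob_diff[of x y 1] by simp

lemma frob_sum: "(sum f A) ^ (q ^ k) = (\<Sum>x\<in>A. (f x :: 'l) ^ (q ^ k))"
  by (induction A rule: infinite_finite_induct) (auto simp: frob_add)

lemma frob_inj: "(x :: 'l) ^ (q ^ k) = y ^ (q ^ k) \<longleftrightarrow> x = y"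
proof
  assume "x ^ (q ^ k) = y ^ (q ^ k)"
  then have "(x - y) ^ (q ^ k) = 0" by (simp add: frob_diff)
  then show "x = y" by simp
qed simp

text \<open>The coefficients lie in F_q and are fixed by Frobenius. A Frobenius power of a value is
  therefore a value at the moved point.\<close>

lemma ev_frob: "ev p x ^ (q ^ k) = ev p (x ^ (q ^ k))"
  by (induction p) (auto simp: ev_pCons frob_add emb_frob power_mult_distrib)

end

section \<open>The constant field extension and the place $\rho$\<close>

text \<open>Counts the residues modulo rho, and with them the elements of F_q(eta). Bounding
  coefficients instead of the degree leaves just the zero polynomial for
  \<open>n = 0\<close>.\<close>

lemma finite_polys_bounded:
  "finite {p :: 'f::{field,finite} poly. \<forall>i\<ge>n. coeff p i = 0}" (is "finite (?P n)")
  and card_polys_bounded: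
  "card {p :: 'f::{field,finite} poly. \<forall>i\<ge>n. coeff p i = 0} = CARD('f) ^ n"
proof -
  have "finite (?P n) \<and> card (?P n) = CARD('f) ^ n"
  proof (induction n)
    case 0
    have "?P 0 = {0}" by (auto simp: poly_eq_iff)
    then show ?case by simp
  next
    case (Suc n)
    have eq: "?P (Suc n) = (\<lambda>(a, p). pCons a p) ` (UNIV \<times> ?P n)"
    proof (intro equalityI subsetI)
      fix p assume p: "p \<in> ?P (Suc n)"
      obtain a r where "p = pCons a r" by (cases p)
      moreover have "coeff r i = 0" if "i \<ge> n" for i
        using p that \<open>p = pCons a r\<close> by (auto dest: spec[of _ "Suc i"])
      ultimately show "p \<in> (\<lambda>(a, p). pCons a p) ` (UNIV \<times> ?P n)" by auto
    next
      fix p assume "p \<in> (\<lambda>(a, p). pCons a p) ` (UNIV \<times> ?P n)"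
      then show "p \<in> ?P (Suc n)" by (auto simp: coeff_pCons split: nat.splits)
    qed
    have "inj_on (\<lambda>(a, p). pCons a p) (UNIV \<times> ?P n)" by (auto simp: inj_on_def)
    then have "card (?P (Suc n)) = card ((UNIV :: 'f set) \<times> ?P n)"
      unfolding eq by (rule card_image)
    moreover have "finite (?P (Suc n))" unfolding eq using Suc by auto
    ultimately show ?case using Suc by (simp add: card_cartesian_product)
  qed
  then show "finite (?P n)" "card (?P n) = CARD('f) ^ n" by auto
qed

text \<open>Division with remainder by an element of least degree. It is applied to the polynomials
  vanishing at eta and to the ideal generated by two polynomials, where it gives a Bezout
  relation.\<close>

lemma poly_ideal_generator:
  fixes S :: "'a::field poly set"
  assumes "r \<in> S" "r \<noteq> 0" and closed: "\<And>x y c. x \<in> S \<Longrightarrow> y \<in> S \<Longrightarrow> x - y * c \<in> S"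
  obtains m where "m \<in> S" "m \<noteq> 0" "\<And>x. x \<in> S \<Longrightarrow> m dvd x"
proof -
  obtain m where m: "m \<in> S" "m \<noteq> 0" and min: "\<And>x. x \<in> S \<Longrightarrow> x \<noteq> 0 \<Longrightarrow> degree m \<le> degree x"
    using arg_min_nat_lemma[of "\<lambda>p. p \<in> S \<and> p \<noteq> 0" r degree] assms by blast
  have "m dvd x" if "x \<in> S" for x
  proof -
    have "x mod m = x - m * (x div m)" by (simp add: minus_mult_div_eq_mod)
    then have "x mod m \<in> S" using closed[OF that m(1)] by simp
    then have "x mod m \<noteq> 0 \<Longrightarrow> degree m \<le> degree (x mod m)" by (rule min)
    moreover have "x mod m = 0 \<or> degree (x mod m) < degree m"
      using m by (intro degree_mod_less)
    ultimately have "x mod m = 0" by linarith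
    then show ?thesis by (simp add: dvd_eq_mod_eq_0)
  qed
  then show ?thesis using m that by blast
qed

text \<open>\<open>transc\<close> makes theta transcendental over F_q. The points theta^(q^j) are
  then pairwise distinct, and the denominators theta^(q^j) - eta^(i) do not vanish.\<close>

locale rho_place = fq_field emb q
  for emb :: "'f::{field,finite} \<Rightarrow> 'l::field" and q :: nat +
  fixes \<rho> :: "'f poly" and \<theta> \<eta> :: 'l and N :: nat
  assumes irr: "irreducible \<rho>" and monic: "lead_coeff \<rho> = 1"
    and N_eq: "N = degree \<rho>" and N_ge_2: "N \<ge> 2"
    and transc: "\<And>p :: 'f poly. p \<noteq> 0 \<Longrightarrow> poly (map_poly emb p) \<theta> \<noteq> 0"
    and root: "poly (map_poly emb \<rho>) \<eta> = 0"
begin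

lemma N_pos [simp]: "N > 0" using N_ge_2 by simp

lemma rho_nz [simp]: "\<rho> \<noteq> 0" using irr by auto

definition th :: "nat \<Rightarrow> 'l" where "th j = \<theta> ^ (q ^ j)"
definition h :: "nat \<Rightarrow> 'l" where "h k = \<eta> ^ (q ^ k)"

lemma th_0 [simp]: "th 0 = \<theta>" by (simp add: th_def)
lemma h_0 [simp]: "h 0 = \<eta>" by (simp add: h_def)
lemma th_frob: "th j ^ (q ^ i) = th (j + i)" by (simp only: th_def frob_comp)
lemma h_frob: "h j ^ (q ^ i) = h (j + i)" by (simp only: h_def frob_comp)
lemma th_q: "th j ^ q = th (Suc j)" using th_frob[of j 1] by simp
lemma h_q: "h j ^ q = h (Suc j)" using h_frob[of j 1] by simp

lemma ev_theta_nz: "p \<noteq> 0 \<Longrightarrow> ev p \<theta> \<noteq> 0" using transc by (simp add: ev_def)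

lemma ev_th: "ev p (th j) = ev p \<theta> ^ (q ^ j)" by (simp add: th_def ev_frob)
lemma ev_h: "ev p (h j) = ev p \<eta> ^ (q ^ j)" by (simp add: h_def ev_frob)

lemma ev_th_nz: "p \<noteq> 0 \<Longrightarrow> ev p (th j) \<noteq> 0" by (simp add: ev_th ev_theta_nz)

lemma ev_rho_eta [simp]: "ev \<rho> \<eta> = 0" using root by (simp add: ev_def)
lemma ev_rho_h [simp]: "ev \<rho> (h k) = 0" by (simp add: ev_h power_0_left)

lemma theta_power_inj: "\<theta> ^ i = \<theta> ^ j \<Longrightarrow> i = j"
proof (rule ccontr)
  assume eq: "\<theta> ^ i = \<theta> ^ j" and "i \<noteq> j"
  then have "coeff (monom 1 i - monom 1 j :: 'f poly) i \<noteq> 0" by simp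
  then have "monom 1 i - monom 1 j \<noteq> (0 :: 'f poly)" by (metis coeff_0)
  from ev_theta_nz[OF this] show False using eq by (simp add: ev_diff ev_monom)
qed

lemma th_inj: "th i = th j \<longleftrightarrow> i = j"
  using theta_power_inj[of "q ^ i" "q ^ j"] power_inject_exp[OF q_gt_1, of i j]
  by (auto simp: th_def)

lemma th_ne_h [simp]: "th j \<noteq> h k" "h k \<noteq> th j"
  using ev_th_nz[of \<rho> j] ev_rho_h[of k] by (metis rho_nz)+

lemma theta_ne_h [simp]: "\<theta> \<noteq> h k" "h k \<noteq> \<theta>"
  using th_ne_h[of 0 k] by simp_all

lemma theta_ne_eta [simp]: "\<theta> \<noteq> \<eta>" "\<eta> \<noteq> \<theta>"
  using theta_ne_h[of 0] by simp_all

lemma th_nz [simp]: "th j \<noteq> 0"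
  using ev_th_nz[of "monom 1 1" j] by (simp add: ev_monom)

lemma theta_nz [simp]: "\<theta> \<noteq> 0" using th_nz[of 0] by simp

text \<open>The generator of the ideal of polynomials vanishing at eta divides rho and is not a
  unit, so irreducibility makes it an associate of rho.\<close>

lemma ev_eta_eq_0_iff: "ev p \<eta> = 0 \<longleftrightarrow> \<rho> dvd p"
proof
  assume "\<rho> dvd p"
  then show "ev p \<eta> = 0" by (auto simp: ev_mult elim!: dvdE)
next
  assume p: "ev p \<eta> = 0"
  obtain m where m: "ev m \<eta> = 0" "m \<noteq> 0" and m_dvd: "\<And>r. ev r \<eta> = 0 \<Longrightarrow> m dvd r"
    using poly_ideal_generator[of \<rho> "{r. ev r \<eta> = 0}"] by (auto simp: ev_diff ev_mult)
  obtain c where c: "\<rho> = m * c" using m_dvd[of \<rho>] by auto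
  have "\<not> m dvd 1"
  proof
    assume "m dvd 1"
    then obtain k where "1 = m * k" by (rule dvdE)
    then have "ev 1 \<eta> = ev m \<eta> * ev k \<eta>" by (metis ev_mult)
    then show False using m by simp
  qed
  then have "c dvd 1" using irreducibleD[OF irr c] by blast
  then have "\<rho> dvd m" using c by (metis dvd_mult_unit_iff dvd_refl mult_unit_dvd_iff)
  then show "\<rho> dvd p" using m_dvd[OF p] by (rule dvd_trans)
qed

lemma ev_h_eq_0_iff: "ev p (h k) = 0 \<longleftrightarrow> \<rho> dvd p"
  by (simp add: ev_h ev_eta_eq_0_iff)

lemma eta_nz [simp]: "\<eta> \<noteq> 0"
proof
  assume "\<eta> = 0"
  then have "\<rho> dvd monom 1 1" by (simp flip: ev_eta_eq_0_iff add: ev_monom)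
  then have "degree \<rho> \<le> 1" by (metis degree_monom_eq dvd_imp_degree_le monom_eq_0_iff one_neq_zero)
  then show False using N_ge_2 N_eq by simp
qed

lemma h_nz [simp]: "h k \<noteq> 0" by (simp add: h_def)

text \<open>The field F_q(eta), presented as F_q[eta] so that it can be counted. That it is a field
  follows from its second description, in \<open>mem_Eset_iff\<close>, as the fixed points of x ->
  x^(q^N).\<close>

definition Eset :: "'l set" where "Eset = range (\<lambda>p. ev p \<eta>)"

lemma Eset_alt: "Eset = (\<lambda>p. ev p \<eta>) ` {p. \<forall>i\<ge>N. coeff p i = 0}"
proof -
  have "ev p \<eta> \<in> (\<lambda>p. ev p \<eta>) ` {p. \<forall>i\<ge>N. coeff p i = 0}" for p
  proof
    have "p mod \<rho> = p - \<rho> * (p div \<rho>)" by (simp add: minus_mult_div_eq_mod)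
    then show "ev p \<eta> = ev (p mod \<rho>) \<eta>" by (simp add: ev_diff ev_mult)
    have "p mod \<rho> = 0 \<or> degree (p mod \<rho>) < N"
      using degree_mod_less[of \<rho> p] by (simp add: N_eq)
    then show "p mod \<rho> \<in> {p. \<forall>i\<ge>N. coeff p i = 0}" by (auto intro: coeff_eq_0)
  qed
  then show ?thesis by (auto simp: Eset_def)
qed

lemma finite_Eset: "finite Eset" and card_Eset: "card Eset = q ^ N"
proof -
  let ?P = "{p :: 'f poly. \<forall>i\<ge>N. coeff p i = 0}"
  show "finite Eset" unfolding Eset_alt by (intro finite_imageI finite_polys_bounded)
  have "inj_on (\<lambda>p. ev p \<eta>) ?P"
  proof (rule inj_onI)
    fix p r assume p: "p \<in> ?P" and r: "r \<in> ?P" and "ev p \<eta> = ev r \<eta>"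
    then have dvd: "\<rho> dvd p - r" by (simp flip: ev_eta_eq_0_iff add: ev_diff)
    have "coeff (p - r) i = 0" if "i \<ge> N" for i using p r that by auto
    then have "p - r \<noteq> 0 \<Longrightarrow> degree (p - r) < N" by (metis leading_coeff_0_iff not_le)
    then show "p = r" using dvd_imp_degree_le[OF dvd] by (force simp: N_eq)
  qed
  then show "card Eset = q ^ N" unfolding Eset_alt
    by (simp only: card_image card_polys_bounded q_eq)
qed

lemma frob_N: "x \<in> Eset \<Longrightarrow> x ^ (q ^ N) = x"
proof -
  assume x: "x \<in> Eset"
  have mult: "a * b \<in> Eset" if "a \<in> Eset" "b \<in> Eset" for a b
    using that by (auto simp: Eset_def ev_mult[symmetric])
  have "0 \<in> Eset" unfolding Eset_def by (rule range_eqI[of _ _ 0]) simp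
  then show ?thesis
    using mult_closed_power_card[OF finite_Eset _ mult x] by (simp add: card_Eset)
qed

lemma frob_fixed_le:
  fixes A :: "'l set"
  assumes "\<And>x. x \<in> A \<Longrightarrow> x ^ n = x" "n > 1"
  shows "finite A" "card A \<le> n"
proof -
  let ?P = "monom 1 n - monom 1 1 :: 'l poly"
  have "coeff ?P n \<noteq> 0" using assms by simp
  then have nz: "?P \<noteq> 0" by (metis coeff_0)
  have sub: "A \<subseteq> {x. poly ?P x = 0}" using assms by (auto simp: poly_monom)
  show "finite A" using finite_subset[OF sub poly_roots_finite[OF nz]] .
  have "card A \<le> card {x. poly ?P x = 0}" by (rule card_mono[OF poly_roots_finite[OF nz] sub])
  also have "\<dots> \<le> degree ?P" by (rule card_poly_roots_bound[OF nz])
  also have "\<dots> \<le> n" using assms(2)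
    by (intro degree_diff_le) (auto intro: order.trans[OF degree_monom_le])
  finally show "card A \<le> n" .
qed

lemma qN_gt_1: "q ^ N > 1" using one_less_power[OF q_gt_1 N_pos] .

text \<open>F_q(eta) already supplies q^N roots of X^(q^N) - X, so there is no room for another
  one.\<close>

lemma mem_Eset_iff: "x \<in> Eset \<longleftrightarrow> x ^ (q ^ N) = x"
proof
  assume x: "x ^ (q ^ N) = x"
  have "card (insert x Eset) \<le> q ^ N"
    by (rule frob_fixed_le) (use x frob_N qN_gt_1 in auto)
  then show "x \<in> Eset" using card_Eset finite_Eset by (auto simp: card_insert_if split: if_splits)
qed (rule frob_N)

lemma eta_in_Eset: "\<eta> \<in> Eset"
  unfolding Eset_def by (rule range_eqI[of _ _ "monom 1 1"]) (simp add: ev_monom)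

lemma h_add_N [simp]: "h (k + N) = h k" "h (N + k) = h k"
proof -
  have "h N = \<eta>" using frob_N[OF eta_in_Eset] by (simp add: h_def)
  then show "h (k + N) = h k" by (metis add.commute h_def h_frob)
  then show "h (N + k) = h k" by (simp add: add.commute)
qed

lemma h_add_mult_N [simp]: "h (k + m * N) = h k"
proof (induction m)
  case (Suc m)
  have "h (k + Suc m * N) = h ((k + m * N) + N)" by (simp add: algebra_simps)
  then show ?case using Suc by (simp only: h_add_N)
qed simp

lemma h_mod_N: "h (k mod N) = h k"
  using h_add_mult_N[of "k mod N" "k div N"] by simp

lemma h_frob_N: "h k ^ (q ^ N) = h k" by (simp add: h_frob)

text \<open>If eta^(d) = eta with 0 < d < N, then the q^d-power map fixes all of F_q(eta), which has
  too many elements for that.\<close>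

lemma h_inj: assumes "i < N" "j < N" "h i = h j" shows "i = j"
proof (rule ccontr)
  assume "i \<noteq> j"
  then obtain a b where ab: "a < b" "b < N" "h a = h b"
    using assms by (metis linorder_neqE_nat)
  define d where "d = b - a"
  have d: "0 < d" "d < N" using ab by (auto simp: d_def)
  have "h b = h d ^ (q ^ a)" using ab by (simp add: h_frob d_def)
  moreover have "h a = \<eta> ^ (q ^ a)" by (simp add: h_def)
  ultimately have "h d = \<eta>" using ab frob_inj by metis
  then have "x ^ (q ^ d) = x" if "x \<in> Eset" for x
    using that by (auto simp: Eset_def ev_frob h_def)
  then have "card Eset \<le> q ^ d"
    using one_less_power[OF q_gt_1 \<open>0 < d\<close>] by (rule frob_fixed_le)
  then have "q ^ N \<le> q ^ d" by (simp add: card_Eset)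
  then have "N \<le> d" by (rule power_le_imp_le_exp[OF q_gt_1])
  then show False using d by simp
qed

text \<open>Both sides are monic of degree N, so their difference has degree below N, yet it
  vanishes at N distinct conjugates.\<close>

lemma rho_factor: "map_poly emb \<rho> = (\<Prod>i<N. [:- h i, 1:])"
proof (rule ccontr)
  define P where "P = (\<Prod>i<N. [:- h i, 1:])"
  assume "map_poly emb \<rho> \<noteq> (\<Prod>i<N. [:- h i, 1:])"
  then have nz: "map_poly emb \<rho> - P \<noteq> 0" by (simp add: P_def)
  have degP: "degree P = N" unfolding P_def
    by (subst degree_prod_eq_sum_degree) auto
  have lcP: "lead_coeff P = 1" unfolding P_def lead_coeff_prod by simp
  have "coeff (map_poly emb \<rho> - P) N = 0"
    using lcP degP monic N_eq by (simp add: coeff_map_poly)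
  moreover have "degree (map_poly emb \<rho> - P) \<le> N"
    by (rule degree_diff_le) (auto simp: degP N_eq)
  ultimately have "degree (map_poly emb \<rho> - P) < N"
    using nz by (metis le_neq_implies_less leading_coeff_0_iff)
  moreover have "h ` {..<N} \<subseteq> {x. poly (map_poly emb \<rho> - P) x = 0}"
  proof (intro image_subsetI CollectI)
    fix i assume "i \<in> {..<N}"
    then have "poly P (h i) = 0" unfolding P_def poly_prod by (intro prod_zero) auto
    then show "poly (map_poly emb \<rho> - P) (h i) = 0" using ev_rho_h[of i] by (simp add: ev_def)
  qed
  then have "card (h ` {..<N}) \<le> degree (map_poly emb \<rho> - P)"
    using card_poly_roots_bound[OF nz] card_mono[OF poly_roots_finite[OF nz]] by (meson order.trans)
  moreover have "card (h ` {..<N}) = N"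
    by (subst card_image) (auto intro!: inj_onI h_inj)
  ultimately show False by simp
qed

text \<open>Shifting by one trades the factor at \<open>h k\<close> for the one at
  \<open>h (k + N)\<close>, which is the same. The free starting index lets rho be written as a
  product starting at any eta^(k).\<close>

lemma prod_shift:
  fixes F :: "'l \<Rightarrow> 'a::comm_monoid_mult"
  shows "(\<Prod>i<N. F (h (k + i))) = (\<Prod>i<N. F (h i))"
proof (induction k)
  case (Suc k)
  obtain M where M: "N = Suc M" using N_pos gr0_implies_Suc by blast
  have "(\<Prod>i<N. F (h (Suc k + i))) = (\<Prod>i<M. F (h (Suc k + i))) * F (h (k + N))"
    by (simp add: M)
  also have "\<dots> = F (h (k + 0)) * (\<Prod>i<M. F (h (k + Suc i)))"
    by (simp only: h_add_N add_0_right add_Suc_right add_Suc) (simp add: mult.commute)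
  also have "\<dots> = (\<Prod>i<N. F (h (k + i)))"
    unfolding M by (simp only: prod.lessThan_Suc_shift)
  finally show ?case using Suc by simp
qed simp

lemma ev_rho_prod: "ev \<rho> x = (\<Prod>i<N. x - h (k + i))"
proof -
  have "ev \<rho> x = (\<Prod>i<N. x - h i)" by (simp add: ev_def rho_factor poly_prod)
  then show ?thesis using prod_shift[of "\<lambda>y. x - y" k] by simp
qed

lemma rho_root: assumes "ev \<rho> x = 0" obtains k where "k < N" "x = h k"
  using assms by (auto simp: ev_rho_prod[of _ 0])

lemma conjg_int [simp]: "conjg q N \<eta> (int k) = h k"
  by (simp add: conjg_def h_def[symmetric] h_mod_N nat_mod_distrib)

text \<open>\<open>k + N - 1\<close> stands for the index k - 1 from here on, so that indices stay
  natural at k = 0.\<close>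

lemma conjg_pred: "conjg q N \<eta> (int k - 1) = h (k + N - 1)"
proof -
  have "int (k + N - 1) = (int k - 1) + int N" using N_pos by linarith
  then have "conjg q N \<eta> (int k - 1) = conjg q N \<eta> (int (k + N - 1))"
    unfolding conjg_def by (simp only: mod_add_self2)
  then show ?thesis by (simp only: conjg_int)
qed

lemma conjg_minus_1: "conjg q N \<eta> (- 1) = h (N - 1)"
  using conjg_pred[of 0] by simp

lemma Eset_subfield: "is_subfield Eset"
  unfolding is_subfield_def
proof (intro conjI ballI)
  show "1 \<in> Eset" by (simp add: mem_Eset_iff)
  fix x y assume "x \<in> Eset" "y \<in> Eset"
  then show "x - y \<in> Eset" "x * y \<in> Eset"
    by (simp_all add: mem_Eset_iff frob_diff power_mult_distrib)
next
  fix x assume "x \<in> Eset"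
  then show "inverse x \<in> Eset" by (simp add: mem_Eset_iff power_inverse)
qed

end

section \<open>Subfields and adjunction\<close>

lemma is_subfield_0: "is_subfield F \<Longrightarrow> 0 \<in> F"
  unfolding is_subfield_def by (metis cancel_comm_monoid_add_class.diff_cancel)

lemma is_subfield_closed:
  assumes "is_subfield F"
  shows "x \<in> F \<Longrightarrow> y \<in> F \<Longrightarrow> x - y \<in> F" "x \<in> F \<Longrightarrow> y \<in> F \<Longrightarrow> x * y \<in> F"
    "x \<in> F \<Longrightarrow> inverse x \<in> F" "1 \<in> F" "0 \<in> F" "x \<in> F \<Longrightarrow> y \<in> F \<Longrightarrow> x + y \<in> F"
    "x \<in> F \<Longrightarrow> y \<in> F \<Longrightarrow> x / y \<in> F" "x \<in> F \<Longrightarrow> - x \<in> F" "x \<in> F \<Longrightarrow> x ^ n \<in> F"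
    "x \<in> F \<Longrightarrow> x powi i \<in> F"
proof -
  have 0: "0 \<in> F" using assms by (rule is_subfield_0)
  have d: "x - y \<in> F" and m: "x * y \<in> F" if "x \<in> F" "y \<in> F" for x y
    using assms that by (auto simp: is_subfield_def)
  have i: "inverse x \<in> F" if "x \<in> F" for x using assms that by (auto simp: is_subfield_def)
  have one: "1 \<in> F" using assms by (auto simp: is_subfield_def)
  have p: "x ^ n \<in> F" if "x \<in> F" for x n
    using that by (induction n) (auto simp: one m)
  have neg: "- x \<in> F" if "x \<in> F" for x using d[OF 0 that] by simp
  show "x \<in> F \<Longrightarrow> y \<in> F \<Longrightarrow> x - y \<in> F" "x \<in> F \<Longrightarrow> y \<in> F \<Longrightarrow> x * y \<in> F"
    "x \<in> F \<Longrightarrow> inverse x \<in> F" "1 \<in> F" "0 \<in> F" "x \<in> F \<Longrightarrow> - x \<in> F" "x \<in> F \<Longrightarrow> x ^ n \<in> F"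
    by (fact d m i one 0 neg p)+
  show "x \<in> F \<Longrightarrow> y \<in> F \<Longrightarrow> x + y \<in> F" using d[of x "- y"] neg[of y] by simp
  show "x \<in> F \<Longrightarrow> y \<in> F \<Longrightarrow> x / y \<in> F" using m[of x "inverse y"] i[of y] by (simp add: divide_inverse)
  show "x \<in> F \<Longrightarrow> x powi i \<in> F" using p[of x] p[OF i, of x] by (auto simp: power_int_def)
qed

lemma is_subfield_prod: "is_subfield F \<Longrightarrow> (\<And>i. i \<in> A \<Longrightarrow> f i \<in> F) \<Longrightarrow> prod f A \<in> F"
  by (induction A rule: infinite_finite_induct) (auto intro: is_subfield_closed)

lemma is_subfield_sum: "is_subfield F \<Longrightarrow> (\<And>i. i \<in> A \<Longrightarrow> f i \<in> F) \<Longrightarrow> sum f A \<in> F"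
  by (induction A rule: infinite_finite_induct) (auto intro: is_subfield_closed)

lemma is_subfield_Inter: "(\<And>F. F \<in> S \<Longrightarrow> is_subfield F) \<Longrightarrow> is_subfield (\<Inter> S)"
  by (auto simp: is_subfield_def)

lemma adjoin_subfield: "is_subfield (adjoin emb S)"
  unfolding adjoin_def hull_def by (rule is_subfield_Inter) auto

lemma adjoin_base: "emb c \<in> adjoin emb S" and adjoin_gen: "x \<in> S \<Longrightarrow> x \<in> adjoin emb S"
  unfolding adjoin_def by (auto intro: hull_inc)

lemma adjoin_least: "is_subfield F \<Longrightarrow> range emb \<subseteq> F \<Longrightarrow> S \<subseteq> F \<Longrightarrow> adjoin emb S \<subseteq> F"
  unfolding adjoin_def by (rule hull_minimal) auto

context fq_field begin

lemma ev_in_subfield: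
  assumes "is_subfield F" "range emb \<subseteq> F" "x \<in> F"
  shows "ev p x \<in> F"
  by (induction p) (use assms in \<open>auto simp: ev_pCons is_subfield_0 intro!: is_subfield_closed(2,6)[OF assms(1)]\<close>)

end

context rho_place begin

lemma adjoin_eta: "adjoin emb {\<eta>} = Eset"
proof
  have "range emb \<subseteq> Eset" by (auto simp: mem_Eset_iff emb_frob)
  then show "adjoin emb {\<eta>} \<subseteq> Eset" using eta_in_Eset by (intro adjoin_least Eset_subfield) auto
  have "ev p \<eta> \<in> adjoin emb {\<eta>}" for p
    by (rule ev_in_subfield[OF adjoin_subfield]) (auto intro: adjoin_base adjoin_gen)
  then show "Eset \<subseteq> adjoin emb {\<eta>}" by (auto simp: Eset_def)
qed

end

section \<open>Fractions and the ring $\mathcal A$\<close>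

text \<open>The condition under which the definite description in \<open>fract_lift\<close> is well
  defined. It passes to the lifted map, so \<open>iota\<close>, \<open>base_change\<close>,
  \<open>coeff_frob\<close> and \<open>iota_rho\<close> are all treated alike.\<close>

definition injective_hom :: "('a::idom \<Rightarrow> 'b::field) \<Rightarrow> bool" where
  "injective_hom H \<longleftrightarrow> (\<forall>x y. H (x + y) = H x + H y) \<and> (\<forall>x y. H (x * y) = H x * H y) \<and>
     (\<forall>x. H x = 0 \<longleftrightarrow> x = 0)"

context
  fixes H :: "'a::idom \<Rightarrow> 'b::field"
  assumes H: "injective_hom H"
begin

lemma injective_hom_simps:
  "H (x + y) = H x + H y" "H (x * y) = H x * H y" "H x = 0 \<longleftrightarrow> x = 0"
  using H by (auto simp: injective_hom_def)

lemma injective_hom_1: "H 1 = 1"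
  using injective_hom_simps(2)[of 1 1] injective_hom_simps(3)[of 1] by simp

lemma fract_lift_Fract: "d \<noteq> 0 \<Longrightarrow> fract_lift H (Fraction_Field.Fract n d) = H n / H d"
  unfolding fract_lift_def
proof (rule the_equality)
  assume d: "d \<noteq> 0"
  then show "\<exists>n' d'. d' \<noteq> 0 \<and> Fraction_Field.Fract n d = Fraction_Field.Fract n' d' \<and> H n / H d = H n' / H d'"
    by blast
  fix y assume "\<exists>n' d'. d' \<noteq> 0 \<and> Fraction_Field.Fract n d = Fraction_Field.Fract n' d' \<and> y = H n' / H d'"
  then obtain n' d' where *: "d' \<noteq> 0" "n * d' = n' * d" "y = H n' / H d'"
    using d by (auto simp: eq_fract)
  have "H n * H d' = H n' * H d" using *(2) by (metis injective_hom_simps(2))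
  then show "y = H n / H d" using * d by (simp add: injective_hom_simps frac_eq_eq)
qed

lemma fract_lift_of_ring: "fract_lift H (Fraction_Field.Fract n 1) = H n"
  by (subst fract_lift_Fract) (auto simp: injective_hom_1)

lemma injective_hom_fract_lift: "injective_hom (fract_lift H)"
proof -
  have "fract_lift H (x + y) = fract_lift H x + fract_lift H y \<and>
        fract_lift H (x * y) = fract_lift H x * fract_lift H y" for x y
    by (cases x, cases y) (auto simp: fract_lift_Fract injective_hom_simps field_simps)
  moreover have "fract_lift H x = 0 \<longleftrightarrow> x = 0" for x
    by (cases x) (auto simp: fract_lift_Fract injective_hom_simps Zero_fract_def eq_fract)
  ultimately show ?thesis by (auto simp: injective_hom_def)
qed

end

lemma Fract_power: "Fraction_Field.Fract a b ^ n = Fraction_Field.Fract (a ^ n) (b ^ n)"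
  by (induction n) (auto simp: One_fract_def)

text \<open>Euclid's lemma. The generator of the ideal (pi, b) divides pi; if it were not a unit, it
  would be an associate of pi, and pi would divide b.\<close>

lemma irreducible_poly_dvd_mult:
  fixes \<pi> :: "'a::field poly"
  assumes irr: "irreducible \<pi>" and dvd: "\<pi> dvd a * b" and "\<not> \<pi> dvd b"
  shows "\<pi> dvd a"
proof -
  define S where "S = {x * \<pi> + y * b | x y. True}"
  have pi: "\<pi> \<in> S" unfolding S_def by (rule CollectI, rule exI[of _ 1], rule exI[of _ 0]) simp
  have b: "b \<in> S" unfolding S_def by (rule CollectI, rule exI[of _ 0], rule exI[of _ 1]) simp
  have closed: "u - v * c \<in> S" if uv: "u \<in> S" "v \<in> S" for u v c
  proof -
    obtain x y x' y' where "u = x * \<pi> + y * b" "v = x' * \<pi> + y' * b"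
      using uv by (auto simp: S_def)
    then have "u - v * c = (x - x' * c) * \<pi> + (y - y' * c) * b" by (simp add: algebra_simps)
    then show ?thesis unfolding S_def by blast
  qed
  have "\<pi> \<noteq> 0" using irr by auto
  from poly_ideal_generator[OF pi this closed]
  obtain m where m: "m \<in> S" "m \<noteq> 0" "\<And>x. x \<in> S \<Longrightarrow> m dvd x" by metis
  obtain c where c: "\<pi> = m * c" using m(3)[OF pi] by auto
  have "m dvd 1"
  proof (rule ccontr)
    assume "\<not> m dvd 1"
    then have "c dvd 1" using irreducibleD[OF irr c] by blast
    then have "\<pi> dvd m" using c by (metis dvd_mult_unit_iff dvd_refl mult_unit_dvd_iff)
    then show False using m(3)[OF b] assms(3) dvd_trans by blast
  qed
  then obtain k where k: "1 = m * k" by (rule dvdE)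
  obtain x y where xy: "m = x * \<pi> + y * b" using m(1) by (auto simp: S_def)
  have "a * (m * k) = \<pi> * (a * x * k) + (a * b) * (y * k)" unfolding xy by (simp add: algebra_simps)
  then have "a = \<pi> * (a * x * k) + (a * b) * (y * k)" by (simp flip: k)
  moreover have "\<pi> dvd \<pi> * (a * x * k) + (a * b) * (y * k)"
    by (intro dvd_add dvd_triv_left dvd_mult2[OF dvd])
  ultimately show ?thesis by metis
qed

lemma irreducible_poly_dvd_power:
  fixes \<pi> :: "'a::field poly"
  assumes "irreducible \<pi>" "\<pi> dvd a ^ n"
  shows "\<pi> dvd a"
  using assms(2)
proof (induction n)
  case 0
  then show ?case using assms(1) by (simp add: irreducible_def)
next
  case (Suc n)
  then show ?case using irreducible_poly_dvd_mult[OF assms(1), of a "a ^ n"] by auto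
qed

text \<open>A divisor of least positive degree is irreducible. It is scaled to be monic because
  \<open>ringA\<close> tests regularity at monic polynomials.\<close>

lemma monic_irreducible_factor:
  fixes d :: "'a::field poly"
  assumes "degree d > 0"
  obtains \<pi> where "irreducible \<pi>" "lead_coeff \<pi> = 1" "\<pi> dvd d"
proof -
  have d0: "d \<noteq> 0" using assms by auto
  obtain m where m: "m dvd d" "degree m > 0"
    and min: "\<And>x. x dvd d \<Longrightarrow> degree x > 0 \<Longrightarrow> degree m \<le> degree x"
    using arg_min_nat_lemma[of "\<lambda>p. p dvd d \<and> degree p > 0" d degree] assms by auto
  define \<pi> where "\<pi> = smult (inverse (lead_coeff m)) m"
  have m0: "m \<noteq> 0" using m by auto
  have "\<pi> dvd d" using m m0 unfolding \<pi>_def by (intro smult_dvd) auto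
  moreover have "lead_coeff \<pi> = 1" using m0 by (simp add: \<pi>_def)
  moreover have deg: "degree \<pi> = degree m" using m0 by (simp add: \<pi>_def)
  moreover have "irreducible \<pi>"
  proof (rule irreducibleI)
    show "\<pi> \<noteq> 0" using m0 by (simp add: \<pi>_def)
    show "\<not> \<pi> dvd 1" using deg m(2) \<open>\<pi> \<noteq> 0\<close> by (simp add: is_unit_iff_degree)
    fix a b assume ab: "\<pi> = a * b"
    then have nz: "a \<noteq> 0" "b \<noteq> 0" using \<open>\<pi> \<noteq> 0\<close> by auto
    show "a dvd 1 \<or> b dvd 1"
    proof (cases "degree a = 0")
      case False
      moreover have "a dvd d" using ab \<open>\<pi> dvd d\<close> by (metis dvd_mult_left)
      ultimately have "degree m \<le> degree a" by (intro min) auto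
      then have "degree b = 0" using deg ab nz by (simp add: degree_mult_eq)
      then show ?thesis using nz by (simp add: is_unit_iff_degree)
    qed (use nz in \<open>simp add: is_unit_iff_degree\<close>)
  qed
  ultimately show ?thesis using that by blast
qed

lemma split_power:
  fixes p \<rho> :: "'a::field poly"
  assumes "p \<noteq> 0" "degree \<rho> > 0"
  obtains e r where "p = \<rho> ^ e * r" "\<not> \<rho> dvd r"
proof -
  have "\<exists>e r. p = \<rho> ^ e * r \<and> \<not> \<rho> dvd r" using assms(1)
  proof (induction "degree p" arbitrary: p rule: less_induct)
    case less
    show ?case
    proof (cases "\<rho> dvd p")
      case True
      then obtain p' where p': "p = \<rho> * p'" by auto
      then have "p' \<noteq> 0" "\<rho> \<noteq> 0" using less.prems by auto
      then have "degree p' < degree p" using assms(2) by (simp add: p' degree_mult_eq)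
      then obtain e r where "p' = \<rho> ^ e * r" "\<not> \<rho> dvd r" using less \<open>p' \<noteq> 0\<close> by blast
      then show ?thesis using p' by (intro exI[of _ "Suc e"] exI[of _ r]) (simp add: mult.assoc)
    next
      case False
      then show ?thesis by (intro exI[of _ 0] exI[of _ p]) simp
    qed
  qed
  then show ?thesis using that by blast
qed

context rho_place begin

abbreviation Fr :: "'f poly \<Rightarrow> nat \<Rightarrow> 'f poly fract" where
  "Fr n m \<equiv> Fraction_Field.Fract n (\<rho> ^ m)"

lemma degree_rho_power [simp]: "degree (\<rho> ^ m) = m * N"
  by (simp add: degree_power_eq N_eq)

lemma Fr_in_ringA: "degree n \<le> m * N \<Longrightarrow> Fr n m \<in> ringA \<rho>"
  unfolding ringA_def
proof (intro CollectI conjI allI impI)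
  assume "degree n \<le> m * N"
  then show "regular_at_infinity (Fr n m)" unfolding regular_at_infinity_def
    by (intro exI[of _ n] exI[of _ "\<rho> ^ m"]) simp
  fix \<pi> assume pi: "irreducible \<pi> \<and> lead_coeff \<pi> = 1 \<and> \<pi> \<noteq> \<rho>"
  have "\<not> \<pi> dvd \<rho> ^ m"
  proof
    assume "\<pi> dvd \<rho> ^ m"
    then have "\<pi> dvd \<rho>" using pi irreducible_poly_dvd_power by blast
    then obtain c where c: "\<rho> = \<pi> * c" by auto
    have "\<not> \<pi> dvd 1" using pi by (simp add: irreducible_def)
    then have "c dvd 1" using irreducibleD[OF irr c] by blast
    then have "degree c = 0" by (metis is_unit_iff_degree dvd_0_left_iff one_neq_zero)
    then obtain k where k: "c = [:k:]" by (rule degree_eq_zeroE)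
    then have "lead_coeff \<rho> = k * lead_coeff \<pi>" using c by (simp only: lead_coeff_mult) simp
    then have "k = 1" using monic pi by simp
    then show False using c k pi by simp
  qed
  then show "regular_at \<pi> (Fr n m)" unfolding regular_at_def by blast
qed

text \<open>Take a denominator of least degree. A prime factor other than rho could be cancelled,
  since regularity there forces it to divide the numerator; so only rho and a constant remain.
  Regularity at infinity then bounds the numerator.\<close>

lemma ringA_cases:
  assumes "a \<in> ringA \<rho>"
  obtains n m where "a = Fr n m" "degree n \<le> m * N"
proof -
  define Q where "Q d \<longleftrightarrow> d \<noteq> 0 \<and> (\<exists>n. a = Fraction_Field.Fract n d)" for d
  obtain n0 d0 where "a = Fraction_Field.Fract n0 d0" "d0 \<noteq> 0" by (cases a) auto
  then have "Q d0" by (auto simp: Q_def)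
  then obtain d where d: "Q d" and min: "\<And>x. Q x \<Longrightarrow> degree d \<le> degree x"
    using arg_min_nat_lemma[of Q d0 degree] by blast
  then obtain n where n: "d \<noteq> 0" "a = Fraction_Field.Fract n d" by (auto simp: Q_def)
  obtain e r where er: "d = \<rho> ^ e * r" "\<not> \<rho> dvd r"
    using split_power[OF n(1), of \<rho>] N_pos N_eq by metis
  have r0: "r \<noteq> 0" using er by auto
  have "degree r = 0"
  proof (rule ccontr)
    assume "degree r \<noteq> 0"
    then obtain \<pi> where pi: "irreducible \<pi>" "lead_coeff \<pi> = 1" "\<pi> dvd r"
      using monic_irreducible_factor[of r] by auto
    then have "\<pi> \<noteq> \<rho>" using er by auto
    then obtain n' d' where d': "\<not> \<pi> dvd d'" "a = Fraction_Field.Fract n' d'"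
      using assms pi by (auto simp: ringA_def regular_at_def)
    then have "d' \<noteq> 0" by auto
    then have eq: "n * d' = n' * d" using d' n by (auto simp: eq_fract)
    have pd: "\<pi> dvd d" using pi er by simp
    then have "\<pi> dvd n * d'" using eq by simp
    then have "\<pi> dvd n" using irreducible_poly_dvd_mult[OF pi(1)] d' by blast
    then obtain n1 d1 where nd: "n = \<pi> * n1" "d = \<pi> * d1" using pd by (auto elim!: dvdE)
    have nz: "\<pi> \<noteq> 0" "d1 \<noteq> 0" using nd n by auto
    then have "a = Fraction_Field.Fract n1 d1" using n nd by (simp add: eq_fract)
    then have "Q d1" using nz by (auto simp: Q_def)
    then have "degree d \<le> degree d1" by (rule min)
    moreover have "degree \<pi> > 0" using pi(1) nz
      by (metis gr0I irreducible_def is_unit_iff_degree)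
    ultimately show False using nd nz by (simp add: degree_mult_eq)
  qed
  then obtain k where k: "r = [:k:]" by (rule degree_eq_zeroE)
  then have k0: "k \<noteq> 0" using r0 by simp
  have a: "a = Fr (smult (inverse k) n) e" using n er k k0 by (auto simp: eq_fract)
  obtain n' d' where d': "d' \<noteq> 0" "degree n' \<le> degree d'" "a = Fraction_Field.Fract n' d'"
    using assms by (auto simp: ringA_def regular_at_infinity_def)
  have eq: "smult (inverse k) n * d' = n' * \<rho> ^ e" using a d' by (simp add: eq_fract)
  have "degree (smult (inverse k) n) \<le> e * N"
  proof (cases "n = 0")
    case False
    then have nz: "n' \<noteq> 0" "smult (inverse k) n \<noteq> 0" using eq d' k0 by auto
    have "degree (smult (inverse k) n) + degree d' = degree n' + e * N"
      using arg_cong[OF eq, of degree] nz d' by (simp add: degree_mult_eq del: mult_smult_left degree_smult_eq)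
    then show ?thesis using d' by simp
  qed simp
  then show ?thesis using a that by blast
qed

text \<open>In this form \<open>m\<close> is the pole order at rho, and the rank one condition
  prescribes the degree \<open>m * N\<close>. Each cancelled rho lowers the degree of the numerator
  by N, which preserves the bound.\<close>

lemma ringA_cases_coprime:
  assumes "a \<in> ringA \<rho>" "a \<noteq> 0"
  obtains n m where "a = Fr n m" "degree n \<le> m * N" "\<not> \<rho> dvd n"
proof -
  obtain n0 m0 where a0: "a = Fr n0 m0" "degree n0 \<le> m0 * N"
    using ringA_cases[OF assms(1)] by blast
  have "\<exists>n m. a = Fr n m \<and> degree n \<le> m * N \<and> \<not> \<rho> dvd n" using a0
  proof (induction m0 arbitrary: n0)
    case 0
    then have "degree n0 = 0" "n0 \<noteq> 0" using assms by (auto simp: Zero_fract_def eq_fract)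
    then have "\<not> \<rho> dvd n0" using dvd_imp_degree_le[of \<rho> n0] N_pos N_eq by auto
    then show ?case using 0 by blast
  next
    case (Suc m)
    show ?case
    proof (cases "\<rho> dvd n0")
      case True
      then obtain n1 where n1: "n0 = \<rho> * n1" by auto
      show ?thesis
      proof (rule Suc.IH)
        show "a = Fr n1 m" using Suc.prems n1 by (simp add: eq_fract)
        have "n1 \<noteq> 0" using Suc.prems assms n1 by (auto simp: Zero_fract_def eq_fract)
        then show "degree n1 \<le> m * N" using Suc.prems(2) n1 by (simp add: degree_mult_eq N_eq)
      qed
    qed (use Suc.prems in blast)
  qed
  then show ?thesis using that by blast
qed

lemma ringA_add: assumes "a \<in> ringA \<rho>" "b \<in> ringA \<rho>" shows "a + b \<in> ringA \<rho>"
proof -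
  obtain n m where a: "a = Fr n m" "degree n \<le> m * N" using ringA_cases[OF assms(1)] .
  obtain n' m' where b: "b = Fr n' m'" "degree n' \<le> m' * N" using ringA_cases[OF assms(2)] .
  have "a + b = Fr (n * \<rho> ^ m' + n' * \<rho> ^ m) (m + m')" using a b by (simp add: power_add)
  moreover have "degree (n * \<rho> ^ m' + n' * \<rho> ^ m) \<le> (m + m') * N"
    using a b by (intro degree_add_le order.trans[OF degree_mult_le]) (auto simp: algebra_simps)
  ultimately show ?thesis by (simp only: Fr_in_ringA)
qed

lemma ringA_mult: assumes "a \<in> ringA \<rho>" "b \<in> ringA \<rho>" shows "a * b \<in> ringA \<rho>"
proof -
  obtain n m where a: "a = Fr n m" "degree n \<le> m * N" using ringA_cases[OF assms(1)] .
  obtain n' m' where b: "b = Fr n' m'" "degree n' \<le> m' * N" using ringA_cases[OF assms(2)] .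
  have "a * b = Fr (n * n') (m + m')" using a b by (simp add: power_add)
  moreover have "degree (n * n') \<le> (m + m') * N"
    using a b by (intro order.trans[OF degree_mult_le]) (auto simp: algebra_simps)
  ultimately show ?thesis by (simp only: Fr_in_ringA)
qed

lemma constA_alt: "constA c = Fr [:c:] 0" by (simp add: constA_def)
lemma constA_in_ringA: "constA c \<in> ringA \<rho>" unfolding constA_alt by (rule Fr_in_ringA) simp
lemma genT_alt: "genT \<rho> n = Fr (monom 1 n) 1" by (simp add: genT_def)
lemma genT_in_ringA: "n \<le> N \<Longrightarrow> genT \<rho> n \<in> ringA \<rho>" unfolding genT_alt
  by (rule Fr_in_ringA) (simp add: degree_monom_eq)
lemma one_in_ringA: "1 \<in> ringA \<rho>" using constA_in_ringA[of 1] by (simp add: constA_def One_fract_def one_pCons)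
lemma zero_in_ringA: "0 \<in> ringA \<rho>" using constA_in_ringA[of 0] by (simp add: constA_def Zero_fract_def)

lemma ringA_power: "a \<in> ringA \<rho> \<Longrightarrow> a ^ n \<in> ringA \<rho>"
  by (induction n) (auto intro: one_in_ringA ringA_mult)

abbreviation io :: "'f poly fract \<Rightarrow> 'l" where "io \<equiv> iota emb \<theta>"

lemma iota_injective_hom: "injective_hom (\<lambda>p. ev p \<theta>)"
  using ev_theta_nz by (auto simp: injective_hom_def ev_add ev_mult)

lemma iota_alt: "io = fract_lift (\<lambda>p. ev p \<theta>)"
  by (simp add: iota_def ev_def)

lemma iota_Fract: "d \<noteq> 0 \<Longrightarrow> io (Fraction_Field.Fract n d) = ev n \<theta> / ev d \<theta>"
  unfolding iota_alt by (rule fract_lift_Fract[OF iota_injective_hom])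

lemma iota_add: "io (a + b) = io a + io b" and iota_mult: "io (a * b) = io a * io b"
  unfolding iota_alt by (rule injective_hom_simps[OF injective_hom_fract_lift[OF iota_injective_hom]])+

lemma iota_constA: "io (constA c) = emb c"
  by (simp add: constA_def iota_Fract)

text \<open>The q^j-th power of iota(a) is the value of a at t = theta^(q^j).\<close>

lemma iota_frob: "d \<noteq> 0 \<Longrightarrow> io (Fraction_Field.Fract n d) ^ (q ^ j) = ev n (th j) / ev d (th j)"
  by (simp add: iota_Fract power_divide ev_th)

lemma iota_genT_frob: "io (genT \<rho> n) ^ (q ^ j) = th j ^ n / ev \<rho> (th j)"
  by (simp add: genT_def iota_frob ev_monom)

end

section \<open>The completion at $\rho$ and the sign function\<close>

context rho_place begin

text \<open>The Taylor expansion p(eta + X). The image of a polynomial in the completion is again a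
  polynomial, so its coefficients and its valuation can be read off here.\<close>

definition expand :: "'f poly \<Rightarrow> 'l poly" where
  "expand p = pcompose (map_poly emb p) [:\<eta>, 1:]"

abbreviation fls_of_poly :: "'l poly \<Rightarrow> 'l fls" where
  "fls_of_poly p \<equiv> fps_to_fls (fps_of_poly p)"

lemma eval_rho_alt: "eval_rho emb \<eta> p = fls_of_poly (expand p)"
proof (induction p)
  case (pCons a p)
  have "eval_rho emb \<eta> (pCons a p) = fls_const (emb a) + (fls_const \<eta> + fls_X) * eval_rho emb \<eta> p"
    by (simp add: eval_rho_def map_poly_pCons)
  also have "\<dots> = fls_of_poly (expand (pCons a p))"
    by (simp add: pCons expand_def map_poly_pCons pcompose_pCons fps_of_poly_add fps_of_poly_mult
        fls_times_fps_to_fls fps_of_poly_const fps_of_poly_pCons fps_of_poly_linear fps_of_poly_smult algebra_simps)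
  finally show ?case .
qed (simp add: eval_rho_def expand_def)

lemma coeff_expand_0: "coeff (expand p) 0 = ev p \<eta>"
  by (simp add: expand_def pcompose_coeff_0 ev_def)

lemma expand_add: "expand (p + r) = expand p + expand r"
proof -
  have "map_poly emb (p + r) = map_poly emb p + map_poly emb r"
    by (rule poly_eqI) (simp add: coeff_map_poly emb_add)
  then show ?thesis by (simp add: expand_def pcompose_add)
qed

lemma expand_mult: "expand (p * r) = expand p * expand r"
  by (simp add: expand_def map_emb_mult pcompose_mult)

lemma expand_power: "expand (p ^ n) = expand p ^ n"
  by (induction n) (simp_all add: expand_mult, simp add: expand_def pcompose_1)

lemma expand_eq_0_iff: "expand p = 0 \<longleftrightarrow> p = 0"
  by (simp add: expand_def pcompose_eq_0_iff)

lemma eval_rho_injective_hom: "injective_hom (eval_rho emb \<eta>)"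
  by (simp add: injective_hom_def eval_rho_alt expand_add expand_mult expand_eq_0_iff
      fps_of_poly_add fps_of_poly_mult fls_times_fps_to_fls)

lemma eval_rho_power: "eval_rho emb \<eta> (p ^ n) = eval_rho emb \<eta> p ^ n"
  by (simp add: eval_rho_alt expand_power fps_of_poly_power fps_to_fls_power)

lemma coeff_expand_in_Eset: "coeff (expand p) i \<in> Eset"
proof (induction p arbitrary: i)
  case 0
  then show ?case by (simp add: expand_def mem_Eset_iff)
next
  case (pCons a p)
  have *: "expand (pCons a p) = [:emb a:] + [:\<eta>, 1:] * expand p"
    by (simp add: expand_def map_poly_pCons pcompose_pCons)
  have "emb a \<in> Eset" by (simp add: mem_Eset_iff emb_frob)
  then show ?case unfolding *
    by (auto simp: coeff_pCons pCons.IH eta_in_Eset split: nat.splits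
        intro!: is_subfield_closed[OF Eset_subfield])
qed

lemma subdegree_eval_rho_unit:
  assumes "\<not> \<rho> dvd n" shows "fls_subdegree (eval_rho emb \<eta> n) = 0"
proof -
  have "ev n \<eta> \<noteq> 0" using assms by (simp add: ev_eta_eq_0_iff)
  then have "fps_nth (fps_of_poly (expand n)) 0 \<noteq> 0" by (simp add: coeff_expand_0)
  then have "subdegree (fps_of_poly (expand n)) = 0" by (simp add: subdegree_eq_0)
  then show ?thesis by (simp add: eval_rho_alt fls_subdegree_fls_to_fps)
qed

text \<open>Among the factors X + eta - eta^(i) of the expansion only the one with i = 0 lacks a
  constant term.\<close>

lemma subdegree_eval_rho_rho: "fls_subdegree (eval_rho emb \<eta> \<rho>) = 1"
proof -
  obtain M where M: "N = Suc M" using N_pos gr0_implies_Suc by blast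
  have "expand \<rho> = (\<Prod>i<N. [:\<eta> - h i, 1:])"
    by (simp add: expand_def rho_factor pcompose_prod pcompose_pCons)
  also have "\<dots> = [:0, 1:] * (\<Prod>i<M. [:\<eta> - h (Suc i), 1:])"
    by (simp add: M prod.lessThan_Suc_shift del: prod.lessThan_Suc)
  finally have e: "expand \<rho> = [:0, 1:] * (\<Prod>i<M. [:\<eta> - h (Suc i), 1:])" .
  have "\<eta> \<noteq> h (Suc i)" if "i < M" for i
    using h_inj[of 0 "Suc i"] that M by auto
  then have nz: "fps_nth (fps_of_poly (\<Prod>i<M. [:\<eta> - h (Suc i), 1:])) 0 \<noteq> 0"
    by (simp add: poly_0_coeff_0[symmetric] poly_prod)
  then have nz': "fps_of_poly (\<Prod>i<M. [:\<eta> - h (Suc i), 1:]) \<noteq> 0" by force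
  have "subdegree (fps_of_poly (expand \<rho>)) = 1"
    unfolding e fps_of_poly_mult using nz nz'
    by (simp add: subdegree_mult subdegree_eq_0)
  then show ?thesis by (simp add: eval_rho_alt fls_subdegree_fls_to_fps)
qed

lemma iota_rho_Fr:
  "iota_rho emb \<eta> (Fr n m) = eval_rho emb \<eta> n / eval_rho emb \<eta> \<rho> ^ m"
  unfolding iota_rho_def by (simp add: fract_lift_Fract[OF eval_rho_injective_hom] eval_rho_power)

lemma subdegree_iota_rho:
  assumes "\<not> \<rho> dvd n" shows "fls_subdegree (iota_rho emb \<eta> (Fr n m)) = - int m"
proof -
  have "n \<noteq> 0" using assms by auto
  then have "eval_rho emb \<eta> n \<noteq> 0" "eval_rho emb \<eta> \<rho> \<noteq> 0"
    by (simp_all add: injective_hom_simps[OF eval_rho_injective_hom])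
  then show ?thesis
    by (simp add: iota_rho_Fr divide_inverse fls_subdegree_pow subdegree_eval_rho_unit[OF assms]
        subdegree_eval_rho_rho)
qed

text \<open>Powers of rho do not affect the sign, and n is n(eta) times the 1-unit \<open>w\<close>.
  Uniqueness comes from comparing constant terms after the power of rho is cancelled.\<close>

lemma Sgn_iota_rho:
  assumes n: "\<not> \<rho> dvd n"
  shows "Sgn emb \<rho> \<eta> (iota_rho emb \<eta> (Fr n m)) = ev n \<eta>"
  unfolding Sgn_def
proof (rule the_equality)
  define x where "x = iota_rho emb \<eta> (Fr n m)"
  define R where "R = eval_rho emb \<eta> \<rho>"
  have R: "R \<noteq> 0" by (simp add: R_def injective_hom_simps[OF eval_rho_injective_hom])
  have nz: "ev n \<eta> \<noteq> 0" using n by (simp add: ev_eta_eq_0_iff)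
  have sx: "fls_subdegree x = - int m" unfolding x_def by (rule subdegree_iota_rho[OF n])
  define w where "w = fls_const (inverse (ev n \<eta>)) * eval_rho emb \<eta> n"
  have x: "x = eval_rho emb \<eta> n * R powi (- int m)"
    by (simp add: x_def R_def iota_rho_Fr power_int_minus divide_inverse)
  have w_nth: "fls_nth w i = inverse (ev n \<eta>) * fls_nth (eval_rho emb \<eta> n) i" for i
    by (simp add: w_def)
  have ev_E: "ev n \<eta> \<in> Eset" by (simp add: Eset_def)
  have w1: "w \<in> K_rho emb \<eta>"
    unfolding K_rho_def adjoin_eta
  proof (intro CollectI allI)
    fix i
    have "fls_nth (eval_rho emb \<eta> n) i \<in> Eset"
      by (auto simp: eval_rho_alt coeff_expand_in_Eset is_subfield_0[OF Eset_subfield])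
    then show "fls_nth w i \<in> Eset" unfolding w_nth
      by (intro is_subfield_closed[OF Eset_subfield] ev_E)
  qed
  have nz': "eval_rho emb \<eta> n \<noteq> 0" using nz
    by (auto simp: injective_hom_simps[OF eval_rho_injective_hom])
  have "fls_nth (eval_rho emb \<eta> n) 0 = ev n \<eta>" by (simp add: eval_rho_alt coeff_expand_0)
  then have w2: "one_unit w" using nz nz'
    by (simp add: one_unit_def w_nth) (simp add: w_def subdegree_eval_rho_unit[OF n])
  have cw: "fls_const (ev n \<eta>) * w = eval_rho emb \<eta> n"
    using nz by (simp add: w_def mult.assoc[symmetric] fls_const_mult_const)
  show "ev n \<eta> \<in> adjoin emb {\<eta>} \<and> ev n \<eta> \<noteq> 0 \<and>
    (\<exists>w\<in>K_rho emb \<eta>. one_unit w \<and> iota_rho emb \<eta> (Fr n m) =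
       fls_const (ev n \<eta>) * eval_rho emb \<eta> \<rho> powi fls_subdegree (iota_rho emb \<eta> (Fr n m)) * w)"
    unfolding x_def[symmetric] R_def[symmetric] sx
    using nz ev_E w1 w2 cw x by (auto simp: adjoin_eta intro!: bexI[of _ w] simp: mult_ac)
  fix s assume s: "s \<in> adjoin emb {\<eta>} \<and> s \<noteq> 0 \<and>
    (\<exists>w\<in>K_rho emb \<eta>. one_unit w \<and> iota_rho emb \<eta> (Fr n m) =
       fls_const s * eval_rho emb \<eta> \<rho> powi fls_subdegree (iota_rho emb \<eta> (Fr n m)) * w)"
  then obtain w' where w': "one_unit w'" "x = fls_const s * R powi (- int m) * w'"
    unfolding x_def[symmetric] R_def[symmetric] sx by blast
  have "(fls_const s * w') * R powi (- int m) = (fls_const (ev n \<eta>) * w) * R powi (- int m)"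
    using x w'(2) cw by (simp add: mult_ac)
  moreover have "R powi (- int m) \<noteq> 0" using R by simp
  ultimately have "fls_const s * w' = fls_const (ev n \<eta>) * w" by (metis mult_right_cancel)
  then have "fls_nth (fls_const s * w') 0 = fls_nth (fls_const (ev n \<eta>) * w) 0" by simp
  then show "s = ev n \<eta>" using w2 w'(1) by (simp add: one_unit_def)
qed

lemma rank_one_degree:
  assumes "rank_one_Drinfeld emb \<rho> \<theta> \<eta> \<Phi>" "\<not> \<rho> dvd n" "degree n \<le> m * N"
  shows "degree (\<Phi> (Fr n m)) = m * N"
proof -
  have "Fr n m \<noteq> 0" using assms(2) by (auto simp: Zero_fract_def eq_fract)
  then have "int (degree (\<Phi> (Fr n m))) = int N * int m"
    using assms(1) Fr_in_ringA[OF assms(3)] subdegree_iota_rho[OF assms(2), of m]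
    by (simp add: rank_one_Drinfeld_def N_eq)
  then have "int (degree (\<Phi> (Fr n m))) = int (m * N)" by simp
  then show ?thesis by (simp only: of_nat_eq_iff)
qed

end

section \<open>Skew polynomials\<close>

context fq_field begin

text \<open>The summation range is free of the degrees of \<open>f\<close> and \<open>g\<close>, so
  that identities can be checked coefficient by coefficient.\<close>

lemma coeff_skew_mult:
  fixes f g :: "'l poly"
  shows "coeff (skew_mult q f g) n = (\<Sum>i\<le>n. coeff f i * coeff g (n - i) ^ (q ^ i))"
proof -
  have inner: "(\<Sum>j\<le>degree g. coeff (monom (coeff f i * coeff g j ^ (q ^ i)) (i + j)) n) =
      (if i \<le> n then coeff f i * coeff g (n - i) ^ (q ^ i) else 0)" for i
  proof (cases "i \<le> n")
    case True
    have "(\<Sum>j\<le>degree g. coeff (monom (coeff f i * coeff g j ^ (q ^ i)) (i + j)) n) =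
        (\<Sum>j\<le>degree g. if j = n - i then coeff f i * coeff g (n - i) ^ (q ^ i) else 0)"
      using True by (intro sum.cong) auto
    also have "\<dots> = coeff f i * coeff g (n - i) ^ (q ^ i)"
      by (auto simp: sum.delta coeff_eq_0 frob_0)
    finally show ?thesis using True by simp
  qed (auto intro!: sum.neutral)
  have "coeff (skew_mult q f g) n =
      (\<Sum>i\<le>degree f. if i \<le> n then coeff f i * coeff g (n - i) ^ (q ^ i) else 0)"
    unfolding skew_mult_def coeff_sum inner ..
  also have "\<dots> = (\<Sum>i | i \<le> degree f \<and> i \<le> n. coeff f i * coeff g (n - i) ^ (q ^ i))"
    by (rule sum.mono_neutral_cong_right) auto
  also have "\<dots> = (\<Sum>i\<le>n. coeff f i * coeff g (n - i) ^ (q ^ i))"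
    by (rule sum.mono_neutral_left) (auto intro: le_degree)
  finally show ?thesis .
qed

lemma skew_mult_add_left: "skew_mult q (f + g) r = skew_mult q f r + skew_mult q (g :: 'l poly) r"
  by (rule poly_eqI) (simp add: coeff_skew_mult sum.distrib algebra_simps)

lemma skew_mult_smult_left: "skew_mult q (smult c f) r = smult (c :: 'l) (skew_mult q f r)"
  by (rule poly_eqI) (simp add: coeff_skew_mult sum_distrib_left mult.assoc)

lemma skew_mult_0_left [simp]: "skew_mult q 0 r = (0 :: 'l poly)"
  by (rule poly_eqI) (simp add: coeff_skew_mult)

lemma skew_mult_sum_left: "skew_mult q (sum F A) r = (\<Sum>x\<in>A. skew_mult q (F x) (r :: 'l poly))"
  by (induction A rule: infinite_finite_induct) (auto simp: skew_mult_add_left)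

lemma coeff_skew_mult_linear:
  "coeff (skew_mult q [:a, b:] r) n =
     a * coeff r n + (case n of 0 \<Rightarrow> 0 | Suc m \<Rightarrow> b * coeff r m ^ q)" for a b :: 'l
proof (cases n)
  case (Suc m)
  have "(\<Sum>i\<le>m. coeff [:a, b:] (Suc i) * coeff r (m - i) ^ (q ^ Suc i)) =
      (\<Sum>i\<le>m. if i = 0 then b * coeff r m ^ q else 0)"
    by (intro sum.cong) (auto simp: coeff_pCons split: nat.splits)
  then show ?thesis
    by (simp add: Suc coeff_skew_mult sum.atMost_Suc_shift del: sum.atMost_Suc)
qed (simp add: coeff_skew_mult)

lemma skew_mult_const: "skew_mult q [:c:] r = smult (c :: 'l) r"
  using coeff_skew_mult_linear[of c 0] by (intro poly_eqI) (simp split: nat.splits)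

lemma skew_mult_1_left [simp]: "skew_mult q 1 r = (r :: 'l poly)"
  using skew_mult_const[of 1 r] by (simp add: one_pCons)

text \<open>Associativity for a linear left factor, the way in which \<open>skew_prod\<close> grows.
  The twist by tau is harmless because the q-th power is additive.\<close>

lemma skew_mult_linear_assoc:
  "skew_mult q [:a, b:] (skew_mult q P R) = skew_mult q (skew_mult q [:a, b:] P) (R :: 'l poly)"
proof (rule poly_eqI)
  fix n
  show "coeff (skew_mult q [:a, b:] (skew_mult q P R)) n =
      coeff (skew_mult q (skew_mult q [:a, b:] P) R) n"
  proof (cases n)
    case (Suc m)
    have "(\<Sum>i\<le>m. coeff P i * coeff R (m - i) ^ (q ^ i)) ^ q =
        (\<Sum>i\<le>m. coeff P i ^ q * coeff R (m - i) ^ (q ^ Suc i))"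
      using frob_sum[of "\<lambda>i. coeff P i * coeff R (m - i) ^ (q ^ i)" "{..m}" 1]
      by (simp add: power_mult_distrib frob_Suc del: power_Suc)
    moreover have "coeff (skew_mult q [:a, b:] (skew_mult q P R)) n =
        a * (\<Sum>i\<le>Suc m. coeff P i * coeff R (Suc m - i) ^ (q ^ i)) +
        b * (\<Sum>i\<le>m. coeff P i * coeff R (m - i) ^ (q ^ i)) ^ q"
      by (simp only: coeff_skew_mult_linear Suc nat.case coeff_skew_mult[of P R])
    moreover have "coeff (skew_mult q (skew_mult q [:a, b:] P) R) n =
        (\<Sum>i\<le>Suc m. (a * coeff P i + (case i of 0 \<Rightarrow> 0 | Suc k \<Rightarrow> b * coeff P k ^ q)) *
           coeff R (Suc m - i) ^ (q ^ i))"
      by (simp only: coeff_skew_mult[of "skew_mult q [:a, b:] P"] coeff_skew_mult_linear Suc)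
    ultimately show ?thesis
      by (simp add: sum.atMost_Suc_shift sum.distrib sum_distrib_left algebra_simps
          del: sum.atMost_Suc power_Suc)
  next
    case 0
    then show ?thesis by (simp add: coeff_skew_mult_linear coeff_skew_mult mult.assoc)
  qed
qed

lemma skew_prod_add:
  "skew_prod q (\<lambda>i. [:a i, b i :: 'l:]) (l + n) =
     skew_mult q (skew_prod q (\<lambda>i. [:a (l + i), b (l + i):]) n) (skew_prod q (\<lambda>i. [:a i, b i:]) l)"
  by (induction n) (simp_all add: skew_mult_linear_assoc)

lemma skew_prod_cong:
  "(\<And>i. i < n \<Longrightarrow> f i = g i) \<Longrightarrow> skew_prod q f n = skew_prod q g n"
  by (induction n) auto

lemma coeff_skew_mult_top:
  fixes f g :: "'l poly"
  assumes "degree f \<le> m" "degree g \<le> n"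
  shows "coeff (skew_mult q f g) (m + n) = coeff f m * coeff g n ^ (q ^ m)"
proof -
  have "(\<Sum>i\<le>m + n. coeff f i * coeff g (m + n - i) ^ (q ^ i)) =
      (\<Sum>i\<le>m + n. if i = m then coeff f m * coeff g n ^ (q ^ m) else 0)"
  proof (intro sum.cong refl)
    fix i assume "i \<in> {..m + n}"
    then consider "i = m" | "i > m" | "m + n - i > n" by fastforce
    then show "coeff f i * coeff g (m + n - i) ^ (q ^ i) =
        (if i = m then coeff f m * coeff g n ^ (q ^ m) else 0)"
      using assms by cases (auto simp: coeff_eq_0 frob_0)
  qed
  then show ?thesis by (simp add: coeff_skew_mult)
qed

lemma degree_skew_mult_le:
  fixes f g :: "'l poly"
  shows "degree (skew_mult q f g) \<le> degree f + degree g"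
proof (rule degree_le, intro allI impI)
  fix k assume k: "degree f + degree g < k"
  show "coeff (skew_mult q f g) k = 0" unfolding coeff_skew_mult
  proof (intro sum.neutral ballI)
    fix i assume "i \<in> {..k}"
    then consider "i > degree f" | "k - i > degree g" using k by fastforce
    then show "coeff f i * coeff g (k - i) ^ (q ^ i) = 0"
      by cases (auto simp: coeff_eq_0 frob_0)
  qed
qed

end

section \<open>Evaluation of skew polynomials along the Frobenius orbit of $\theta$\<close>

text \<open>Divided by the product of all x - b m, the basis consists of the products of (x - a m) /
  (x - b m) over m < i, which are the s_i up to constants. At x = b (D - 1) every term with i < D
  vanishes; this yields the second clause and later the leading coefficients.\<close>

lemma newton_basis:
  fixes a b :: "nat \<Rightarrow> 'l::field"
  assumes ab: "\<And>i j. a i \<noteq> b j" and "degree p \<le> D"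
  shows "\<exists>c. (\<forall>x. poly p x = (\<Sum>i\<le>D. c i * ((\<Prod>m<i. x - a m) * (\<Prod>m=i..<D. x - b m)))) \<and>
    (D > 0 \<longrightarrow> c D * (\<Prod>m<D. b (D - 1) - a m) = poly p (b (D - 1)))"
  using assms(2)
proof (induction D arbitrary: p)
  case 0
  then obtain k where "p = [:k:]" by (metis degree_eq_zeroE le_zero_eq)
  then show ?case by (intro exI[of _ "\<lambda>_. k"]) simp
next
  case (Suc D)
  define A where "A = (\<Prod>m<Suc D. [:- a m, 1:])"
  have degA: "degree A = Suc D"
    unfolding A_def by (subst degree_prod_eq_sum_degree) auto
  have polyA: "poly A x = (\<Prod>m<Suc D. x - a m)" for x by (simp add: A_def poly_prod del: prod.lessThan_Suc)
  have Ab: "poly A (b D) \<noteq> 0" using ab[THEN not_sym] unfolding polyA by (subst prod_zero_iff) auto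
  \<comment> \<open>Subtracting \<open>k\<close> times the full product \<open>A\<close> creates a
    zero at \<open>b D\<close>. Dividing it out lowers the degree bound by one.\<close>
  define k where "k = poly p (b D) / poly A (b D)"
  have "poly (p - smult k A) (b D) = 0" using Ab by (simp add: k_def)
  then have "[:- b D, 1:] dvd p - smult k A" by (simp only: poly_eq_0_iff_dvd)
  then obtain r where r: "p - smult k A = [:- b D, 1:] * r" by (rule dvdE)
  have deg: "degree (p - smult k A) \<le> Suc D"
    using Suc.prems degA by (intro degree_diff_le) auto
  have "degree r \<le> D"
  proof (cases "r = 0")
    case False
    then have "degree ([:- b D, 1:] * r) = Suc (degree r)" by (subst degree_mult_eq) auto
    then show ?thesis using deg r by simp
  qed simp
  from Suc.IH[OF this] obtain c where
    c: "\<And>x. poly r x = (\<Sum>i\<le>D. c i * ((\<Prod>m<i. x - a m) * (\<Prod>m=i..<D. x - b m)))" by blast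
  define c' where "c' = c(Suc D := k)"
  have "poly p x = (\<Sum>i\<le>Suc D. c' i * ((\<Prod>m<i. x - a m) * (\<Prod>m=i..<Suc D. x - b m)))" for x
  proof -
    have "poly p x = poly (p - smult k A) x + k * poly A x" by simp
    also have "poly (p - smult k A) x = (x - b D) * poly r x" unfolding r by (simp add: algebra_simps)
    also have "\<dots> = (\<Sum>i\<le>D. c' i * ((\<Prod>m<i. x - a m) * (\<Prod>m=i..<Suc D. x - b m)))"
      unfolding c sum_distrib_left
      by (intro sum.cong refl) (simp add: c'_def mult_ac)
    also have "k * poly A x = c' (Suc D) * ((\<Prod>m<Suc D. x - a m) * (\<Prod>m=Suc D..<Suc D. x - b m))"
      by (simp add: c'_def polyA)
    finally show ?thesis by simp
  qed
  moreover have "c' (Suc D) * (\<Prod>m<Suc D. b D - a m) = poly p (b D)"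
    using Ab by (simp add: c'_def polyA[symmetric] k_def del: prod.lessThan_Suc)
  ultimately show ?case by (intro exI[of _ c']) (simp del: prod.lessThan_Suc sum.atMost_Suc)
qed

lemma sum_triangle_swap:
  fixes f :: "nat \<Rightarrow> nat \<Rightarrow> 'a::comm_monoid_add"
  shows "(\<Sum>n\<le>j. \<Sum>i\<le>n. f i (n - i)) = (\<Sum>i\<le>j. \<Sum>l\<le>j - i. f i l)"
proof -
  have "{(i, l). i + l \<le> j} = Sigma {..j} (\<lambda>i. {..j - i})" by auto
  then show ?thesis
    unfolding sum.triangle_reindex_eq[symmetric] by (simp add: sum.Sigma)
qed

context rho_place begin

text \<open>The value at t = theta^(q^j) of s_i, built from f = g (1/(t - eta^(k)) - 1/(theta -
  eta^(k))). The m-th factor is f with its coefficients raised to the power q^m.\<close>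

definition S :: "nat \<Rightarrow> 'l \<Rightarrow> nat \<Rightarrow> nat \<Rightarrow> 'l" where
  "S k g i j = (\<Prod>m<i. g ^ (q ^ m) * (1 / (th j - h (k + m)) - 1 / (th m - h (k + m))))"

text \<open>The sum may stop at j because s_i vanishes at theta^(q^j) for i > j;
  \<open>G_eq_degree\<close> gives the version bounded by the degree.\<close>

definition G :: "nat \<Rightarrow> 'l \<Rightarrow> 'l poly \<Rightarrow> nat \<Rightarrow> 'l" where
  "G k g P j = (\<Sum>i\<le>j. coeff P i * S k g i j)"

lemma S_0 [simp]: "S k g 0 j = 1" by (simp add: S_def)

lemma S_1: "S k g (Suc 0) j = g * (1 / (th j - h k) - 1 / (\<theta> - h k))"
  by (simp add: S_def)

lemma S_gt: "j < i \<Longrightarrow> S k g i j = 0"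
  unfolding S_def by (rule prod_zero) auto

lemma S_diag: "g \<noteq> 0 \<Longrightarrow> S k g i i \<noteq> 0"
  unfolding S_def by (subst prod_zero_iff) (auto simp: th_inj)

text \<open>s_(i+l) = s_i s_l^(i), and Frobenius carries the value of s_l at theta^(q^(j-i)) to that
  of s_l^(i) at theta^(q^j).\<close>

lemma S_add:
  assumes "i \<le> j" shows "S k g (i + l) j = S k g i j * S k g l (j - i) ^ (q ^ i)"
proof -
  have "S k g l (j - i) ^ (q ^ i) =
      (\<Prod>m<l. g ^ (q ^ (i + m)) * (1 / (th j - h (k + (i + m))) - 1 / (th (i + m) - h (k + (i + m)))))"
    unfolding S_def prod_power_distrib
    using assms
    by (intro prod.cong refl)
      (simp add: power_mult_distrib frob_diff power_divide th_frob h_frob frob_comp add_ac)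
  moreover have "(\<Prod>m<i + l. f m) = (\<Prod>m<i. f m) * (\<Prod>m<l. f (i + m))" for f :: "nat \<Rightarrow> 'l"
    by (induction l) (auto simp: mult_ac)
  ultimately show ?thesis unfolding S_def by simp
qed

lemma G_add: "G k g (P + Q) j = G k g P j + G k g Q j"
  by (simp add: G_def sum.distrib algebra_simps)

lemma G_smult: "G k g (smult c P) j = c * G k g P j"
  by (simp add: G_def sum_distrib_left mult.assoc)

lemma G_at_0: "G k g P 0 = coeff P 0" by (simp add: G_def)

lemma G_const: "G k g [:c:] j = c"
proof -
  have "G k g [:c:] j = (\<Sum>i\<le>j. if i = 0 then c else 0)"
    unfolding G_def by (intro sum.cong) (auto simp: coeff_pCons split: nat.splits)
  then show ?thesis by simp
qed

lemma G_eq_degree: "G k g P j = (\<Sum>i\<le>degree P. coeff P i * S k g i j)"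
proof -
  have "G k g P j = (\<Sum>i\<le>max j (degree P). coeff P i * S k g i j)"
    unfolding G_def by (rule sum.mono_neutral_left) (auto simp: S_gt)
  also have "\<dots> = (\<Sum>i\<le>degree P. coeff P i * S k g i j)"
    by (rule sum.mono_neutral_right) (auto simp: coeff_eq_0)
  finally show ?thesis .
qed

text \<open>The system is triangular with nonzero diagonal entries \<open>S k g n n\<close>.\<close>

lemma G_inj:
  assumes "g \<noteq> 0" and eq: "\<And>j. G k g P j = G k g Q j" shows "P = Q"
proof (rule poly_eqI)
  fix n show "coeff P n = coeff Q n"
  proof (induction n rule: less_induct)
    case (less n)
    have *: "G k g R n = (\<Sum>i<n. coeff R i * S k g i n) + coeff R n * S k g n n" for R
      by (simp add: G_def lessThan_Suc_atMost[symmetric])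
    have "(\<Sum>i<n. coeff P i * S k g i n) = (\<Sum>i<n. coeff Q i * S k g i n)"
      by (intro sum.cong) (auto simp: less)
    then have "coeff P n * S k g n n = coeff Q n * S k g n n"
      using eq[of n] by (simp add: *)
    then show ?case using S_diag[OF assms(1)] by simp
  qed
qed

lemma G_skew_mult:
  "G k g (skew_mult q P Q) j = (\<Sum>i\<le>j. coeff P i * S k g i j * G k g Q (j - i) ^ (q ^ i))"
proof -
  have "G k g (skew_mult q P Q) j =
      (\<Sum>n\<le>j. \<Sum>i\<le>n. coeff P i * coeff Q (n - i) ^ (q ^ i) * S k g (i + (n - i)) j)"
    unfolding G_def coeff_skew_mult sum_distrib_right by (intro sum.cong) auto
  also have "\<dots> = (\<Sum>i\<le>j. \<Sum>l\<le>j - i. coeff P i * coeff Q l ^ (q ^ i) * S k g (i + l) j)"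
    by (rule sum_triangle_swap)
  also have "\<dots> = (\<Sum>i\<le>j. coeff P i * S k g i j * G k g Q (j - i) ^ (q ^ i))"
    unfolding G_def frob_sum sum_distrib_left
    by (intro sum.cong refl) (auto simp: S_add power_mult_distrib mult_ac)
  finally show ?thesis .
qed

lemma G_skew_mult_linear_Suc:
  "G k g (skew_mult q [:a, b:] P) (Suc j) =
     a * G k g P (Suc j) + b * S k g (Suc 0) (Suc j) * G k g P j ^ q"
proof -
  have "(\<Sum>i\<le>j. coeff [:a, b:] (Suc i) * S k g (Suc i) (Suc j) * G k g P (j - i) ^ (q ^ Suc i)) =
      (\<Sum>i\<le>j. if i = 0 then b * S k g (Suc 0) (Suc j) * G k g P j ^ q else 0)"
    by (intro sum.cong) (auto simp: coeff_pCons split: nat.splits)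
  then show ?thesis
    unfolding G_skew_mult
    by (simp add: sum.atMost_Suc_shift del: sum.atMost_Suc power_Suc)
qed

lemma G_skew_mult_linear_0: "G k g (skew_mult q [:a, b:] P) 0 = a * G k g P 0"
  by (simp add: G_skew_mult)

text \<open>On an orbit the power G(Q)(j-i)^(q^i) does not depend on i and factors out. This is the
  multiplicativity of \<open>Dmod\<close>.\<close>

lemma G_skew_mult_orbit:
  assumes "\<And>j. G k g P j = x ^ (q ^ j)" "\<And>j. G k g Q j = y ^ (q ^ j)"
  shows "G k g (skew_mult q P Q) j = (x * y) ^ (q ^ j)"
proof -
  have "G k g (skew_mult q P Q) j = (\<Sum>i\<le>j. coeff P i * S k g i j * y ^ (q ^ j))"
    unfolding G_skew_mult by (intro sum.cong) (auto simp: assms frob_comp)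
  also have "\<dots> = G k g P j * y ^ (q ^ j)" by (simp add: G_def sum_distrib_right)
  finally show ?thesis by (simp add: assms power_mult_distrib)
qed

lemma inv_diff: "t \<noteq> c \<Longrightarrow> s \<noteq> c \<Longrightarrow> 1 / (t - c) - 1 / (s - c) = (s - t) / ((t - c) * (s - c))" for c s t :: 'l
  by (simp add: diff_frac_eq)

text \<open>Separates the constant from the dependence on the point \<open>th j\<close>, which has
  the shape of the Newton basis.\<close>

lemma S_alt:
  obtains K where "K \<noteq> 0 \<longleftrightarrow> g \<noteq> 0 \<or> i = 0"
    "\<And>j. S k g i j = K * ((\<Prod>m<i. th j - th m) / (\<Prod>m<i. th j - h (k + m)))"
proof
  let ?K = "\<Prod>m<i. g ^ (q ^ m) / (h (k + m) - th m)"
  show "?K \<noteq> 0 \<longleftrightarrow> g \<noteq> 0 \<or> i = 0" by (auto simp: prod_zero_iff)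
  show "S k g i j = ?K * ((\<Prod>m<i. th j - th m) / (\<Prod>m<i. th j - h (k + m)))" for j
    unfolding S_def prod_dividef[symmetric] prod.distrib[symmetric]
    by (intro prod.cong refl) (simp add: inv_diff frac_eq_eq, simp add: algebra_simps)
qed

lemma ev_rho_power_prod: "ev \<rho> x ^ m = (\<Prod>i<m * N. x - h (k + i))"
proof (induction m)
  case (Suc m)
  have split: "(\<Prod>i<a + l. f i) = (\<Prod>i<a. f i) * (\<Prod>i<l. f (a + i))" for f :: "nat \<Rightarrow> 'l" and a l
    by (induction l) (auto simp: mult_ac)
  have "(\<Prod>i<N. x - h (k + (m * N + i))) = ev \<rho> x"
    unfolding ev_rho_prod[of x "k + m * N"] by (simp add: add_ac)
  moreover have "(\<Prod>i<Suc m * N. x - h (k + i)) = (\<Prod>i<m * N + N. x - h (k + i))"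
    by (simp add: add.commute)
  ultimately have "(\<Prod>i<Suc m * N. x - h (k + i)) = ev \<rho> x ^ m * ev \<rho> x"
    by (simp only: split Suc.IH)
  then show ?case by (simp add: mult.commute)
qed simp

text \<open>Newton interpolation of n with zeros theta^(q^m) and poles eta^(k+m); the product of the
  first m N pole factors is rho^m. The constant \<open>C\<close> does not depend on n, so a single n
  suffices to compute it.\<close>

lemma skew_interpolation:
  assumes g: "g \<noteq> 0"
  shows "\<exists>C. C \<noteq> 0 \<and> (\<forall>n. degree n \<le> m * N \<longrightarrow> (\<exists>P. degree P \<le> m * N \<and>
    coeff P (m * N) = C * ev n (h (k + N - 1)) \<and>
    (\<forall>j. G k g P j = ev n (th j) / ev \<rho> (th j) ^ m)))"
proof -
  define D where "D = m * N"
  have "\<exists>K. \<forall>i. K i \<noteq> 0 \<and>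
      (\<forall>j. S k g i j = K i * ((\<Prod>m<i. th j - th m) / (\<Prod>m<i. th j - h (k + m))))"
    using S_alt[of g _ k] g by (intro choice) metis
  then obtain K where K: "\<And>i. K i \<noteq> 0"
    "\<And>i j. S k g i j = K i * ((\<Prod>m<i. th j - th m) / (\<Prod>m<i. th j - h (k + m)))" by blast
  define V where "V = (if D = 0 then 1 else \<Prod>m<D. h (k + (D - 1)) - th m)"
  have V: "V \<noteq> 0" by (auto simp: V_def prod_zero_iff)
  show ?thesis
  proof (intro exI[of _ "1 / (K D * V)"] conjI allI impI)
    show "1 / (K D * V) \<noteq> 0" using V K by simp
    fix n :: "'f poly" assume n: "degree n \<le> m * N"
    have "degree (map_poly emb n) \<le> D" using n by (simp add: D_def)
    from newton_basis[of th "\<lambda>i. h (k + i)", OF th_ne_h(1) this]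
    obtain c where c: "\<And>x. ev n x = (\<Sum>i\<le>D. c i * ((\<Prod>m<i. x - th m) * (\<Prod>m=i..<D. x - h (k + m))))"
      and cD: "D > 0 \<Longrightarrow> c D * (\<Prod>m<D. h (k + (D - 1)) - th m) = ev n (h (k + (D - 1)))"
      by (auto simp: ev_def)
    define P where "P = (\<Sum>i\<le>D. monom (c i / K i) i)"
    have coeffP: "coeff P i = (if i \<le> D then c i / K i else 0)" for i
      by (simp add: P_def coeff_sum sum.delta)
    have degP: "degree P \<le> D" by (rule degree_le) (auto simp: coeffP)
    have cV: "c D * V = ev n (h (k + N - 1))"
    proof (cases "D = 0")
      case True
      then have "degree n = 0" using n by (auto simp: D_def)
      then obtain a where "n = [:a:]" by (rule degree_eq_zeroE)
      then show ?thesis using c[of 0] True by (simp add: V_def)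
    next
      case False
      then obtain m' where m': "m = Suc m'" by (cases m) (auto simp: D_def)
      \<comment> \<open>The last pole has index k + m N - 1, which is k - 1 modulo N. This is why
        leading coefficients are values at eta^(k-1).\<close>
      have "k + (D - 1) = (k + N - 1) + m' * N" using N_ge_2 by (simp add: D_def m')
      then have "h (k + (D - 1)) = h (k + N - 1)" by (simp only: h_add_mult_N)
      then show ?thesis using cD False by (simp add: V_def)
    qed
    have "G k g P j = ev n (th j) / ev \<rho> (th j) ^ m" for j
    proof -
      have "G k g P j = (\<Sum>i\<le>D. coeff P i * S k g i j)"
        unfolding G_eq_degree using degP by (intro sum.mono_neutral_left) (auto simp: coeff_eq_0)
      also have "\<dots> = (\<Sum>i\<le>D. c i * ((\<Prod>m<i. th j - th m) * (\<Prod>m=i..<D. th j - h (k + m))) /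
          (\<Prod>m<D. th j - h (k + m)))"
      proof (intro sum.cong refl)
        fix i assume i: "i \<in> {..D}"
        have "(\<Prod>m<D. th j - h (k + m)) = (\<Prod>m<i. th j - h (k + m)) * (\<Prod>m=i..<D. th j - h (k + m))"
          using i prod.atLeastLessThan_concat[of 0 i D "\<lambda>m. th j - h (k + m)"] by (simp add: lessThan_atLeast0)
        moreover have "(\<Prod>m=i..<D. th j - h (k + m)) \<noteq> 0" by (auto simp: prod_zero_iff)
        ultimately show "coeff P i * S k g i j = c i * ((\<Prod>m<i. th j - th m) *
            (\<Prod>m=i..<D. th j - h (k + m))) / (\<Prod>m<D. th j - h (k + m))"
          using i K by (simp add: coeffP)
      qed
      also have "\<dots> = ev n (th j) / (\<Prod>m<D. th j - h (k + m))"
        by (simp add: c sum_divide_distrib)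
      finally show ?thesis by (simp add: ev_rho_power_prod[of _ _ k] D_def)
    qed
    then show "\<exists>P. degree P \<le> m * N \<and> coeff P (m * N) = 1 / (K D * V) * ev n (h (k + N - 1)) \<and>
        (\<forall>j. G k g P j = ev n (th j) / ev \<rho> (th j) ^ m)"
      unfolding cV[symmetric]
      using degP V K by (intro exI[of _ P]) (simp add: coeffP D_def[symmetric])
  qed
qed

text \<open>Such a P exists by \<open>skew_interpolation\<close> and is unique by
  \<open>G_inj\<close>.\<close>

definition Dmod :: "nat \<Rightarrow> 'l \<Rightarrow> 'f poly fract \<Rightarrow> 'l poly" where
  "Dmod k g = (\<lambda>a\<in>ringA \<rho>. THE P. \<forall>j. G k g P j = io a ^ (q ^ j))"

lemma iota_Fr_frob: "io (Fr n m) ^ (q ^ j) = ev n (th j) / ev \<rho> (th j) ^ m"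
  by (simp add: iota_frob ev_power)

lemma Dmod_eqI:
  assumes "g \<noteq> 0" "a \<in> ringA \<rho>" "\<And>j. G k g P j = io a ^ (q ^ j)"
  shows "Dmod k g a = P"
proof -
  have "(THE P. \<forall>j. G k g P j = io a ^ (q ^ j)) = P"
    by (rule the_equality) (use assms G_inj[OF assms(1), of k] in auto)
  then show ?thesis using assms by (simp add: Dmod_def)
qed

lemma Dmod_lead:
  assumes g: "g \<noteq> 0"
  shows "\<exists>C. C \<noteq> 0 \<and> (\<forall>n. degree n \<le> m * N \<longrightarrow> degree (Dmod k g (Fr n m)) \<le> m * N \<and>
    coeff (Dmod k g (Fr n m)) (m * N) = C * ev n (h (k + N - 1)) \<and>
    (\<forall>j. G k g (Dmod k g (Fr n m)) j = io (Fr n m) ^ (q ^ j)))"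
proof -
  obtain C where C: "C \<noteq> 0" "\<And>n. degree n \<le> m * N \<Longrightarrow> (\<exists>P. degree P \<le> m * N \<and>
      coeff P (m * N) = C * ev n (h (k + N - 1)) \<and> (\<forall>j. G k g P j = io (Fr n m) ^ (q ^ j)))"
    using skew_interpolation[OF g, of m k] unfolding iota_Fr_frob by blast
  show ?thesis
    using C Dmod_eqI[OF g Fr_in_ringA, of _ m k] by (intro exI[of _ C]) metis
qed

lemma G_Dmod:
  assumes "g \<noteq> 0" "a \<in> ringA \<rho>" shows "G k g (Dmod k g a) j = io a ^ (q ^ j)"
proof -
  obtain n m where "a = Fr n m" "degree n \<le> m * N" using ringA_cases[OF assms(2)] .
  then show ?thesis using Dmod_lead[OF assms(1), of m k] by blast
qed

lemma rank_one_Dmod: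
  assumes g: "g \<noteq> 0" shows "rank_one_Drinfeld emb \<rho> \<theta> \<eta> (Dmod k g)"
  unfolding rank_one_Drinfeld_def
proof (intro conjI ballI allI impI)
  show "Dmod k g \<in> extensional (ringA \<rho>)" by (simp add: Dmod_def)
  fix a b assume a: "a \<in> ringA \<rho>" and b: "b \<in> ringA \<rho>"
  show "Dmod k g (a + b) = Dmod k g a + Dmod k g b"
    by (rule Dmod_eqI) (simp_all add: g a b ringA_add G_add G_Dmod iota_add frob_add)
  have "Dmod k g (a * b) = skew_mult q (Dmod k g a) (Dmod k g b)"
    by (rule Dmod_eqI[OF g ringA_mult[OF a b]], unfold iota_mult, rule G_skew_mult_orbit)
       (simp_all add: G_Dmod g a b)
  then show "Dmod k g (a * b) = skew_mult CARD('f) (Dmod k g a) (Dmod k g b)" by (simp only: q_eq)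
next
  fix c show "Dmod k g (constA c) = [:emb c:]"
    by (rule Dmod_eqI) (simp_all add: g constA_in_ringA G_const iota_constA emb_frob)
next
  fix a assume a: "a \<in> ringA \<rho>"
  show "coeff (Dmod k g a) 0 = io a" using G_Dmod[OF g a, of k 0] by (simp add: G_at_0)
  assume "a \<noteq> 0"
  then obtain n m where n: "a = Fr n m" "degree n \<le> m * N" "\<not> \<rho> dvd n"
    using ringA_cases_coprime[OF a] by blast
  \<comment> \<open>The top coefficient is a nonzero multiple of n(eta^(k-1)), and rho does not
    divide n.\<close>
  have "degree (Dmod k g a) \<le> m * N" "coeff (Dmod k g a) (m * N) \<noteq> 0"
    using Dmod_lead[OF g, of m k] n ev_h_eq_0_iff[of n "k + N - 1"] by auto
  then have "degree (Dmod k g a) = m * N" using le_degree by (metis le_antisym)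
  then show "int (degree (Dmod k g a)) = - int (degree \<rho>) * fls_subdegree (iota_rho emb \<eta> a)"
    using subdegree_iota_rho[OF n(3), of m] n(1) by (simp add: N_eq)
qed

end

section \<open>Classification of the rank one modules\<close>

lemma Fract_sum: "d \<noteq> 0 \<Longrightarrow> (\<Sum>i\<in>A. Fraction_Field.Fract (f i) d) = Fraction_Field.Fract (sum f A) d"
  by (induction A rule: infinite_finite_induct)
    (auto simp: Zero_fract_def eq_fract algebra_simps)

locale rank_one_module = rho_place emb q \<rho> \<theta> \<eta> N
  for emb :: "'f::{field,finite} \<Rightarrow> 'l::field" and q :: nat
    and \<rho> :: "'f poly" and \<theta> \<eta> :: 'l and N :: nat +
  fixes \<psi> :: "'f poly fract \<Rightarrow> 'l poly"
  assumes rank_one: "rank_one_Drinfeld emb \<rho> \<theta> \<eta> \<psi>"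
begin

lemma psi_add: "a \<in> ringA \<rho> \<Longrightarrow> b \<in> ringA \<rho> \<Longrightarrow> \<psi> (a + b) = \<psi> a + \<psi> b"
  and psi_mult: "a \<in> ringA \<rho> \<Longrightarrow> b \<in> ringA \<rho> \<Longrightarrow> \<psi> (a * b) = skew_mult q (\<psi> a) (\<psi> b)"
  and psi_const: "\<psi> (constA c) = [:emb c:]"
  and psi_coeff_0: "a \<in> ringA \<rho> \<Longrightarrow> coeff (\<psi> a) 0 = io a"
  using rank_one by (auto simp: rank_one_Drinfeld_def q_eq)

lemma psi_0: "\<psi> 0 = 0"
  using psi_const[of 0] by (simp add: constA_def Zero_fract_def)

lemma psi_1: "\<psi> 1 = 1"
  using psi_const[of 1] by (simp add: constA_def One_fract_def one_pCons)

lemma psi_sum: "(\<And>i. i \<in> A \<Longrightarrow> f i \<in> ringA \<rho>) \<Longrightarrow> sum f A \<in> ringA \<rho> \<and> \<psi> (sum f A) = (\<Sum>i\<in>A. \<psi> (f i))"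
  by (induction A rule: infinite_finite_induct) (auto simp: psi_0 psi_add zero_in_ringA ringA_add)

text \<open>The index will run up to N: t^N / rho also lies in A, and rho / rho = 1 becomes a linear
  relation among the \<open>R i\<close>.\<close>

definition R :: "nat \<Rightarrow> 'l poly" where "R i = \<psi> (genT \<rho> i)"
definition top :: "nat \<Rightarrow> 'l" where "top i = coeff (R i) N"

lemma degree_R: assumes "i \<le> N" shows "degree (R i) = N"
proof -
  have "\<not> \<rho> dvd monom 1 i" by (simp flip: ev_eta_eq_0_iff add: ev_monom)
  then show ?thesis
    unfolding R_def genT_alt using rank_one_degree[OF rank_one, of "monom 1 i" 1] assms
    by (simp add: degree_monom_eq)
qed

lemma top_nz: assumes "i \<le> N" shows "top i \<noteq> 0"
  using degree_R[OF assms] by (metis N_pos degree_0 leading_coeff_0_iff less_irrefl top_def)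

text \<open>Multiplication by t, which is not itself in A, enters through T_i T_1 = T_(i+1)
  T_0.\<close>

lemma R_comm: assumes "i < N" shows "skew_mult q (R i) (R 1) = skew_mult q (R (Suc i)) (R 0)"
proof -
  have "genT \<rho> i * genT \<rho> 1 = genT \<rho> (Suc i) * genT \<rho> 0"
    by (simp add: genT_def mult_monom)
  then show ?thesis
    using assms psi_mult[of "genT \<rho> i" "genT \<rho> 1"] psi_mult[of "genT \<rho> (Suc i)" "genT \<rho> 0"] N_ge_2
    by (simp add: R_def genT_in_ringA)
qed

text \<open>Plays the part of t on leading coefficients. By \<open>rho_zz\<close> it is a conjugate
  of eta.\<close>

definition zz :: 'l where "zz = top 1 / top 0"

text \<open>Leading coefficients in \<open>R_comm\<close> give the ratio zz^(q^N); the case i = 0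
  shows that this is zz.\<close>

lemma top_Suc: assumes "i < N" shows "top (Suc i) = top i * zz"
proof -
  have *: "top i * top 1 ^ (q ^ N) = top (Suc i) * top 0 ^ (q ^ N)" if "i < N" for i
    using arg_cong[OF R_comm[OF that], of "\<lambda>P. coeff P (N + N)"] that
    by (subst (asm) (1 2) coeff_skew_mult_top) (auto simp: degree_R top_def)
  have "zz ^ (q ^ N) = zz"
    using *[of 0] top_nz[of 0] by (simp add: zz_def power_divide field_simps)
  moreover have "top (Suc i) = top i * zz ^ (q ^ N)"
    using *[OF assms] top_nz[of 0] by (simp add: zz_def power_divide field_simps)
  ultimately show ?thesis by simp
qed

lemma top_eq: "i \<le> N \<Longrightarrow> top i = top 0 * zz ^ i"
  by (induction i) (auto simp: top_Suc)

text \<open>The value of the $L$-linear extension of $\psi$ at $n(t) / \rho(t)$, for $\deg n \le N$.\<close>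
definition ext :: "'l poly \<Rightarrow> 'l poly" where
  "ext n = (\<Sum>i\<le>N. smult (coeff n i) (R i))"

lemma ext_add: "ext (m + n) = ext m + ext n"
  by (simp add: ext_def smult_add_left sum.distrib)

lemma ext_smult: "ext (smult c n) = smult c (ext n)"
  by (rule poly_eqI) (simp add: ext_def coeff_sum sum_distrib_left mult.assoc)

lemma poly_sum_N: "degree n \<le> N \<Longrightarrow> poly n x = (\<Sum>i\<le>N. coeff n i * x ^ i)" for n :: "'l poly"
  unfolding poly_altdef by (rule sum.mono_neutral_left) (auto simp: coeff_eq_0)

text \<open>\<open>R_comm\<close> made linear: multiplying the argument by t amounts to replacing
  \<open>R 0\<close> by \<open>R 1\<close> on the right. The strict bound keeps t n within the range
  of \<open>ext\<close>.\<close>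

lemma ext_shift:
  assumes "degree n < N"
  shows "skew_mult q (ext n) (R 1) = skew_mult q (ext (pCons 0 n)) (R 0)"
proof -
  obtain M where M: "N = Suc M" using N_pos gr0_implies_Suc by blast
  have "skew_mult q (ext (pCons 0 n)) (R 0) =
      (\<Sum>i\<le>M. smult (coeff n i) (skew_mult q (R (Suc i)) (R 0)))"
    unfolding ext_def unfolding M
    by (simp add: sum.atMost_Suc_shift skew_mult_add_left skew_mult_sum_left skew_mult_smult_left
        del: sum.atMost_Suc)
  also have "\<dots> = (\<Sum>i\<le>M. smult (coeff n i) (skew_mult q (R i) (R 1)))"
    using R_comm unfolding M by (intro sum.cong refl) (simp add: less_Suc_eq_le)
  also have "\<dots> = skew_mult q (ext n) (R 1)"
    unfolding ext_def unfolding M using assms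
    by (simp add: M coeff_eq_0 skew_mult_sum_left skew_mult_smult_left)
  finally show ?thesis ..
qed

lemma ext_rho: "ext (map_poly emb \<rho>) = 1"
proof -
  let ?f = "\<lambda>i. constA (coeff \<rho> i) * genT \<rho> i"
  have in_A: "?f i \<in> ringA \<rho>" if "i \<in> {..N}" for i
    using that by (auto intro!: ringA_mult constA_in_ringA genT_in_ringA)
  have "(\<Sum>i\<le>N. ?f i) = (\<Sum>i\<le>N. Fraction_Field.Fract (monom (coeff \<rho> i) i) \<rho>)"
    by (intro sum.cong refl) (simp add: constA_def genT_def smult_monom)
  also have "\<dots> = Fraction_Field.Fract \<rho> \<rho>"
    using poly_as_sum_of_monoms[of \<rho>] by (simp add: Fract_sum N_eq)
  also have "\<dots> = 1" by (simp add: One_fract_def eq_fract)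
  finally have sum: "(\<Sum>i\<le>N. ?f i) = 1" .
  have "ext (map_poly emb \<rho>) = (\<Sum>i\<le>N. \<psi> (?f i))"
    unfolding ext_def
    by (intro sum.cong refl)
      (simp add: psi_mult constA_in_ringA genT_in_ringA psi_const skew_mult_const R_def coeff_map_poly)
  also have "\<dots> = \<psi> (\<Sum>i\<le>N. ?f i)" using psi_sum[of "{..N}" ?f] in_A by simp
  finally show ?thesis by (simp add: sum psi_1)
qed

lemma coeff_R_0: "i \<le> N \<Longrightarrow> coeff (R i) 0 = \<theta> ^ i / ev \<rho> \<theta>"
  using psi_coeff_0[of "genT \<rho> i"] iota_genT_frob[of i 0] by (simp add: R_def genT_in_ringA)

lemma coeff_ext_0: "degree n \<le> N \<Longrightarrow> coeff (ext n) 0 = poly n \<theta> / ev \<rho> \<theta>"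
  by (simp add: ext_def coeff_sum coeff_R_0 poly_sum_N sum_divide_distrib)

lemma coeff_ext_N: "degree n \<le> N \<Longrightarrow> coeff (ext n) N = top 0 * poly n zz"
proof -
  assume n: "degree n \<le> N"
  have "coeff (ext n) N = (\<Sum>i\<le>N. coeff n i * top i)"
    by (simp add: ext_def coeff_sum top_def)
  also have "\<dots> = (\<Sum>i\<le>N. top 0 * (coeff n i * zz ^ i))"
  proof (intro sum.cong refl)
    fix i assume "i \<in> {..N}"
    then have "top i = top 0 * zz ^ i" by (intro top_eq) simp
    then show "coeff n i * top i = top 0 * (coeff n i * zz ^ i)" by (simp only: mult_ac)
  qed
  finally show ?thesis by (simp add: poly_sum_N[OF n] sum_distrib_left)
qed

lemma degree_ext: "degree (ext n) \<le> N"
  unfolding ext_def by (intro degree_sum_le) (auto intro: order.trans[OF degree_smult_le] simp: degree_R)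

text \<open>The image of rho / rho is 1, so its coefficient at tau^N, equal to \<open>top 0\<close>
  times rho(zz), vanishes.\<close>

lemma rho_zz: "ev \<rho> zz = 0"
proof -
  have "degree (map_poly emb \<rho>) \<le> N" by (simp add: N_eq)
  then have "coeff (1 :: 'l poly) N = top 0 * ev \<rho> zz"
    using coeff_ext_N[of "map_poly emb \<rho>"] by (simp only: ext_rho ev_def)
  moreover have "coeff (1 :: 'l poly) N = 0" using N_ge_2 by (intro coeff_eq_0) simp
  ultimately show ?thesis using top_nz[of 0] by simp
qed

lemma zz_ne_th: "zz ^ (q ^ D) \<noteq> \<theta>"
proof
  assume "zz ^ (q ^ D) = \<theta>"
  then have "ev \<rho> \<theta> = ev \<rho> zz ^ (q ^ D)" by (simp add: ev_frob)
  then show False using rho_zz ev_theta_nz[of \<rho>] by simp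
qed

text \<open>If $n$ is killed, then $n = (t - \theta) n_1$ and $Q$, the image of $n_1$, satisfies
  $Q R_1 = \theta Q R_0$;
  comparing leading coefficients would make $\theta$ a conjugate of $\eta$.\<close>
lemma ext_inj:
  assumes "degree n \<le> N" "ext n = 0" shows "n = 0"
  using assms
proof (induction "degree n" arbitrary: n rule: less_induct)
  case less
  show ?case
  proof (rule ccontr)
    assume nz: "n \<noteq> 0"
    have "poly n \<theta> = 0" using coeff_ext_0[OF less.prems(1)] less.prems(2) ev_theta_nz[of \<rho>] by simp
    then have "[:- \<theta>, 1:] dvd n" by (simp only: poly_eq_0_iff_dvd)
    then obtain n1 where n1: "n = [:- \<theta>, 1:] * n1" by (rule dvdE)
    have n1z: "n1 \<noteq> 0" using n1 nz by auto
    have deg: "degree n = Suc (degree n1)" unfolding n1 using n1z by (subst degree_mult_eq) auto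
    define Q where "Q = ext n1"
    have "ext (pCons 0 n1) = ext (n + smult \<theta> n1)" by (simp add: n1)
    then have "ext (pCons 0 n1) = smult \<theta> Q" by (simp add: ext_add ext_smult less.prems Q_def)
    then have eq: "skew_mult q Q (R 1) = smult \<theta> (skew_mult q Q (R 0))"
      using ext_shift[of n1] deg less.prems(1) by (simp add: Q_def skew_mult_smult_left)
    have "Q = 0"
    proof (rule ccontr)
      assume Q: "Q \<noteq> 0"
      have "lead_coeff Q * top 1 ^ (q ^ degree Q) = \<theta> * (lead_coeff Q * top 0 ^ (q ^ degree Q))"
        using arg_cong[OF eq, of "\<lambda>P. coeff P (degree Q + N)"] N_ge_2
        by (simp add: coeff_skew_mult_top degree_R top_def)
      then have "zz ^ (q ^ degree Q) = \<theta>"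
        using Q top_nz[of 0] by (simp add: zz_def power_divide field_simps)
      then show False using zz_ne_th by blast
    qed
    then have "n1 = 0" using less.hyps[of n1] deg less.prems(1) by (simp add: Q_def)
    then show False using n1z by blast
  qed
qed

text \<open>The linear skew polynomial is the image of 1/(t - eta^(k)). The relation expresses t/(t
  - eta^(k)) = 1 + eta^(k)/(t - eta^(k)), multiplied by 1/rho.\<close>

lemma shtuka_exists:
  obtains k b where "k < N" "b \<noteq> 0"
    "skew_mult q [:1 / (\<theta> - h k), b:] (R 1) =
       R 0 + smult (h k) (skew_mult q [:1 / (\<theta> - h k), b:] (R 0))"
proof -
  obtain k' where k': "k' < N" "zz = h k'" using rho_root[OF rho_zz] by blast
  \<comment> \<open>The pole is placed at zz^q, one Frobenius step beyond zz, so that comparing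
    leading coefficients will force degree one.\<close>
  define k where "k = Suc k' mod N"
  have hk: "h k = zz ^ q" unfolding k_def h_mod_N by (simp add: k' h_q)
  define \<xi> where "\<xi> = h k"
  have "poly (map_poly emb \<rho>) \<xi> = 0" using ev_rho_h[of k] by (simp add: ev_def \<xi>_def)
  then have "[:- \<xi>, 1:] dvd map_poly emb \<rho>" by (simp only: poly_eq_0_iff_dvd)
  then obtain r where r: "map_poly emb \<rho> = [:- \<xi>, 1:] * r" by (rule dvdE)
  have rz: "r \<noteq> 0"
  proof
    assume "r = 0"
    then have "map_poly emb \<rho> = 0" using r by simp
    then show False by simp
  qed
  have "degree (map_poly emb \<rho>) = Suc (degree r)" unfolding r using rz by (subst degree_mult_eq) auto
  then have degr: "Suc (degree r) = N" by (simp add: N_eq)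
  have ev_r: "ev \<rho> x = (x - \<xi>) * poly r x" for x by (simp add: ev_def r algebra_simps)
  define Q where "Q = ext r"
  have "pCons 0 r = map_poly emb \<rho> + smult \<xi> r" by (simp add: r)
  then have "ext (pCons 0 r) = 1 + smult \<xi> Q" by (simp only: ext_add ext_smult ext_rho Q_def)
  then have eq: "skew_mult q Q (R 1) = R 0 + smult \<xi> (skew_mult q Q (R 0))"
    using ext_shift[of r] degr by (simp add: Q_def skew_mult_smult_left skew_mult_add_left)
  have Qz: "Q \<noteq> 0" using ext_inj[of r] rz degr by (auto simp: Q_def)
  \<comment> \<open>Being a root of rho other than \<open>\<xi>\<close>, zz is a root of
    \<open>r\<close>; hence the coefficient of tau^N in \<open>Q\<close> vanishes.\<close>
  have "zz \<noteq> \<xi>"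
  proof
    assume "zz = \<xi>"
    then have "\<eta> ^ (q ^ k') = h 1 ^ (q ^ k')" by (simp add: \<xi>_def hk k'(2) h_frob h_q flip: h_def)
    then have "h 0 = h 1" unfolding frob_inj by simp
    then show False using h_inj[of 0 1] N_ge_2 by simp
  qed
  then have "poly r zz = 0" using ev_r[of zz] rho_zz by simp
  then have "coeff Q N = 0" using coeff_ext_N[of r] degr by (simp add: Q_def)
  then have degQ: "degree Q < N"
    using Qz degree_ext[of r] by (metis Q_def le_neq_implies_less leading_coeff_0_iff)
  define D where "D = degree Q"
  \<comment> \<open>A constant image b would send r - b rho to 0, against
    \<open>ext_inj\<close>.\<close>
  have D0: "D \<noteq> 0"
  proof
    assume "D = 0"
    then obtain b where b: "Q = [:b:]" unfolding D_def by (rule degree_eq_zeroE)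
    then have "ext (r + smult (- b) (map_poly emb \<rho>)) = 0"
      by (simp only: ext_add ext_smult ext_rho) (simp add: Q_def[symmetric] one_pCons)
    moreover have "degree (r + smult (- b) (map_poly emb \<rho>)) \<le> N"
      using degr by (intro degree_add_le order.trans[OF degree_smult_le]) (auto simp: N_eq)
    ultimately have "r + smult (- b) (map_poly emb \<rho>) = 0" by (rule ext_inj[rotated])
    then have "r = smult b (map_poly emb \<rho>)" by simp
    then have "degree r = N" using rz by (auto simp: N_eq split: if_splits)
    then show False using degr by simp
  qed
  have "coeff (R 0) (D + N) = 0" using D0 degree_R[of 0] by (intro coeff_eq_0) simp
  then have "lead_coeff Q * top 1 ^ (q ^ D) = \<xi> * (lead_coeff Q * top 0 ^ (q ^ D))"
    using arg_cong[OF eq, of "\<lambda>P. coeff P (D + N)"] N_ge_2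
    by (simp add: coeff_skew_mult_top degree_R top_def D_def)
  then have zD: "zz ^ (q ^ D) = zz ^ q"
    using Qz top_nz[of 0] by (simp add: zz_def power_divide field_simps \<xi>_def hk)
  \<comment> \<open>zz^(q^D) = zz^q with 0 < D < N, and the N conjugates of eta are
    distinct.\<close>
  have "D = 1"
  proof -
    obtain d where d: "D = Suc d" using D0 not0_implies_Suc by blast
    have "(zz ^ (q ^ d)) ^ (q ^ 1) = zz ^ (q ^ 1)" using zD by (simp only: d frob_Suc power_one_right)
    then have "zz ^ (q ^ d) = zz" unfolding frob_inj .
    then have "h d ^ (q ^ k') = h 0 ^ (q ^ k')" by (simp add: k'(2) h_frob add.commute del: h_0)
    then have "h d = h 0" unfolding frob_inj .
    then have "d = 0" using h_inj[of d 0] degQ d D_def by simp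
    then show ?thesis using d by simp
  qed
  then have "coeff Q n = coeff [:coeff Q 0, coeff Q 1:] n" for n
    by (auto simp: coeff_pCons D_def intro!: coeff_eq_0 split: nat.splits)
  moreover have "coeff Q 1 \<noteq> 0" using \<open>D = 1\<close> Qz by (metis D_def leading_coeff_0_iff)
  ultimately obtain a b where ab: "Q = [:a, b:]" "b \<noteq> 0" by (metis poly_eqI)
  have "a = poly r \<theta> / ev \<rho> \<theta>" using coeff_ext_0[of r] degr ab by (simp add: Q_def[symmetric])
  also have "\<dots> = 1 / (\<theta> - \<xi>)" using ev_r[of \<theta>] ev_theta_nz[of \<rho>] by auto
  finally have "Q = [:1 / (\<theta> - h k), b:]" using ab by (simp add: \<xi>_def)
  then show ?thesis using that[of k b] eq ab by (simp add: \<xi>_def) (simp add: k_def)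
qed

lemma eq_Dmod: obtains k g where "k < N" "g \<noteq> 0" "\<psi> = Dmod k g"
proof -
  obtain k b where k: "k < N" and b: "b \<noteq> 0" and
    sh: "skew_mult q [:1 / (\<theta> - h k), b:] (R 1) =
       R 0 + smult (h k) (skew_mult q [:1 / (\<theta> - h k), b:] (R 0))"
    by (rule shtuka_exists)
  \<comment> \<open>With this g, the skew polynomial of \<open>shtuka_exists\<close> evaluates to
    1/(theta^(q^j) - eta^(k)).\<close>
  define g where "g = 1 / b"
  have g: "g \<noteq> 0" using b by (simp add: g_def)
  have "\<forall>a\<in>ringA \<rho>. G k g (\<psi> a) j = io a ^ (q ^ j)" for j
  proof (induction j rule: less_induct)
    case (less j)
    show ?case
    proof (cases j)
      case 0
      then show ?thesis by (simp add: G_at_0 psi_coeff_0)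
    next
      case (Suc j')
      \<comment> \<open>Only the term with i = 0 contains G(psi_c)(j). In the others,
        G(psi_c)(j-i)^(q^i) is iota(c)^(q^j) by the induction hypothesis.\<close>
      have prod: "G k g (skew_mult q (\<psi> a) (\<psi> c)) j =
          io a * G k g (\<psi> c) j + (G k g (\<psi> a) j - io a) * io c ^ (q ^ j)"
        if a: "a \<in> ringA \<rho>" and c: "c \<in> ringA \<rho>" for a c
      proof -
        have "(\<Sum>i\<le>j'. coeff (\<psi> a) (Suc i) * S k g (Suc i) j * G k g (\<psi> c) (j - Suc i) ^ (q ^ Suc i)) =
            (\<Sum>i\<le>j'. coeff (\<psi> a) (Suc i) * S k g (Suc i) j) * io c ^ (q ^ j)"
          unfolding sum_distrib_right
        proof (intro sum.cong refl)
          fix i assume "i \<in> {..j'}"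
          then have "G k g (\<psi> c) (j - Suc i) = io c ^ (q ^ (j - Suc i))" "j - Suc i + Suc i = j"
            using less.IH[of "j - Suc i"] c Suc by auto
          then show "coeff (\<psi> a) (Suc i) * S k g (Suc i) j * G k g (\<psi> c) (j - Suc i) ^ (q ^ Suc i) =
              coeff (\<psi> a) (Suc i) * S k g (Suc i) j * io c ^ (q ^ j)"
            by (simp only: frob_comp)
        qed
        moreover have "G k g (\<psi> a) j = io a + (\<Sum>i\<le>j'. coeff (\<psi> a) (Suc i) * S k g (Suc i) j)"
          using a by (simp add: G_def Suc sum.atMost_Suc_shift psi_coeff_0 del: sum.atMost_Suc)
        ultimately show ?thesis unfolding G_skew_mult
          using a by (simp add: Suc sum.atMost_Suc_shift psi_coeff_0 del: sum.atMost_Suc power_Suc)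
      qed
      define \<delta> where "\<delta> a = G k g (\<psi> a) j - io a ^ (q ^ j)" for a
      \<comment> \<open>Commutativity makes the error \<open>\<delta>\<close> proportional to
        iota(a) - iota(a)^(q^j), and leaves the factor of proportionality open.\<close>
      have comm: "\<delta> c * (io a - io a ^ (q ^ j)) = \<delta> a * (io c - io c ^ (q ^ j))"
        if a: "a \<in> ringA \<rho>" and c: "c \<in> ringA \<rho>" for a c
      proof -
        have "skew_mult q (\<psi> a) (\<psi> c) = skew_mult q (\<psi> c) (\<psi> a)"
          using psi_mult[OF a c] psi_mult[OF c a] by (simp add: mult.commute)
        then have "io a * G k g (\<psi> c) j + (G k g (\<psi> a) j - io a) * io c ^ (q ^ j) =
            io c * G k g (\<psi> a) j + (G k g (\<psi> c) j - io c) * io a ^ (q ^ j)"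
          using prod[OF a c] prod[OF c a] by simp
        then show ?thesis by (simp add: \<delta>_def algebra_simps)
      qed
      have T: "genT \<rho> 0 \<in> ringA \<rho>" "genT \<rho> 1 \<in> ringA \<rho>"
        using N_ge_2 by (auto intro: genT_in_ringA)
      define x0 t0 where "x0 = io (genT \<rho> 0) ^ (q ^ j)" and "t0 = io (genT \<rho> 0)"
      have x0: "x0 \<noteq> 0" using ev_th_nz[of \<rho> j] by (simp add: x0_def iota_genT_frob)
      have t1: "io (genT \<rho> 1) = \<theta> * t0" using iota_genT_frob[of _ 0] by (simp add: t0_def)
      have x1: "io (genT \<rho> 1) ^ (q ^ j) = th j * x0" by (simp add: x0_def iota_genT_frob)
      have th: "th j \<noteq> \<theta>" using th_inj[of j 0] Suc by simp
      have y: "b * S k g (Suc 0) (Suc j') = 1 / (th j - h k) - 1 / (\<theta> - h k)"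
        using b by (simp add: S_1 g_def Suc)
      have Q: "G k g (skew_mult q [:1 / (\<theta> - h k), b:] (\<psi> a)) j =
          1 / (\<theta> - h k) * G k g (\<psi> a) j + (1 / (th j - h k) - 1 / (\<theta> - h k)) * io a ^ (q ^ j)"
        if "a \<in> ringA \<rho>" for a
      proof -
        have "G k g (\<psi> a) j' ^ q = io a ^ (q ^ j)" using less.IH[of j'] that Suc by (simp add: frob_Suc del: power_Suc)
        then show ?thesis unfolding Suc G_skew_mult_linear_Suc y by (simp only: Suc)
      qed
      \<comment> \<open>The relation \<open>sh\<close>, evaluated at j and cleared of denominators,
        supplies the second equation between the two errors.\<close>
      have "\<delta> (genT \<rho> 1) = \<theta> * \<delta> (genT \<rho> 0)"
      proof -
        have "1 / (\<theta> - h k) * G k g (R 1) j + (1 / (th j - h k) - 1 / (\<theta> - h k)) * (th j * x0) =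
            G k g (R 0) j + h k * (1 / (\<theta> - h k) * G k g (R 0) j +
              (1 / (th j - h k) - 1 / (\<theta> - h k)) * x0)"
          using arg_cong[OF sh, of "\<lambda>P. G k g P j"] Q[OF T(1)] Q[OF T(2)] x1
          by (simp only: G_add G_smult R_def x0_def)
        then have "(\<theta> - h k) * (1 / (\<theta> - h k) * G k g (R 1) j + (1 / (th j - h k) - 1 / (\<theta> - h k)) * (th j * x0)) =
            (\<theta> - h k) * (G k g (R 0) j + h k * (1 / (\<theta> - h k) * G k g (R 0) j +
              (1 / (th j - h k) - 1 / (\<theta> - h k)) * x0))" by simp
        moreover have "(\<theta> - h k) * (1 / (th j - h k) - 1 / (\<theta> - h k)) * (th j - h k) = \<theta> - th j"
          by (simp add: inv_diff)
        moreover have "(\<theta> - h k) * (1 / (\<theta> - h k)) = 1" by simp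
        moreover define u v where "u = 1 / (\<theta> - h k)" and "v = 1 / (th j - h k) - 1 / (\<theta> - h k)"
        ultimately have "(\<theta> - h k) * (u * G k g (R 1) j + v * (th j * x0)) =
            (\<theta> - h k) * (G k g (R 0) j + h k * (u * G k g (R 0) j + v * x0))"
          "(\<theta> - h k) * v * (th j - h k) = \<theta> - th j" "(\<theta> - h k) * u = 1" by simp_all
        then have "G k g (R 1) j + (\<theta> - th j) * x0 = (\<theta> - h k) * G k g (R 0) j + h k * G k g (R 0) j"
          by algebra
        then show ?thesis
          unfolding \<delta>_def x1 by (simp add: R_def x0_def[symmetric] algebra_simps)
      qed
      then have "\<delta> (genT \<rho> 0) * (x0 * (th j - \<theta>)) = 0"
        using comm[OF T, unfolded x1, unfolded x0_def[symmetric], unfolded t1 t0_def[symmetric]]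
        by (simp only: algebra_simps) (simp add: algebra_simps)
      then have \<delta>0: "\<delta> (genT \<rho> 0) = 0" using x0 th by simp
      then have \<delta>1: "\<delta> (genT \<rho> 1) = 0" using \<open>\<delta> (genT \<rho> 1) = \<theta> * \<delta> (genT \<rho> 0)\<close> by simp
      have "\<delta> a = 0" if a: "a \<in> ringA \<rho>" for a
      proof (rule ccontr)
        assume "\<delta> a \<noteq> 0"
        \<comment> \<open>A nonzero error at a would make both T_0 and T_1 take equal values at
          theta and at theta^(q^j), so t would as well; but j > 0.\<close>
        then have "t0 = x0" "\<theta> * t0 = th j * x0"
          using comm[OF T(1) a, unfolded x0_def[symmetric], unfolded t0_def[symmetric]]
            comm[OF T(2) a, unfolded x1, unfolded t1] \<delta>0 \<delta>1 by auto
        then show False using x0 th by simp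
      qed
      then show ?thesis by (simp add: \<delta>_def)
    qed
  qed
  then have "\<psi> a = Dmod k g a" if "a \<in> ringA \<rho>" for a
    using Dmod_eqI[OF g that, of k "\<psi> a"] that by simp
  moreover have "\<psi> \<in> extensional (ringA \<rho>)" using rank_one by (simp add: rank_one_Drinfeld_def)
  moreover have "Dmod k g \<in> extensional (ringA \<rho>)" by (simp add: Dmod_def)
  ultimately have "\<psi> = Dmod k g" by (intro extensionalityI)
  then show ?thesis using that k g by blast
qed

end

lemma (in rho_place) rank_one_eq_Dmod:
  assumes "rank_one_Drinfeld emb \<rho> \<theta> \<eta> \<psi>"
  obtains k g where "k < N" "g \<noteq> 0" "\<psi> = Dmod k g"
proof -
  interpret rank_one_module emb q \<rho> \<theta> \<eta> N \<psi>
    by unfold_locales (rule assms)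
  show ?thesis using eq_Dmod that by blast
qed

section \<open>Standard modules and shtuka functions\<close>

text \<open>A relation, because a fraction may have a pole at x and only a representative with
  nonvanishing denominator may be evaluated.\<close>

definition val_at :: "'l::field \<Rightarrow> 'l poly fract \<Rightarrow> 'l \<Rightarrow> bool" where
  "val_at x f y \<longleftrightarrow> (\<exists>n d. f = Fraction_Field.Fract n d \<and> poly d x \<noteq> 0 \<and> y = poly n x / poly d x)"

lemma val_at_Fract: "poly d x \<noteq> 0 \<Longrightarrow> val_at x (Fraction_Field.Fract n d) (poly n x / poly d x)"
  by (auto simp: val_at_def)

lemma val_at_const: "val_at x (Fraction_Field.Fract [:c:] 1) c"
  using val_at_Fract[of 1 x "[:c:]"] by simp

lemma val_at_unique: assumes "val_at x f y" "val_at x f y'" shows "y = y'"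
proof -
  obtain n d n' d' where *: "f = Fraction_Field.Fract n d" "poly d x \<noteq> 0" "y = poly n x / poly d x"
    "f = Fraction_Field.Fract n' d'" "poly d' x \<noteq> 0" "y' = poly n' x / poly d' x"
    using assms unfolding val_at_def by blast
  have "d \<noteq> 0" "d' \<noteq> 0" using * by auto
  then have "n * d' = n' * d" using * by (simp add: eq_fract)
  then have "poly n x * poly d' x = poly n' x * poly d x" by (metis poly_mult)
  then show ?thesis using * by (simp add: frac_eq_eq)
qed

lemma val_at_add: assumes "val_at x f y" "val_at x f' y'" shows "val_at x (f + f') (y + y')"
proof -
  obtain n d n' d' where *: "f = Fraction_Field.Fract n d" "poly d x \<noteq> 0" "y = poly n x / poly d x"
    "f' = Fraction_Field.Fract n' d'" "poly d' x \<noteq> 0" "y' = poly n' x / poly d' x"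
    using assms by (auto simp: val_at_def)
  have "d \<noteq> 0" "d' \<noteq> 0" using * by auto
  then have "f + f' = Fraction_Field.Fract (n * d' + n' * d) (d * d')" using * by simp
  moreover have "y + y' = poly (n * d' + n' * d) x / poly (d * d') x" using * by (simp add: add_frac_eq)
  ultimately show ?thesis using val_at_Fract[of "d * d'" x "n * d' + n' * d"] * by simp
qed

lemma val_at_mult: assumes "val_at x f y" "val_at x f' y'" shows "val_at x (f * f') (y * y')"
proof -
  obtain n d n' d' where *: "f = Fraction_Field.Fract n d" "poly d x \<noteq> 0" "y = poly n x / poly d x"
    "f' = Fraction_Field.Fract n' d'" "poly d' x \<noteq> 0" "y' = poly n' x / poly d' x"
    using assms by (auto simp: val_at_def)
  then show ?thesis using val_at_Fract[of "d * d'" x "n * n'"] by simp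
qed

lemma val_at_0: "val_at x 0 0" and val_at_1: "val_at x 1 1"
  using val_at_const[of x 0] val_at_const[of x 1]
  by (simp_all add: Zero_fract_def One_fract_def one_pCons)

lemma val_at_sum: "(\<And>i. i \<in> A \<Longrightarrow> val_at x (f i) (v i)) \<Longrightarrow> val_at x (sum f A) (sum v A)"
  by (induction A rule: infinite_finite_induct) (auto intro: val_at_add val_at_0)

lemma val_at_prod: "(\<And>i. i \<in> A \<Longrightarrow> val_at x (f i) (v i)) \<Longrightarrow> val_at x (prod f A) (prod v A)"
  by (induction A rule: infinite_finite_induct) (auto intro: val_at_mult val_at_1)

lemma val_at_diff: assumes "val_at x f y" "val_at x f' y'" shows "val_at x (f - f') (y - y')"
proof -
  have "val_at x (- 1) (- 1)"
    using val_at_const[of x "- 1"] by (simp add: One_fract_def one_pCons)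
  from val_at_add[OF assms(1) val_at_mult[OF this assms(2)]] show ?thesis by simp
qed

text \<open>The cross difference of two distinct fractions has finitely many roots. Multiplying it
  by both denominators discards the points where a representative cannot be evaluated.\<close>

lemma fract_eqI_val_at:
  assumes "infinite X" "\<And>x. x \<in> X \<Longrightarrow> val_at x f (v x)" "\<And>x. x \<in> X \<Longrightarrow> val_at x f' (v x)"
  shows "f = f'"
proof -
  obtain n d where f: "f = Fraction_Field.Fract n d" "d \<noteq> 0" by (cases f) auto
  obtain n' d' where f': "f' = Fraction_Field.Fract n' d'" "d' \<noteq> 0" by (cases f') auto
  have "n * d' - n' * d = 0"
  proof (rule ccontr)
    assume nz: "n * d' - n' * d \<noteq> 0"
    then have "finite {x. poly ((n * d' - n' * d) * (d * d')) x = 0}"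
      using f f' by (intro poly_roots_finite) simp
    then have "\<not> X \<subseteq> {x. poly ((n * d' - n' * d) * (d * d')) x = 0}"
      using assms(1) finite_subset by blast
    then obtain x where x: "x \<in> X" "poly ((n * d' - n' * d) * (d * d')) x \<noteq> 0" by blast
    then have "val_at x f (poly n x / poly d x)" "val_at x f' (poly n' x / poly d' x)"
      using f f' by (auto intro: val_at_Fract)
    then have "poly n x / poly d x = poly n' x / poly d' x"
      using assms(2,3)[OF x(1)] val_at_unique by metis
    then show False using x by (simp add: frac_eq_eq)
  qed
  then show ?thesis using f f' by (simp add: eq_fract)
qed

context rho_place begin

lemma base_change_injective_hom:
  "injective_hom (\<lambda>p. Fraction_Field.Fract (map_poly emb p) 1 :: 'l poly fract)"
proof -
  have "map_poly emb (p + r) = map_poly emb p + map_poly emb r" for p r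
    by (rule poly_eqI) (simp add: coeff_map_poly emb_add)
  then show ?thesis by (simp add: injective_hom_def map_emb_mult Zero_fract_def eq_fract)
qed

lemma val_at_base_change: "val_at (th j) (base_change emb (Fr n m)) (io (Fr n m) ^ (q ^ j))"
proof -
  have "\<rho> ^ m \<noteq> 0" by simp
  then have "base_change emb (Fr n m) = Fraction_Field.Fract (map_poly emb n) (map_poly emb (\<rho> ^ m))"
    unfolding base_change_def by (simp add: fract_lift_Fract[OF base_change_injective_hom])
  then show ?thesis
    using val_at_Fract[of "map_poly emb (\<rho> ^ m)" "th j" "map_poly emb n"] ev_th_nz[of "\<rho> ^ m" j]
    by (simp add: iota_frob ev_def)
qed

lemma coeff_frob_injective_hom:
  "injective_hom (\<lambda>p :: 'l poly. Fraction_Field.Fract (map_poly (\<lambda>c. c ^ (q ^ m)) p) 1)"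
proof -
  have "map_poly (\<lambda>c. c ^ (q ^ m)) (p + r) =
      map_poly (\<lambda>c. c ^ (q ^ m)) p + map_poly (\<lambda>c. c ^ (q ^ m)) r" for p r :: "'l poly"
    by (rule poly_eqI) (simp add: coeff_map_poly frob_add del: power_eq_0_iff)
  moreover have "map_poly (\<lambda>c. c ^ (q ^ m)) (p * r) =
      map_poly (\<lambda>c. c ^ (q ^ m)) p * map_poly (\<lambda>c. c ^ (q ^ m)) r" for p r :: "'l poly"
    by (rule poly_eqI) (simp add: coeff_map_poly coeff_mult frob_sum power_mult_distrib)
  moreover have "map_poly (\<lambda>c. c ^ (q ^ m)) p = 0 \<longleftrightarrow> p = 0" for p :: "'l poly"
    by (simp add: poly_eq_iff coeff_map_poly)
  ultimately show ?thesis by (simp add: injective_hom_def Zero_fract_def eq_fract)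
qed

lemma val_at_coeff_frob_shtuka:
  "val_at (th j) (coeff_frob q m (shtuka q N \<theta> \<eta> (int k)))
     (1 / (th j - h (k + m)) - 1 / (th m - h (k + m)))"
proof -
  define F :: "'l poly fract \<Rightarrow> 'l poly fract" where "F = coeff_frob q m"
  have hom: "injective_hom F" unfolding F_def coeff_frob_def
    by (rule injective_hom_fract_lift[OF coeff_frob_injective_hom])
  have "F (a - b) = F a - F b" for a b
    using injective_hom_simps(1)[OF hom, of "a - b" b] by simp
  moreover have "F (Fraction_Field.Fract 1 [:- h k, 1:]) = Fraction_Field.Fract 1 [:- h (k + m), 1:]"
    unfolding F_def coeff_frob_def
    by (subst fract_lift_Fract[OF coeff_frob_injective_hom])
      (simp_all add: map_poly_pCons map_poly_1' frob_minus h_frob)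
  moreover have "F (Fraction_Field.Fract [:1 / (\<theta> - h k):] 1) = Fraction_Field.Fract [:1 / (th m - h (k + m)):] 1"
    unfolding F_def coeff_frob_def
    by (subst fract_lift_of_ring[OF coeff_frob_injective_hom])
      (simp add: map_poly_pCons power_divide frob_diff h_frob th_def)
  ultimately have "F (shtuka q N \<theta> \<eta> (int k)) =
      Fraction_Field.Fract 1 [:- h (k + m), 1:] - Fraction_Field.Fract [:1 / (th m - h (k + m)):] 1"
    by (simp only: shtuka_def conjg_int)
  moreover have "val_at (th j) (Fraction_Field.Fract 1 [:- h (k + m), 1:]) (1 / (th j - h (k + m)))"
    using val_at_Fract[of "[:- h (k + m), 1:]" "th j" 1] by simp
  ultimately show ?thesis unfolding F_def by (simp only: val_at_diff[OF _ val_at_const])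
qed

lemma val_at_shtuka_sum:
  "val_at (th j) (\<Sum>i\<le>degree P. Fraction_Field.Fract [:coeff P i:] 1 *
     shtuka_basis q (shtuka q N \<theta> \<eta> (int k)) i) (G k 1 P j)"
  unfolding G_eq_degree shtuka_basis_def S_def power_one mult_1
  by (intro val_at_sum val_at_mult val_at_const val_at_prod val_at_coeff_frob_shtuka)

text \<open>A rational function is determined by its values at the infinitely many points
  theta^(q^j), so the expansion of a in the s_i is equivalent to the equations defining
  \<open>Dmod k 1\<close>.\<close>

lemma from_shtuka_iff:
  "from_shtuka emb \<rho> \<theta> \<eta> (shtuka q N \<theta> \<eta> (int k)) \<Phi> \<longleftrightarrow> \<Phi> = Dmod k 1"
proof
  assume \<Phi>: "from_shtuka emb \<rho> \<theta> \<eta> (shtuka q N \<theta> \<eta> (int k)) \<Phi>"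
  have "\<Phi> a = Dmod k 1 a" if a: "a \<in> ringA \<rho>" for a
  proof (rule Dmod_eqI[symmetric, OF _ a])
    fix j
    obtain n m where n: "a = Fr n m" using ringA_cases[OF a] by blast
    have "val_at (th j) (base_change emb a) (G k 1 (\<Phi> a) j)"
      using \<Phi> a val_at_shtuka_sum[of j "\<Phi> a" k] by (simp add: from_shtuka_def flip: q_eq)
    then show "G k 1 (\<Phi> a) j = io a ^ (q ^ j)"
      using val_at_base_change[of j n m] n val_at_unique by blast
  qed simp
  moreover have "\<Phi> \<in> extensional (ringA \<rho>)" "Dmod k 1 \<in> extensional (ringA \<rho>)"
    using \<Phi> by (auto simp: from_shtuka_def rank_one_Drinfeld_def Dmod_def)
  ultimately show "\<Phi> = Dmod k 1" by (intro extensionalityI)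
next
  assume \<Phi>: "\<Phi> = Dmod k 1"
  have inf: "infinite (range th)"
    using th_inj by (intro range_inj_infinite) (auto simp: inj_def)
  have "base_change emb a = (\<Sum>i\<le>degree (\<Phi> a). Fraction_Field.Fract [:coeff (\<Phi> a) i:] 1 *
      shtuka_basis q (shtuka q N \<theta> \<eta> (int k)) i)" if a: "a \<in> ringA \<rho>" for a
  \<comment> \<open>\<open>inv th\<close> reads the index j off the point
    \<open>th j\<close>.\<close>
  proof (rule fract_eqI_val_at[OF inf, where v = "\<lambda>x. io a ^ (q ^ (inv th x))"])
    obtain n m where n: "a = Fr n m" using ringA_cases[OF a] by blast
    have inv: "inv th (th j) = j" for j by (rule inv_f_f) (auto simp: inj_def th_inj)
    fix x assume "x \<in> range th"
    then obtain j where x: "x = th j" by blast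
    show "val_at x (base_change emb a) (io a ^ (q ^ (inv th x)))"
      using val_at_base_change[of j n m] by (simp add: x inv n)
    show "val_at x (\<Sum>i\<le>degree (\<Phi> a). Fraction_Field.Fract [:coeff (\<Phi> a) i:] 1 *
      shtuka_basis q (shtuka q N \<theta> \<eta> (int k)) i) (io a ^ (q ^ (inv th x)))"
      using val_at_shtuka_sum[of j "\<Phi> a" k] G_Dmod[OF _ a, of 1 k j] by (simp add: x inv \<Phi>)
  qed
  then show "from_shtuka emb \<rho> \<theta> \<eta> (shtuka q N \<theta> \<eta> (int k)) \<Phi>"
    unfolding from_shtuka_def \<Phi> q_eq[symmetric] by (auto intro: rank_one_Dmod)
qed

lemma standard_modules_eq: "standard_modules emb \<rho> \<theta> \<eta> = {Dmod k 1 | k. k < N}"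
proof -
  have shtuka_mod: "shtuka q N \<theta> \<eta> i = shtuka q N \<theta> \<eta> (int (nat (i mod int N)))" for i
    using N_pos by (simp add: shtuka_def conjg_def)
  have lt: "nat (i mod int N) < N" for i using N_pos by (simp add: nat_less_iff)
  have "(\<exists>i. from_shtuka emb \<rho> \<theta> \<eta> (shtuka q N \<theta> \<eta> i) \<Phi>) \<longleftrightarrow> (\<exists>k<N. \<Phi> = Dmod k 1)" for \<Phi>
    using shtuka_mod lt from_shtuka_iff by metis
  then show ?thesis unfolding standard_modules_def q_eq[symmetric] N_eq[symmetric] by auto
qed

section \<open>The product formula\<close>

text \<open>The constant after m linear factors as long as no power of t appears. With D =
  \<open>dd k g m\<close>, w = \<open>g / (\<theta> - h k)\<close> and y = \<open>h (k + m)\<close>,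
  the constant term D^(q-1) w turns the numerator into D^q w (x - y) + D^q w (theta - x) = D^q w
  (theta - y), which is free of x.\<close>

primrec dd :: "nat \<Rightarrow> 'l \<Rightarrow> nat \<Rightarrow> 'l" where
  "dd k g 0 = 1"
| "dd k g (Suc m) = dd k g m ^ q * (g / (\<theta> - h k)) * (\<theta> - h (k + m))"

lemma dd_nz: "g \<noteq> 0 \<Longrightarrow> dd k g m \<noteq> 0"
  by (induction m) auto

text \<open>The correction to \<open>dd\<close> once powers of t appear: a power of 1/eta^(k+m-1).
  Truncated subtraction makes it 1 for m <= l.\<close>

definition ee :: "nat \<Rightarrow> nat \<Rightarrow> nat \<Rightarrow> 'l" where
  "ee k l m = inverse (h (k + m + N - 1)) ^ (m - l)"

lemma ee_Suc: "ee k l (Suc m) = ee k l m ^ q * (if m < l then 1 else inverse (h (k + m)))"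
proof -
  have 1: "k + Suc m + N - 1 = (k + m) + N" by simp
  have 2: "inverse (h (k + m + N - 1)) ^ q = inverse (h (k + m))"
  proof -
    have "Suc (k + m + N - 1) = (k + m) + N" using N_pos by linarith
    then have "h (k + m + N - 1) ^ q = h (k + m)" by (simp only: h_q h_add_N)
    then show ?thesis by (simp only: power_inverse)
  qed
  have 3: "(inverse (h (k + m + N - 1)) ^ (m - l)) ^ q = inverse (h (k + m)) ^ (m - l)"
    by (metis 2 power_commutes power_mult mult.commute)
  show ?thesis unfolding ee_def 1 h_add_N 3 by (auto simp: Suc_diff_le not_less)
qed

text \<open>Let D now be the product of \<open>dd\<close> and \<open>ee\<close>. For m >= l the
  extra factor theta/y changes D^q w (x - y) into D^q w (theta x/y - theta). Adding D^q w (theta -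
  x) leaves D^q w (theta - y) x/y, so each such step contributes one power of t.\<close>

definition aa :: "nat \<Rightarrow> 'l \<Rightarrow> nat \<Rightarrow> nat \<Rightarrow> 'l" where
  "aa k g l m = dd k g m ^ (q - 1) * (g / (\<theta> - h k)) *
     (if m < l then 1 else \<theta> / h (k + m) * ee k l m ^ (q - 1))"

text \<open>The partial products evaluate at $t = \theta^{q^j}$ to
  $t^{\max(m - l, 0)} / \prod_{i<m} (t - \eta^{(k+i)})$ up to the constant
  $dd \cdot ee$; in each step the constant term $a_m$ is the unique one that keeps this shape.\<close>
lemma G_partial_product:
  assumes g: "g \<noteq> 0"
  shows "G k g (skew_prod q (\<lambda>i. [:aa k g l i, 1:]) m) j =
     dd k g m * ee k l m * th j ^ (m - l) / (\<Prod>i<m. th j - h (k + i))"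
proof (induction m arbitrary: j)
  case 0
  then show ?case using G_const[of k g 1 j] by (simp add: ee_def one_pCons)
next
  case (Suc m)
  define w where "w = g / (\<theta> - h k)"
  define D where "D = dd k g m * ee k l m"
  define P where "P = skew_prod q (\<lambda>i. [:aa k g l i, 1:]) m"
  define x where "x = th j"
  define V where "V = (\<Prod>i<m. x - h (k + i))"
  have V: "V \<noteq> 0" by (auto simp: V_def x_def prod_zero_iff)
  define y where "y = h (k + m)"
  have xy: "x \<noteq> y" "\<theta> \<noteq> y" "y \<noteq> 0" by (auto simp: x_def y_def)
  have qq: "z ^ q = z ^ (q - 1) * z" for z :: 'l
    by (metis power_minus_mult q_pos)
  have aD: "aa k g l m * D = D ^ q * w * (if m < l then 1 else \<theta> / y)"
    by (auto simp: aa_def D_def w_def y_def qq ee_def power_mult_distrib)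
  have dS: "dd k g (Suc m) * ee k l (Suc m) = D ^ q * w * (\<theta> - y) * (if m < l then 1 else inverse y)"
    by (simp add: D_def ee_Suc power_mult_distrib w_def y_def)
  have rhs: "(\<Prod>i<Suc m. th j - h (k + i)) = V * (x - y)" by (simp add: V_def x_def y_def)
  have GP: "G k g P j = D * x ^ (m - l) / V" using Suc.IH[of j] by (simp add: P_def D_def x_def V_def)
  have "G k g (skew_mult q [:aa k g l m, 1:] P) j =
      aa k g l m * (D * x ^ (m - l) / V) + w * (\<theta> - x) * D ^ q * x ^ (m - l) / (V * (x - y))"
  proof (cases j)
    case 0
    then show ?thesis using GP by (simp add: G_skew_mult_linear_0 x_def)
  next
    case (Suc j')
    have thq: "th j' ^ q = x" by (simp add: th_q x_def Suc)
    \<comment> \<open>Frobenius moves every pole one step on; the factor 1/(x - eta^(k)) from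
      \<open>S\<close> supplies the missing first one.\<close>
    have "(\<Prod>i<m. th j' - h (k + i)) ^ q = (\<Prod>i<m. x - h (k + Suc i))"
      unfolding prod_power_distrib by (intro prod.cong refl) (simp add: frob_diff_q thq h_q)
    moreover have "(\<Prod>i<m. x - h (k + Suc i)) * (x - h k) = V * (x - y)"
      using prod.lessThan_Suc_shift[of "\<lambda>i. x - h (k + i)" m] by (simp add: V_def y_def mult.commute)
    then have "(\<Prod>i<m. x - h (k + Suc i)) = V * (x - y) / (x - h k)"
      by (simp add: x_def eq_divide_eq)
    ultimately have "G k g P j' ^ q = D ^ q * x ^ (m - l) * (x - h k) / (V * (x - y))"
      using Suc.IH[of j']
      by (simp add: P_def power_divide power_mult_distrib D_def thq power_mult[symmetric] mult.commute)
         (simp add: power_mult thq)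
    moreover have "S k g (Suc 0) j = w * (\<theta> - x) / (x - h k)"
      by (simp add: S_1 inv_diff x_def w_def)
    ultimately have "S k g (Suc 0) j * G k g P j' ^ q = w * (\<theta> - x) * D ^ q * x ^ (m - l) / (V * (x - y))"
      by (simp add: x_def mult_ac)
    then show ?thesis using GP unfolding Suc G_skew_mult_linear_Suc by simp
  qed
  also have "\<dots> = (aa k g l m * D * (x - y) + D ^ q * w * (\<theta> - x)) * x ^ (m - l) / (V * (x - y))"
    using V xy by (simp add: field_simps)
  also have "(aa k g l m * D * (x - y) + D ^ q * w * (\<theta> - x)) * x ^ (m - l) =
      dd k g (Suc m) * ee k l (Suc m) * x ^ (Suc m - l)"
    unfolding aD dS using xy by (auto simp: field_simps Suc_diff_le not_less)
  finally show ?case unfolding rhs by (simp add: P_def x_def)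
qed

lemma Dmod_genT:
  assumes g: "g \<noteq> 0" and n: "n \<le> N"
  shows "Dmod k g (genT \<rho> n) = smult (h (k + N - 1) ^ n / dd k g N)
    (skew_prod q (\<lambda>i. [:aa k g (N - n) i, 1:]) N)"
proof (rule Dmod_eqI[OF g genT_in_ringA[OF n]])
  fix j
  have e: "ee k (N - n) N = inverse (h (k + N - 1)) ^ n"
  proof -
    have "k + N + N - 1 = (k + N - 1) + N" using N_pos by linarith
    then show ?thesis using n by (simp only: ee_def h_add_N diff_diff_cancel)
  qed
  have "N - (N - n) = n" using n by simp
  then show "G k g (smult (h (k + N - 1) ^ n / dd k g N) (skew_prod q (\<lambda>i. [:aa k g (N - n) i, 1:]) N)) j =
      io (genT \<rho> n) ^ (q ^ j)"
    unfolding G_smult G_partial_product[OF g] iota_genT_frob e ev_rho_prod[of _ k]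
    using dd_nz[OF g, of k N] by (simp add: power_inverse)
qed

end

section \<open>The action of $\sigma$ and the twists\<close>

text \<open>An element of \<open>gal\<close> is constrained only on its field, so the laws are
  stated relative to a subfield. This form is stable under iteration, as sigma^k requires.\<close>

definition field_endo :: "'a::field set \<Rightarrow> ('a \<Rightarrow> 'a) \<Rightarrow> bool" where
  "field_endo F s \<longleftrightarrow> is_subfield F \<and> s ` F \<subseteq> F \<and> s 1 = 1 \<and>
     (\<forall>x\<in>F. \<forall>y\<in>F. s (x + y) = s x + s y \<and> s (x * y) = s x * s y)"

context
  fixes F :: "'a::field set" and s :: "'a \<Rightarrow> 'a"
  assumes s: "field_endo F s"
begin

lemma field_endo_subfield: "is_subfield F" using s by (simp add: field_endo_def)

lemma field_endo_simps:
  "x \<in> F \<Longrightarrow> s x \<in> F" "s 1 = 1" "x \<in> F \<Longrightarrow> y \<in> F \<Longrightarrow> s (x + y) = s x + s y"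
  "x \<in> F \<Longrightarrow> y \<in> F \<Longrightarrow> s (x * y) = s x * s y"
  using s by (auto simp: field_endo_def)

lemma field_endo_0: "s 0 = 0"
  using field_endo_simps(3)[of 0 0] is_subfield_0[OF field_endo_subfield]
  by (metis add_0 add_cancel_left_right)

lemma field_endo_diff: assumes "x \<in> F" "y \<in> F" shows "s (x - y) = s x - s y"
  using field_endo_simps(3)[of "x - y" y] assms is_subfield_closed(1)[OF field_endo_subfield]
  by (simp add: eq_diff_eq)

lemma field_endo_divide: assumes "x \<in> F" "y \<in> F" shows "s (x / y) = s x / s y"
proof (cases "y = 0")
  case False
  have inv: "inverse y \<in> F" using assms is_subfield_closed(3)[OF field_endo_subfield] by blast
  then have "s y * s (inverse y) = 1"
    using False assms field_endo_simps(2,4) by (metis right_inverse)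
  moreover from this have "s y \<noteq> 0" by auto
  ultimately have "s (inverse y) = inverse (s y)" by (simp add: inverse_unique)
  then show ?thesis using field_endo_simps(4)[OF assms(1) inv] by (simp add: divide_inverse)
qed (simp add: field_endo_0)

lemma field_endo_power: "x \<in> F \<Longrightarrow> s (x ^ n) = s x ^ n"
  by (induction n)
    (auto simp: field_endo_simps is_subfield_closed(9)[OF field_endo_subfield])

lemma field_endo_sum: "(\<And>i. i \<in> A \<Longrightarrow> f i \<in> F) \<Longrightarrow> s (sum f A) = (\<Sum>i\<in>A. s (f i))"
  by (induction A rule: infinite_finite_induct)
    (auto simp: field_endo_0 field_endo_simps is_subfield_sum[OF field_endo_subfield])

lemma field_endo_prod: "(\<And>i. i \<in> A \<Longrightarrow> f i \<in> F) \<Longrightarrow> s (prod f A) = (\<Prod>i\<in>A. s (f i))"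
  by (induction A rule: infinite_finite_induct)
    (auto simp: field_endo_simps is_subfield_prod[OF field_endo_subfield])

end

text \<open>Terms beyond the degree have exponent 0, so products with different exponents can be
  taken over one range.\<close>

lemma gexp_eq:
  assumes "\<And>i. (\<sigma> ^^ i) x = y i" "degree P \<le> n"
  shows "gexp \<sigma> x P = (\<Prod>i\<le>n. y i powi coeff P i)"
  unfolding gexp_def assms(1)
  by (rule prod.mono_neutral_left) (use assms(2) in \<open>auto simp: coeff_eq_0\<close>)

context
  fixes \<sigma> :: "'a::field \<Rightarrow> 'a" and x :: 'a
  assumes nz: "\<And>i. (\<sigma> ^^ i) x \<noteq> 0"
begin

lemma gexp_add: "gexp \<sigma> x (P + Q) = gexp \<sigma> x P * gexp \<sigma> x Q"
proof -
  let ?n = "max (degree P) (degree Q)"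
  have "degree (P + Q) \<le> ?n" by (rule degree_add_le_max)
  then show ?thesis
    using gexp_eq[of \<sigma> x "\<lambda>i. (\<sigma> ^^ i) x" _ ?n] nz by (simp add: power_int_add prod.distrib)
qed

lemma gexp_smult: "gexp \<sigma> x (smult c P) = gexp \<sigma> x P powi c"
proof -
  have prod: "(\<Prod>i\<in>A. f i) powi c = (\<Prod>i\<in>A. f i powi c)" for f :: "nat \<Rightarrow> 'a" and A
    by (induction A rule: infinite_finite_induct) (auto simp: power_int_mult_distrib)
  show ?thesis
    using gexp_eq[of \<sigma> x "\<lambda>i. (\<sigma> ^^ i) x" _ "degree P"] degree_smult_le[of c P]
    by (simp add: prod power_int_mult[symmetric] mult.commute)
qed

lemma gexp_monom: "gexp \<sigma> x (monom c n) = (\<sigma> ^^ n) x powi c"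
proof -
  have "(\<Prod>i\<le>n. (\<sigma> ^^ i) x powi (if n = i then c else 0)) =
      (\<Prod>i\<le>n. if i = n then (\<sigma> ^^ n) x powi c else 1)"
    by (intro prod.cong) auto
  then show ?thesis
    using gexp_eq[of \<sigma> x "\<lambda>i. (\<sigma> ^^ i) x" "monom c n" n] degree_monom_le[of c n] by simp
qed

lemma gexp_0: "gexp \<sigma> x 0 = 1" by (simp add: gexp_def)

text \<open>Brings gamma into the one-step form of the recursion of \<open>dd\<close>, against which
  it will be matched.\<close>

lemma gam_Suc: "gam q (Suc k) = smult (int q) (gam q k) + monom 1 k"
proof -
  have "smult (int q) (gam q k) = (\<Sum>i<k. monom (int q ^ Suc i) (k - 1 - i))"
    by (rule poly_eqI) (simp add: gam_def coeff_sum sum_distrib_left mult.commute if_distrib cong: if_cong)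
  then show ?thesis unfolding gam_def
    by (simp add: sum.lessThan_Suc_shift add.commute del: sum.lessThan_Suc)
qed

lemma gexp_gam_0: "gexp \<sigma> x (gam q 0) = 1"
  by (simp add: gam_def gexp_0)

lemma gexp_gam_Suc: "gexp \<sigma> x (gam q (Suc k)) = gexp \<sigma> x (gam q k) ^ q * (\<sigma> ^^ k) x"
  unfolding gam_Suc gexp_add gexp_smult gexp_monom by simp

end

locale sigma_place = rho_place emb q \<rho> \<theta> \<eta> N
  for emb :: "'f::{field,finite} \<Rightarrow> 'l::field" and q :: nat
    and \<rho> :: "'f poly" and \<theta> \<eta> :: 'l and N :: nat +
  fixes \<sigma> :: "'l \<Rightarrow> 'l"
  assumes sigma: "\<sigma> \<in> gal (adjoin emb {\<theta>, \<eta>}) (adjoin emb {\<theta>})" and sigma_eta: "\<sigma> \<eta> = \<eta> ^ q"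
begin

abbreviation "H \<equiv> adjoin emb {\<theta>, \<eta>}"
abbreviation "K \<equiv> adjoin emb {\<theta>}"

lemma H_subfield: "is_subfield H" by (rule adjoin_subfield)

lemma theta_in_K: "\<theta> \<in> K" and theta_in_H: "\<theta> \<in> H" and eta_in_H: "\<eta> \<in> H"
  by (auto intro: adjoin_gen)

lemmas H_closed = is_subfield_closed[OF H_subfield]

lemma h_in_H: "h i \<in> H" unfolding h_def by (intro H_closed eta_in_H)
lemma th_in_H: "th i \<in> H" unfolding th_def by (intro H_closed theta_in_H)

lemma sigma_fixed: "x \<in> K \<Longrightarrow> (\<sigma> ^^ i) x = x"
  using sigma by (induction i) (auto simp: gal_def)

lemma sigma_endo: "field_endo H (\<sigma> ^^ i)"
proof (induction i)
  case 0
  then show ?case by (simp add: field_endo_def H_subfield)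
next
  case (Suc i)
  have 1: "\<sigma> ` H = H" "\<And>x y. x \<in> H \<Longrightarrow> y \<in> H \<Longrightarrow> \<sigma> (x + y) = \<sigma> x + \<sigma> y \<and> \<sigma> (x * y) = \<sigma> x * \<sigma> y"
    using sigma by (auto simp: gal_def bij_betw_def)
  have "\<sigma> x \<in> H" if "x \<in> H" for x using 1(1) that by blast
  moreover have "(\<sigma> ^^ Suc i) 1 = 1"
    by (rule sigma_fixed) (rule is_subfield_closed(4)[OF adjoin_subfield])
  ultimately show ?case using Suc 1(2) by (simp add: field_endo_def image_subset_iff)
qed

lemmas sigma_simps = field_endo_simps[OF sigma_endo] field_endo_diff[OF sigma_endo]
  field_endo_divide[OF sigma_endo] field_endo_power[OF sigma_endo] field_endo_sum[OF sigma_endo]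
  field_endo_prod[OF sigma_endo] field_endo_0[OF sigma_endo]

lemma sigma_theta: "(\<sigma> ^^ i) \<theta> = \<theta>" using sigma_fixed theta_in_K by blast

lemma sigma_h: "(\<sigma> ^^ i) (h k) = h (k + i)"
proof (induction i)
  case (Suc i)
  have "\<sigma> (h (k + i)) = h (Suc (k + i))"
    unfolding h_def using field_endo_power[OF sigma_endo[of 1] eta_in_H, of "q ^ (k + i)"]
    by (simp add: sigma_eta power_mult)
  then show ?case using Suc by simp
qed simp

lemma sigma_th: "(\<sigma> ^^ i) (th j) = th j"
  unfolding th_def by (simp add: sigma_simps theta_in_H sigma_theta)

lemma sigma_Theta: "(\<sigma> ^^ i) (1 / (\<theta> - h k)) = 1 / (\<theta> - h (k + i))"
  by (simp add: sigma_simps theta_in_H h_in_H H_closed(1,4) sigma_theta sigma_h)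

lemma sigma_Theta_neg: "(\<sigma> ^^ i) (1 / (h k - \<theta>)) = 1 / (h (k + i) - \<theta>)"
  by (simp add: sigma_simps theta_in_H h_in_H H_closed(1,4) sigma_theta sigma_h)

lemma S_in_subfield:
  assumes F: "is_subfield F" and "\<theta> \<in> F" "\<eta> \<in> F" "g \<in> F"
  shows "S k g i j \<in> F"
  unfolding S_def th_def h_def
  by (intro is_subfield_prod[OF F] is_subfield_closed[OF F] assms)

lemma iota_in_subfield:
  assumes F: "is_subfield F" and "range emb \<subseteq> F" "\<theta> \<in> F" "a \<in> ringA \<rho>"
  shows "io a \<in> F"
proof -
  obtain n m where "a = Fr n m" using ringA_cases[OF assms(4)] by blast
  then show ?thesis
    by (simp add: iota_Fract) (intro is_subfield_closed[OF F] ev_in_subfield assms)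
qed

text \<open>The triangular system has its entries in F and can be solved there. This provides
  coefficients in H, where sigma is meaningful, and in H^+ for the Hayes modules.\<close>

lemma Dmod_coeff_in_subfield:
  assumes F: "is_subfield F" and "range emb \<subseteq> F" "\<theta> \<in> F" "\<eta> \<in> F" "g \<in> F" and g: "g \<noteq> 0"
    and a: "a \<in> ringA \<rho>"
  shows "coeff (Dmod k g a) n \<in> F"
proof (induction n rule: less_induct)
  case (less n)
  define P where "P = Dmod k g a"
  note S_in = S_in_subfield[OF F assms(3,4,5)]
  have "io a ^ (q ^ n) = (\<Sum>i<n. coeff P i * S k g i n) + coeff P n * S k g n n"
    using G_Dmod[OF g a, of k n] by (simp add: P_def G_def lessThan_Suc_atMost[symmetric])
  then have "coeff P n = (io a ^ (q ^ n) - (\<Sum>i<n. coeff P i * S k g i n)) / S k g n n"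
    using S_diag[OF g, of k n] by (simp add: field_simps)
  moreover have "(\<Sum>i<n. coeff P i * S k g i n) \<in> F"
    by (intro is_subfield_sum[OF F] is_subfield_closed(2)[OF F] S_in) (simp add: less P_def)
  moreover have "io a ^ (q ^ n) \<in> F"
    by (intro is_subfield_closed[OF F] iota_in_subfield assms a)
  ultimately show ?case using is_subfield_closed(1,7)[OF F] S_in by (simp add: P_def)
qed

text \<open>sigma^k fixes theta^(q^j) and iota(a) and moves eta^(i) to eta^(i+k), so it carries the
  system defining \<open>Dmod 0 1\<close> to the one defining \<open>Dmod k 1\<close>.\<close>

lemma twist_Dmod: "twist \<rho> \<sigma> k (Dmod 0 1) = Dmod k 1"
proof -
  have "map_poly (\<sigma> ^^ k) (Dmod 0 1 a) = Dmod k 1 a" if a: "a \<in> ringA \<rho>" for a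
  proof (rule Dmod_eqI[symmetric, OF _ a])
    fix j
    define P where "P = Dmod 0 1 a"
    have range: "range emb \<subseteq> K" "range emb \<subseteq> H" by (auto intro: adjoin_base)
    have P: "coeff P i \<in> H" for i
      unfolding P_def using range
      by (intro Dmod_coeff_in_subfield H_subfield theta_in_H eta_in_H H_closed a) auto
    have S: "(\<sigma> ^^ k) (S 0 1 i j) = S k 1 i j" for i
      unfolding S_def power_one mult_1
      by (subst sigma_simps)
        (auto intro!: H_closed th_in_H h_in_H prod.cong
          simp: sigma_simps H_closed th_in_H h_in_H sigma_th sigma_h add_ac)
    have S_in: "S 0 1 i j \<in> H" for i
      by (intro S_in_subfield H_subfield theta_in_H eta_in_H H_closed)
    have coeff: "coeff (map_poly (\<sigma> ^^ k) P) i = (\<sigma> ^^ k) (coeff P i)" for i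
      by (rule coeff_map_poly) (simp add: sigma_simps)
    have "G k 1 (map_poly (\<sigma> ^^ k) P) j = (\<sigma> ^^ k) (G 0 1 P j)"
      unfolding G_def by (simp add: sigma_simps H_closed P S_in coeff S)
    also have "\<dots> = io a ^ (q ^ j)"
      unfolding P_def G_Dmod[OF one_neq_zero a] using range
      by (intro sigma_fixed is_subfield_closed[OF adjoin_subfield] iota_in_subfield theta_in_K a adjoin_subfield)
    finally show "G k 1 (map_poly (\<sigma> ^^ k) (Dmod 0 1 a)) j = io a ^ (q ^ j)" by (simp add: P_def)
  qed simp
  then show ?thesis by (auto simp: twist_def Dmod_def restrict_def)
qed

section \<open>Closed forms of the constants of the standard modules\<close>

lemma W_Suc: "W q (Suc m) = q * W q m + 1" and W_mult: "(q - 1) * W q m + 1 = q ^ m"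
proof -
  have *: "(q - 1) * W q m + 1 = q ^ m" for m
  proof -
    have "\<exists>c. q ^ m = (q - 1) * c + 1"
    proof (induction m)
      case (Suc m)
      then obtain c where "q ^ m = (q - 1) * c + 1" by blast
      moreover obtain p where "q = Suc p" using q_pos gr0_implies_Suc by blast
      ultimately have "q ^ Suc m = (q - 1) * (q * c + 1) + 1" by (simp add: algebra_simps)
      then show ?case by blast
    qed auto
    then show ?thesis using q_ge_2 by (auto simp: W_def)
  qed
  then show "(q - 1) * W q m + 1 = q ^ m" .
  obtain p where p: "q = Suc p" using q_pos gr0_implies_Suc by blast
  have "(q - 1) * W q (Suc m) + 1 = q * ((q - 1) * W q m + 1)"
    by (simp only: * power_Suc)
  also have "\<dots> = (q - 1) * (q * W q m + 1) + 1" by (simp add: p algebra_simps)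
  finally have "(q - 1) * W q (Suc m) + 1 = (q - 1) * (q * W q m + 1) + 1" .
  then show "W q (Suc m) = q * W q m + 1" using q_ge_2 by (simp del: mult_Suc_right)
qed

lemma W_0: "W q 0 = 0" by (simp add: W_def)

definition AA :: "nat \<Rightarrow> 'l" where "AA m = gexp \<sigma> (1 / (\<theta> - \<eta>)) (gam q m)"

lemma Theta_nz: "(\<sigma> ^^ i) (1 / (\<theta> - \<eta>)) \<noteq> 0"
  using sigma_Theta[of i 0] by simp

lemma AA_0: "AA 0 = 1" unfolding AA_def by (rule gexp_gam_0[OF Theta_nz])

lemma AA_Suc: "AA (Suc m) = AA m ^ q * (1 / (\<theta> - h m))"
  unfolding AA_def gexp_gam_Suc[OF Theta_nz] using sigma_Theta[of m 0] by simp

text \<open>Numerator and denominator follow the recursions of W and gamma. At m = N the inverse is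
  the leading factor Theta^(gamma_N - W_N).\<close>

lemma dd_standard: "dd 0 1 m = (1 / (\<theta> - \<eta>)) ^ W q m / AA m"
  by (induction m)
    (auto simp: W_0 AA_0 W_Suc AA_Suc power_divide power_mult_distrib power_mult[symmetric] mult.commute)

lemma powi_1_minus_q: "x powi (1 - int q) = inverse x ^ (q - 1)" for x :: 'l
proof -
  have "1 - int q = - int (q - 1)" using q_ge_2 by arith
  then show ?thesis by (simp only: power_int_minus power_int_of_nat power_inverse)
qed

text \<open>Since q^m = (q - 1) W_m + 1, the bracket is the (q - 1)-st power of Theta^(W_m) /
  Theta^(gamma_m), times Theta, up to the powers of t handled by \<open>ee\<close>.\<close>

lemma angle_eq: "angle q N \<sigma> \<theta> \<eta> l m = aa 0 1 l m"
proof -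
  define \<Theta> where "\<Theta> = 1 / (\<theta> - \<eta>)"
  have "gexp \<sigma> \<Theta> (smult (1 - int q) (gam q m)) = inverse (AA m) ^ (q - 1)"
    unfolding \<Theta>_def gexp_smult[OF Theta_nz] powi_1_minus_q AA_def ..
  moreover have "\<Theta> ^ (q ^ m) = (\<Theta> ^ W q m) ^ (q - 1) * \<Theta>"
    by (simp add: W_mult[of m, symmetric] power_mult[symmetric] mult.commute)
  ultimately have x: "gexp \<sigma> \<Theta> (smult (1 - int q) (gam q m)) * \<Theta> ^ (q ^ m) = dd 0 1 m ^ (q - 1) * \<Theta>"
    by (simp add: dd_standard \<Theta>_def[symmetric] power_divide power_inverse field_simps)
  show ?thesis
  proof (cases "m < l")
    case True
    then show ?thesis using x by (simp add: angle_def Let_def aa_def \<Theta>_def)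
  next
    case False
    have "conjg q N \<eta> (int m - 1) powi ((1 - int q) * (int m - int l)) = ee 0 l m ^ (q - 1)"
    proof -
      have "int m - int l = int (m - l)" using False by (simp add: of_nat_diff)
      then show ?thesis
        by (simp only: power_int_mult power_int_of_nat powi_1_minus_q conjg_pred ee_def add_0)
          (simp only: power_mult[symmetric] mult.commute)
    qed
    moreover define X where "X = gexp \<sigma> \<Theta> (smult (1 - int q) (gam q m)) * \<Theta> ^ (q ^ m)"
    ultimately have "angle q N \<sigma> \<theta> \<eta> l m = \<theta> * (ee 0 l m ^ (q - 1) / h m) * X"
      using False by (simp add: angle_def Let_def \<Theta>_def)
    then show ?thesis using x False by (simp add: aa_def X_def \<Theta>_def)
  qed
qed

lemma standard_genT:
  assumes "n < N"
  shows "Dmod 0 1 (genT \<rho> n) =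
    smult (conjg q N \<eta> (- 1) ^ n * gexp \<sigma> (1 / (\<theta> - \<eta>)) (gam q N - [:int (W q N):]))
      (skew_prod q (\<lambda>i. [:angle q N \<sigma> \<theta> \<eta> (N - n) i, 1:]) N)"
proof -
  have "gam q N - [:int (W q N):] = gam q N + monom (- int (W q N)) 0"
    by (simp add: monom_0)
  then have "gexp \<sigma> (1 / (\<theta> - \<eta>)) (gam q N - [:int (W q N):]) = AA N / (1 / (\<theta> - \<eta>)) ^ W q N"
    by (simp only: gexp_add[OF Theta_nz] gexp_monom[OF Theta_nz] AA_def[symmetric] funpow_0)
      (simp add: power_int_minus divide_inverse)
  then show ?thesis
    using Dmod_genT[of 1 n 0] assms
    by (simp add: angle_eq dd_standard conjg_minus_1)
qed

end

section \<open>Hayes modules\<close>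

context rho_place begin

lemma coeff_skew_prod_linear: "coeff (skew_prod q (\<lambda>i. [:a i :: 'l, 1:]) m) m = 1"
proof -
  have "degree (skew_prod q (\<lambda>i. [:a i, 1:]) m) \<le> m \<and> coeff (skew_prod q (\<lambda>i. [:a i, 1:]) m) m = 1"
  proof (induction m)
    case (Suc m)
    then show ?case
      using degree_skew_mult_le[of "[:a m, 1:]" "skew_prod q (\<lambda>i. [:a i, 1:]) m"]
        coeff_skew_mult_top[of "[:a m, 1:]" 1 "skew_prod q (\<lambda>i. [:a i, 1:]) m" m]
      by simp
  qed simp
  then show ?thesis by simp
qed

lemma coeff_Dmod_genT:
  assumes "g \<noteq> 0" "n \<le> N"
  shows "coeff (Dmod k g (genT \<rho> n)) N = h (k + N - 1) ^ n / dd k g N"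
  by (simp add: Dmod_genT[OF assms] coeff_skew_prod_linear)

text \<open>The leading coefficients at T_1 and T_0 have ratio eta^(k-1), which determines k. Then g
  is read off the equation at j = 1, for an a with iota(a)^q different from iota(a).\<close>

lemma Dmod_inj:
  assumes "k < N" "k' < N" "g \<noteq> 0" "g' \<noteq> 0" and eq: "Dmod k g = Dmod k' g'"
  shows "k = k' \<and> g = g'"
proof
  have "h (k + N - 1) ^ n / dd k g N = h (k' + N - 1) ^ n / dd k' g' N" if "n \<le> N" for n
    using coeff_Dmod_genT assms that by metis
  from this[of 0] this[of 1] have "h (k + N - 1) = h (k' + N - 1)"
    using N_ge_2 dd_nz[OF assms(3), of k N] by (simp add: field_simps)
  then have "h (k + N - 1) ^ q = h (k' + N - 1) ^ q" by simp
  moreover have "Suc (k + N - 1) = k + N" "Suc (k' + N - 1) = k' + N" using N_pos by linarith+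
  ultimately have "h k = h k'" by (simp only: h_q h_add_N)
  then show k: "k = k'" using assms h_inj by blast
  obtain a where a: "a \<in> ringA \<rho>" "io a ^ q \<noteq> io a"
  proof -
    have "io (genT \<rho> 0) ^ q \<noteq> io (genT \<rho> 0) \<or> io (genT \<rho> 1) ^ q \<noteq> io (genT \<rho> 1)"
    proof (rule ccontr)
      assume *: "\<not> ?thesis"
      define x where "x = io (genT \<rho> 0)"
      have x: "x \<noteq> 0" using ev_th_nz[of \<rho> 0] iota_genT_frob[of 0 0] by (simp add: x_def)
      have x1: "io (genT \<rho> 1) = \<theta> * x"
        using iota_genT_frob[of 0 0] iota_genT_frob[of 1 0] by (simp add: x_def)
      have "x ^ q = x" "(\<theta> * x) ^ q = \<theta> * x" using * x1 by (auto simp: x_def)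
      then have "\<theta> ^ q = \<theta>" using x by (simp add: power_mult_distrib)
      then have "th 1 = th 0" by (simp add: th_def)
      then show False by (simp only: th_inj)
    qed
    then show ?thesis using that genT_in_ringA[of 0] genT_in_ringA[of 1] N_ge_2 by auto
  qed
  define c where "c = coeff (Dmod k g a) 1"
  have *: "io a ^ q = io a + c * (f * (1 / (th 1 - h k) - 1 / (\<theta> - h k)))"
    if "Dmod k f = Dmod k g" "f \<noteq> 0" for f
    using G_Dmod[OF that(2) a(1), of k 1] G_Dmod[OF that(2) a(1), of k 0] that(1)
    by (simp add: G_def S_1 c_def)
  have "c * (g * (1 / (th 1 - h k) - 1 / (\<theta> - h k))) = c * (g' * (1 / (th 1 - h k) - 1 / (\<theta> - h k)))"
    using *[of g] *[of g'] assms k by simp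
  moreover have "c * (g * (1 / (th 1 - h k) - 1 / (\<theta> - h k))) \<noteq> 0" using *[of g] assms a by force
  ultimately show "g = g'" by simp
qed

lemma power_frob_in_gal: "(\<lambda>x. x ^ (q ^ k)) \<in> gal (adjoin emb {\<eta>}) (range emb)"
  unfolding adjoin_eta gal_def
proof (intro CollectI conjI ballI)
  have inj: "inj_on (\<lambda>x. x ^ (q ^ k)) Eset" by (auto simp: inj_on_def frob_inj)
  moreover have "(\<lambda>x. x ^ (q ^ k)) ` Eset \<subseteq> Eset"
    using is_subfield_closed(9)[OF Eset_subfield] by auto
  ultimately show "bij_betw (\<lambda>x. x ^ (q ^ k)) Eset Eset"
    using endo_inj_surj[OF finite_Eset] by (simp add: bij_betw_def)
qed (auto simp: frob_add power_mult_distrib emb_frob)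

lemma Fr_one_power: "Fr 1 m = genT \<rho> 0 ^ m"
  by (simp add: genT_def Fract_power)

text \<open>The constant in \<open>Dmod_lead\<close> is the same for all n. It is found at n = 1,
  where 1/rho^m is a power of T_0, whose image has leading coefficient 1.\<close>

lemma Dmod_lead_coeff:
  assumes g: "g \<noteq> 0" and dd: "dd k g N = 1" and n: "degree n \<le> m * N" "\<not> \<rho> dvd n"
  shows "lead_coeff (Dmod k g (Fr n m)) = ev n (h (k + N - 1))"
proof -
  interpret D: rank_one_module emb q \<rho> \<theta> \<eta> N "Dmod k g"
    by unfold_locales (rule rank_one_Dmod[OF g])
  obtain C where C: "\<And>n. degree n \<le> m * N \<Longrightarrow> degree (Dmod k g (Fr n m)) \<le> m * N \<and>
      coeff (Dmod k g (Fr n m)) (m * N) = C * ev n (h (k + N - 1))"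
    using Dmod_lead[OF g, of m k] by blast
  have T0: "genT \<rho> 0 \<in> ringA \<rho>" by (simp add: genT_in_ringA)
  have top: "coeff (Dmod k g (genT \<rho> 0 ^ i)) (i * N) = 1 \<and> degree (Dmod k g (genT \<rho> 0 ^ i)) \<le> i * N" for i
  proof (induction i)
    case 0
    then show ?case by (simp add: D.psi_1)
  next
    case (Suc i)
    have deg: "degree (Dmod k g (genT \<rho> 0)) \<le> N"
      using D.degree_R[of 0] by (simp add: D.R_def)
    have c: "coeff (Dmod k g (genT \<rho> 0)) N = 1" using coeff_Dmod_genT[OF g, of 0 k] dd by simp
    have "Dmod k g (genT \<rho> 0 ^ Suc i) = skew_mult q (Dmod k g (genT \<rho> 0)) (Dmod k g (genT \<rho> 0 ^ i))"
      using D.psi_mult[OF T0 ringA_power[OF T0]] by simp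
    then show ?case
      using Suc deg c coeff_skew_mult_top[OF deg, of "Dmod k g (genT \<rho> 0 ^ i)" "i * N"]
        order.trans[OF degree_skew_mult_le add_mono[OF deg, of "degree (Dmod k g (genT \<rho> 0 ^ i))" "i * N"]]
      by simp
  qed
  have "C = 1" using C[of 1] top[of m] by (simp add: Fr_one_power)
  moreover have "degree (Dmod k g (Fr n m)) = m * N"
    by (rule rank_one_degree[OF rank_one_Dmod[OF g] n(2,1)])
  ultimately show ?thesis using C[OF n(1)] by simp
qed

end

section \<open>The equations defining U_rho\<close>

context sigma_place begin

definition BB :: "nat \<Rightarrow> nat \<Rightarrow> 'l" where
  "BB k m = gexp \<sigma> (1 / (h k - \<theta>)) (gam q m)"

lemma Theta_neg_nz: "(\<sigma> ^^ i) (1 / (h k - \<theta>)) \<noteq> 0"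
  by (simp add: sigma_Theta_neg)

lemma BB_0: "BB k 0 = 1" unfolding BB_def by (rule gexp_gam_0[OF Theta_neg_nz])

lemma BB_Suc: "BB k (Suc m) = BB k m ^ q * (1 / (h (k + m) - \<theta>))"
  unfolding BB_def gexp_gam_Suc[OF Theta_neg_nz] sigma_Theta_neg ..

lemma BB_nz: "BB k m \<noteq> 0" by (induction m) (auto simp: BB_0 BB_Suc)

text \<open>Splits off the factor with the highest exponent, where \<open>BB_Suc\<close> splits off
  the one with exponent 1.\<close>

lemma BB_shift: "BB k (Suc m) = (1 / (h k - \<theta>)) ^ (q ^ m) * BB (Suc k) m"
proof (induction m)
  case (Suc m)
  have "BB k (Suc (Suc m)) = ((1 / (h k - \<theta>)) ^ (q ^ m) * BB (Suc k) m) ^ q * (1 / (h (k + Suc m) - \<theta>))"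
    using BB_Suc[of k "Suc m"] by (simp only: Suc)
  then show ?case
    by (simp add: BB_Suc power_mult_distrib frob_Suc del: power_Suc)
qed (simp add: BB_0 BB_Suc)

lemma frob_pred: "x ^ (q ^ m) = x ^ (q ^ m - 1) * x" for x :: 'l
  by (metis power_minus_mult qpow_pos)

text \<open>Compares the two splittings of \<open>BB k (Suc N)\<close>, whose first and last bases
  agree because eta^(k+N) = eta^(k).\<close>

lemma BB_N_Suc: "BB (Suc k) N = BB k N ^ q * (\<theta> - h k) ^ (q ^ N - 1)"
proof -
  define X where "X = \<theta> - h k"
  have X: "X \<noteq> 0" "1 / (h k - \<theta>) = - (1 / X)" by (simp_all add: X_def minus_divide_right)
  have "- ((1 / X) ^ (q ^ N)) * BB (Suc k) N = BB k N ^ q * - (1 / X)"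
    using BB_shift[of k N] BB_Suc[of k N] by (simp add: X frob_minus)
  then have "(1 / X) ^ (q ^ N) * BB (Suc k) N = BB k N ^ q * (1 / X)" by simp
  then have "BB (Suc k) N * X = BB k N ^ q * X ^ (q ^ N)"
    using X by (simp add: power_divide field_simps)
  then show ?thesis using X unfolding X_def[symmetric] frob_pred[of X N] by simp
qed

lemma BB_in_H: "BB k m \<in> H"
  by (induction m) (auto simp: BB_0 BB_Suc intro!: H_closed h_in_H theta_in_H)

lemma sigma_BB: "\<sigma> (BB k m) = BB (Suc k) m"
proof (induction m)
  case 0
  then show ?case using sigma_simps(2)[of 1] by (simp add: BB_0)
next
  case (Suc m)
  define c where "c = 1 / (h (k + m) - \<theta>)"
  have c: "c \<in> H" unfolding c_def by (intro H_closed h_in_H theta_in_H)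
  have sc: "\<sigma> c = 1 / (h (Suc k + m) - \<theta>)"
    using sigma_Theta_neg[of 1 "k + m"] by (simp add: c_def)
  have "\<sigma> (BB k (Suc m)) = \<sigma> (BB k m ^ q * c)" by (simp only: BB_Suc c_def)
  also have "\<dots> = \<sigma> (BB k m) ^ q * \<sigma> c"
    using field_endo_simps(4)[OF sigma_endo[of 1] H_closed(9)[OF BB_in_H] c]
      field_endo_power[OF sigma_endo[of 1] BB_in_H] by simp
  finally show ?case by (simp only: Suc sc BB_Suc)
qed

text \<open>Applying $\sigma$ to the hypothesis gives
  $(\theta - \eta^{(k)})^{q^N - 1} = (\theta - \eta^{(k')})^{q^N - 1}$, hence
  $\theta^{q^N} = \theta$ unless $k = k'$.\<close>
lemma BB_N_inj:
  assumes "k < N" "k' < N" "BB k N = BB k' N"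
  shows "k = k'"
proof -
  define X Y where "X = \<theta> - h k" and "Y = \<theta> - h k'"
  have "BB (Suc k) N = BB (Suc k') N" using sigma_BB assms by metis
  then have "X ^ (q ^ N - 1) = Y ^ (q ^ N - 1)"
    using assms(3) BB_nz[of k' N] by (simp add: BB_N_Suc X_def Y_def)
  then have "X ^ (q ^ N) * Y = Y ^ (q ^ N) * X" by (simp add: frob_pred mult_ac)
  then have "(th N - h k) * Y = (th N - h k') * X"
    by (simp add: X_def Y_def frob_diff h_frob_N th_def)
  then have "(th N - \<theta>) * (h k - h k') = 0" by (simp add: X_def Y_def algebra_simps)
  moreover have "th N \<noteq> \<theta>" using th_inj[of N 0] N_pos by simp
  ultimately show ?thesis using h_inj[OF assms(1,2)] by simp
qed

text \<open>In each step theta - eta^(k+m) cancels against its negative, and the remaining factors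
  obey the recursion of W.\<close>

lemma dd_BB: "dd k g m * BB k m = (- (g / (\<theta> - h k))) ^ W q m"
proof (induction m)
  case (Suc m)
  define w where "w = g / (\<theta> - h k)"
  define X where "X = \<theta> - h (k + m)"
  have X: "X \<noteq> 0" "1 / (h (k + m) - \<theta>) = - (1 / X)" by (simp_all add: X_def minus_divide_right)
  have "dd k g (Suc m) * BB k (Suc m) = (dd k g m * BB k m) ^ q * - w"
    unfolding BB_Suc X(2) using X(1) by (simp add: w_def[symmetric] X_def[symmetric] power_mult_distrib)
  also have "\<dots> = (- w) ^ W q (Suc m)"
    by (simp only: Suc.IH w_def[symmetric] W_Suc power_add power_mult power_one_right mult.commute[of q])
  finally show ?case by (simp only: w_def)
qed (simp add: BB_0 W_0)

lemma W_N_pos: "W q N > 0"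
  using W_mult[of N] qN_gt_1 by (cases "W q N = 0") auto

text \<open>The normalisation of Hayes modules thus becomes the k-th equation of U_rho, in the
  unknown x = -g/(theta - eta^(k)).\<close>

lemma dd_N_eq_1_iff: "dd k (- x * (\<theta> - h k)) N = 1 \<longleftrightarrow> x ^ W q N = BB k N"
proof -
  have "dd k (- x * (\<theta> - h k)) N * BB k N = x ^ W q N"
    using dd_BB[of k "- x * (\<theta> - h k)" N] by simp
  then show ?thesis using BB_nz[of k N] by (metis mult_cancel_right1 mult_1)
qed

lemma root_of_unity_in_Eset: assumes "\<mu> ^ W q N = 1" shows "\<mu> \<in> Eset"
proof -
  have "\<mu> ^ (q ^ N) = (\<mu> ^ W q N) ^ (q - 1) * \<mu>"
    by (simp add: W_mult[of N, symmetric] power_mult[symmetric] mult.commute)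
  then show ?thesis using assms by (simp add: mem_Eset_iff)
qed

text \<open>All (q - 1) W_N nonzero elements of F_q(eta) are roots of x^((q-1) W_N) - 1. The
  cofactor of x^(W_N) - 1 accounts for at most (q - 2) W_N of them.\<close>

lemma finite_roots_of_unity: "finite {\<mu> :: 'l. \<mu> ^ W q N = 1}"
  and card_roots_of_unity: "card {\<mu> :: 'l. \<mu> ^ W q N = 1} = W q N"
proof -
  let ?R = "{\<mu> :: 'l. \<mu> ^ W q N = 1}"
  define w where "w = W q N"
  have w: "w > 0" using W_N_pos by (simp add: w_def)
  let ?P = "monom 1 w - 1 :: 'l poly"
  have P0: "?P \<noteq> 0"
  proof
    assume "?P = 0"
    then have "coeff ?P w = 0" by simp
    then show False using w by simp
  qed
  have RP: "?R = {x. poly ?P x = 0}" by (auto simp: poly_monom w_def)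
  show fin: "finite ?R" unfolding RP by (rule poly_roots_finite[OF P0])
  have "card ?R \<le> degree ?P" unfolding RP by (rule card_poly_roots_bound[OF P0])
  also have "\<dots> \<le> w" by (intro degree_diff_le) (auto simp: degree_monom_le)
  finally have le: "card ?R \<le> w" .
  define Q :: "'l poly" where "Q = (\<Sum>i<q - 1. monom 1 (w * i))"
  have "coeff Q 0 = (\<Sum>i<q - 1. if i = 0 then 1 else 0)"
    unfolding Q_def coeff_sum using w by (intro sum.cong) auto
  then have "coeff Q 0 = 1" using q_ge_2 by simp
  then have Q0: "Q \<noteq> 0" by auto
  have degQ: "degree Q \<le> w * (q - 2)" unfolding Q_def
    by (intro degree_sum_le) (auto intro!: order.trans[OF degree_monom_le])
  have "Eset - {0} \<subseteq> ?R \<union> {x. poly Q x = 0}"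
  proof
    fix x assume x: "x \<in> Eset - {0}"
    then have "x ^ (q ^ N) = x" "x \<noteq> 0" by (auto simp: mem_Eset_iff)
    moreover have "x ^ (q ^ N) = (x ^ w) ^ (q - 1) * x"
      by (simp add: W_mult[of N, symmetric] power_mult[symmetric] mult.commute w_def)
    ultimately have "(x ^ w) ^ (q - 1) = 1" by simp
    then have "(x ^ w - 1) * poly Q x = 0"
      using power_diff_1_eq[of "x ^ w" "q - 1"]
      by (simp add: Q_def poly_sum poly_monom power_mult)
    then show "x \<in> ?R \<union> {x. poly Q x = 0}" by (auto simp: w_def)
  qed
  then have "card (Eset - {0}) \<le> card (?R \<union> {x. poly Q x = 0})"
    using fin poly_roots_finite[OF Q0] by (intro card_mono) auto
  also have "\<dots> \<le> card ?R + card {x. poly Q x = 0}" by (rule card_Un_le)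
  also have "\<dots> \<le> card ?R + w * (q - 2)" using card_poly_roots_bound[OF Q0] degQ by simp
  finally have "card (Eset - {0}) \<le> card ?R + w * (q - 2)" .
  moreover have "card (Eset - {0}) = (q - 1) * w"
    using card_Diff_singleton[OF is_subfield_0[OF Eset_subfield]] W_mult[of N] by (simp add: card_Eset w_def)
  moreover obtain p where "q = Suc (Suc p)" using q_ge_2 by (metis add_2_eq_Suc le_Suc_ex)
  ultimately have "w \<le> card ?R" by (simp add: algebra_simps)
  then show "card ?R = W q N" using le by (simp add: w_def)
qed

lemma frob_mult_N: "x \<in> Eset \<Longrightarrow> x ^ (q ^ (m * N)) = x"
proof (induction m)
  case (Suc m)
  have "x ^ (q ^ (Suc m * N)) = (x ^ (q ^ N)) ^ (q ^ (m * N))" by (simp only: frob_comp mult_Suc)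
  then show ?case using Suc frob_N by simp
qed simp

end

section \<open>Labels of the roots and the Hayes modules\<close>

locale labelled_place = sigma_place emb q \<rho> \<theta> \<eta> N \<sigma>
  for emb :: "'f::{field,finite} \<Rightarrow> 'l::field" and q :: nat
    and \<rho> :: "'f poly" and \<theta> \<eta> :: 'l and N :: nat and \<sigma> :: "'l \<Rightarrow> 'l" +
  fixes u :: 'l
  assumes u: "u ^ W q N = BB 0 N"
begin

abbreviation "ul \<equiv> u_lab q \<sigma> \<theta> \<eta> u"

lemma ul_alt: "ul k \<mu> = \<mu> ^ (q ^ k) * inverse (AA k) ^ (q - 1) * u ^ (q ^ k)"
  unfolding u_lab_def gexp_smult[OF Theta_nz] AA_def powi_1_minus_q ..

lemma ul_0: "ul 0 \<mu> = \<mu> * u" by (simp add: ul_alt AA_0)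

lemma ul_Suc: "ul (Suc k) \<mu> = ul k \<mu> ^ q * (\<theta> - h k) ^ (q - 1)"
proof -
  have "inverse (AA (Suc k)) ^ (q - 1) = (inverse (AA k) ^ (q - 1)) ^ q * (\<theta> - h k) ^ (q - 1)"
    by (simp add: AA_Suc power_divide power_mult_distrib power_inverse divide_inverse power_mult[symmetric] mult.commute)
  then show ?thesis unfolding ul_alt frob_Suc by (simp only: power_mult_distrib mult_ac)
qed

lemma ul_mult: "ul k (\<mu> * \<nu>) = ul k \<mu> * \<nu> ^ (q ^ k)"
  by (simp add: ul_alt power_mult_distrib mult_ac)

text \<open>The W_N-th power of the recursion \<open>ul_Suc\<close> is that of
  \<open>BB_N_Suc\<close>, because (q - 1) W_N = q^N - 1.\<close>

lemma ul_root: assumes "\<mu> ^ W q N = 1" shows "ul k \<mu> ^ W q N = BB k N"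
proof (induction k)
  case 0
  then show ?case using assms u by (simp add: ul_0 power_mult_distrib)
next
  case (Suc k)
  have "(q - 1) * W q N = q ^ N - 1" using W_mult[of N] by simp
  then have "((\<theta> - h k) ^ (q - 1)) ^ W q N = (\<theta> - h k) ^ (q ^ N - 1)"
    by (simp only: power_mult[symmetric])
  moreover have "(ul k \<mu> ^ q) ^ W q N = (ul k \<mu> ^ W q N) ^ q"
    by (simp only: power_mult[symmetric] mult.commute)
  ultimately show ?case by (simp only: ul_Suc BB_N_Suc power_mult_distrib Suc)
qed

lemma ul_nz: "\<mu> ^ W q N = 1 \<Longrightarrow> ul k \<mu> \<noteq> 0"
  using ul_root[of \<mu> k] BB_nz[of k N] W_N_pos by (metis power_0_left not_gr_zero)

lemma roots_eq: "{x. x ^ W q N = BB k N} = ul k ` {\<mu>. \<mu> ^ W q N = 1}"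
proof (intro equalityI subsetI)
  fix x assume "x \<in> {x. x ^ W q N = BB k N}"
  then have x: "x ^ W q N = BB k N" by simp
  define \<nu> where "\<nu> = x / ul k 1"
  have nz: "ul k 1 \<noteq> 0" by (simp add: ul_nz)
  have \<nu>: "\<nu> ^ W q N = 1" using x ul_root[of 1 k] BB_nz[of k N] by (simp add: \<nu>_def power_divide)
  \<comment> \<open>The quotient of two roots is a root of unity \<open>\<nu>\<close> in F_q(eta).
    Its q^k-th root is obtained by going on with Frobenius up to the next multiple of N.\<close>
  define \<mu> where "\<mu> = \<nu> ^ (q ^ (k * N - k))"
  have "k * 1 \<le> k * N" using N_ge_2 by (intro mult_le_mono) auto
  then have "k * N - k + k = k * N" by simp
  then have "\<mu> ^ (q ^ k) = \<nu> ^ (q ^ (k * N))" by (simp only: \<mu>_def frob_comp)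
  also have "\<dots> = \<nu>" by (rule frob_mult_N[OF root_of_unity_in_Eset[OF \<nu>]])
  finally have "x = ul k \<mu>" using ul_mult[of k 1 \<mu>] nz by (simp add: \<nu>_def)
  moreover have "\<mu> ^ W q N = (\<nu> ^ W q N) ^ (q ^ (k * N - k))"
    by (simp only: \<mu>_def power_mult[symmetric] mult.commute)
  ultimately show "x \<in> ul k ` {\<mu>. \<mu> ^ W q N = 1}" using \<nu> by simp
qed (use ul_root in auto)

lemma card_roots: "card {x. x ^ W q N = BB k N} = W q N"
proof -
  have "inj_on (ul k) {\<mu>. \<mu> ^ W q N = 1}"
  proof (rule inj_onI)
    fix \<mu> \<nu> assume "ul k \<mu> = ul k \<nu>"
    then have "\<mu> ^ (q ^ k) = \<nu> ^ (q ^ k)"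
      using ul_mult[of k 1 \<mu>] ul_mult[of k 1 \<nu>] ul_nz[of 1 k] by simp
    then show "\<mu> = \<nu>" by (simp only: frob_inj)
  qed
  then show ?thesis unfolding roots_eq by (simp only: card_image card_roots_of_unity)
qed

lemma U_rho_eq: "U_rho q N \<sigma> \<theta> \<eta> = (\<Union>k<N. {x. x ^ W q N = BB k N})"
  by (auto simp: U_rho_def BB_def)

lemma U_rho_labels: "U_rho q N \<sigma> \<theta> \<eta> = {ul k \<mu> | k \<mu>. k < N \<and> \<mu> ^ W q N = 1}"
  unfolding U_rho_eq roots_eq by auto

lemma card_U_rho: "card (U_rho q N \<sigma> \<theta> \<eta>) = N * W q N"
proof -
  have "card (\<Union>k<N. {x. x ^ W q N = BB k N}) = (\<Sum>k<N. card {x. x ^ W q N = BB k N})"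
  proof (rule card_UN_disjoint)
    show "\<forall>i\<in>{..<N}. finite {x. x ^ W q N = BB i N}"
      unfolding roots_eq using finite_roots_of_unity by simp
    show "\<forall>i\<in>{..<N}. \<forall>j\<in>{..<N}. i \<noteq> j \<longrightarrow> {x. x ^ W q N = BB i N} \<inter> {x. x ^ W q N = BB j N} = {}"
      using BB_N_inj by force
  qed simp
  then show ?thesis by (simp add: U_rho_eq card_roots)
qed

definition kk :: "'l \<Rightarrow> nat" where "kk x = (THE k. k < N \<and> x ^ W q N = BB k N)"

text \<open>Inverts x = -g/(theta - eta^(k)); the index k is recovered from x, since by
  \<open>BB_N_inj\<close> the N equations have different right-hand sides.\<close>

definition hayes :: "'l \<Rightarrow> 'f poly fract \<Rightarrow> 'l poly" where
  "hayes x = Dmod (kk x) (- x * (\<theta> - h (kk x)))"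

lemma kk_eq: assumes "k < N" "x ^ W q N = BB k N" shows "kk x = k"
  unfolding kk_def by (rule the_equality) (use assms BB_N_inj in auto)

abbreviation Hplus :: "'l set" where "Hplus \<equiv> adjoin emb {\<theta>, \<eta>, u}"

lemma Hplus_closed:
  "is_subfield Hplus" "range emb \<subseteq> Hplus" "\<theta> \<in> Hplus" "\<eta> \<in> Hplus" "u \<in> Hplus" "H \<subseteq> Hplus"
proof -
  show F: "is_subfield Hplus" by (rule adjoin_subfield)
  show b: "range emb \<subseteq> Hplus" by (auto intro: adjoin_base)
  show g: "\<theta> \<in> Hplus" "\<eta> \<in> Hplus" "u \<in> Hplus" by (auto intro: adjoin_gen)
  show "H \<subseteq> Hplus" using F b g by (intro adjoin_least) auto
qed

lemma ul_in_Hplus: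
  assumes "\<mu> ^ W q N = 1" shows "ul k \<mu> \<in> Hplus"
proof -
  note cl = is_subfield_closed[OF Hplus_closed(1)]
  have "\<mu> \<in> Eset" by (rule root_of_unity_in_Eset[OF assms])
  then have \<mu>: "\<mu> \<in> Hplus"
    unfolding Eset_def by (auto intro!: ev_in_subfield Hplus_closed)
  have "AA k \<in> H"
    by (induction k) (auto simp: AA_0 AA_Suc intro!: H_closed h_in_H theta_in_H)
  then have "AA k \<in> Hplus" using Hplus_closed(6) by blast
  then show ?thesis unfolding ul_alt by (intro cl \<mu> Hplus_closed(5))
qed

lemma Hayes_modules_eq: "Hayes_modules emb \<rho> \<theta> \<eta> u = hayes ` U_rho q N \<sigma> \<theta> \<eta>"
proof (intro equalityI subsetI)
  fix \<psi> assume "\<psi> \<in> Hayes_modules emb \<rho> \<theta> \<eta> u"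
  then obtain s where r: "rank_one_Drinfeld emb \<rho> \<theta> \<eta> \<psi>"
    and s: "s \<in> gal (adjoin emb {\<eta>}) (range emb)"
    and lc: "\<And>a. a \<in> ringA \<rho> \<Longrightarrow> a \<noteq> 0 \<Longrightarrow> lead_coeff (\<psi> a) = s (Sgn emb \<rho> \<eta> (iota_rho emb \<eta> a))"
    unfolding Hayes_modules_def by blast
  obtain k g where k: "k < N" and g: "g \<noteq> 0" and \<psi>: "\<psi> = Dmod k g" using rank_one_eq_Dmod[OF r] .
  \<comment> \<open>The element 1/rho has sign 1, which every automorphism fixes; so
    \<open>dd k g N\<close> must be 1.\<close>
  have rho1: "\<not> \<rho> dvd 1" using irr by (simp add: irreducible_def)
  have T0: "genT \<rho> 0 = Fr 1 1" by (simp add: genT_def)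
  have "degree (\<psi> (Fr 1 1)) = N" using rank_one_degree[OF r rho1, of 1] by simp
  then have "lead_coeff (\<psi> (Fr 1 1)) = 1 / dd k g N"
    using coeff_Dmod_genT[OF g, of 0 k] by (simp add: \<psi> T0)
  moreover have "Fr 1 1 \<noteq> 0" by (simp add: Zero_fract_def eq_fract)
  then have "lead_coeff (\<psi> (Fr 1 1)) = s 1"
    using lc[of "Fr 1 1"] Fr_in_ringA[of 1 1] Sgn_iota_rho[OF rho1, of 1] by simp
  moreover have "s 1 = 1" using s emb_1 unfolding gal_def by (metis (mono_tags, lifting) mem_Collect_eq rangeI)
  ultimately have dd: "dd k g N = 1" using dd_nz[OF g, of k N] by simp
  define x where "x = - (g / (\<theta> - h k))"
  have gx: "g = - x * (\<theta> - h k)" by (simp add: x_def)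
  then have x: "x ^ W q N = BB k N" using dd dd_N_eq_1_iff by simp
  then have "\<psi> = hayes x" by (simp add: hayes_def kk_eq[OF k x] \<psi> gx)
  then show "\<psi> \<in> hayes ` U_rho q N \<sigma> \<theta> \<eta>" using k x by (auto simp: U_rho_eq)
next
  fix \<psi> assume "\<psi> \<in> hayes ` U_rho q N \<sigma> \<theta> \<eta>"
  then obtain k x where k: "k < N" and x: "x ^ W q N = BB k N" and \<psi>x: "\<psi> = hayes x"
    by (auto simp: U_rho_eq)
  obtain \<mu> where \<mu>: "\<mu> ^ W q N = 1" "x = ul k \<mu>" using x roots_eq[of k] by auto
  define g where "g = - x * (\<theta> - h k)"
  have \<psi>: "\<psi> = Dmod k g" by (simp add: \<psi>x hayes_def kk_eq[OF k x] g_def)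
  have g: "g \<noteq> 0" using ul_nz[OF \<mu>(1)] \<mu>(2) by (simp add: g_def)
  have dd: "dd k g N = 1" unfolding g_def using dd_N_eq_1_iff x by blast
  note cl = is_subfield_closed[OF Hplus_closed(1)]
  have "h k \<in> Hplus" using h_in_H Hplus_closed(6) by blast
  then have g_in: "g \<in> Hplus"
    unfolding g_def \<mu>(2) by (intro cl ul_in_Hplus \<mu> Hplus_closed(3))
  \<comment> \<open>The sign of n/rho^m is n(eta) and its leading coefficient is n(eta^(k-1)), so
    the automorphism is the (k-1)-st power of Frobenius.\<close>
  define s where "s = (\<lambda>x :: 'l. x ^ (q ^ (k + N - 1)))"
  have "lead_coeff (\<psi> a) = s (Sgn emb \<rho> \<eta> (iota_rho emb \<eta> a))" if a: "a \<in> ringA \<rho>" "a \<noteq> 0" for a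
  proof -
    obtain n m where n: "a = Fr n m" "degree n \<le> m * N" "\<not> \<rho> dvd n"
      using ringA_cases_coprime[OF a] by blast
    show ?thesis
      unfolding n(1) \<psi> Dmod_lead_coeff[OF g dd n(2,3)] Sgn_iota_rho[OF n(3)] s_def
      by (rule ev_h)
  qed
  moreover have "coeff (\<psi> a) i \<in> Hplus" if "a \<in> ringA \<rho>" for a i
    unfolding \<psi> by (rule Dmod_coeff_in_subfield[OF Hplus_closed(1-4) g_in g that])
  ultimately show "\<psi> \<in> Hayes_modules emb \<rho> \<theta> \<eta> u"
    unfolding Hayes_modules_def using rank_one_Dmod[OF g, of k] power_frob_in_gal[of "k + N - 1"]
    by (auto simp: \<psi> s_def intro!: bexI[of _ "\<lambda>x. x ^ (q ^ (k + N - 1))"])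
qed

lemma hayes_inj: "inj_on hayes (U_rho q N \<sigma> \<theta> \<eta>)"
proof (rule inj_onI)
  fix x y assume "x \<in> U_rho q N \<sigma> \<theta> \<eta>" "y \<in> U_rho q N \<sigma> \<theta> \<eta>" and eq: "hayes x = hayes y"
  then obtain k k' where k: "k < N" "x ^ W q N = BB k N" "k' < N" "y ^ W q N = BB k' N"
    by (auto simp: U_rho_eq)
  have "x \<noteq> 0" "y \<noteq> 0" using k BB_nz W_N_pos by (metis power_0_left not_gr_zero)+
  then have "k = k' \<and> - x * (\<theta> - h k) = - y * (\<theta> - h k')"
    using eq k by (intro Dmod_inj) (auto simp: hayes_def kk_eq[OF k(1,2)] kk_eq[OF k(3,4)])
  then have "x * (\<theta> - h k) = y * (\<theta> - h k)" by auto
  then show "x = y" by simp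
qed

text \<open>Both sides start at -u_k and satisfy z_(m+1) = z_m^q (theta - eta^(k+m))^(q-1). The
  label u_(k+m) is thus minus the constant term of the m-th linear factor before t enters.\<close>

lemma dd_ul: "dd k (- ul k \<mu> * (\<theta> - h k)) m ^ (q - 1) * - ul k \<mu> = - ul (k + m) \<mu>"
proof (induction m)
  case (Suc m)
  define d where "d = dd k (- ul k \<mu> * (\<theta> - h k)) m"
  define w where "w = - ul k \<mu>"
  define X where "X = \<theta> - h (k + m)"
  have qq: "z ^ q = z ^ (q - 1) * z" for z :: 'l by (metis power_minus_mult q_pos)
  have "dd k (- ul k \<mu> * (\<theta> - h k)) (Suc m) = d ^ q * w * X" by (simp add: d_def w_def X_def)
  then have "dd k (- ul k \<mu> * (\<theta> - h k)) (Suc m) ^ (q - 1) * w = (d ^ (q - 1) * w) ^ q * X ^ (q - 1)"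
    by (simp add: power_mult_distrib qq[of w] power_mult[symmetric] mult_ac)
  also have "d ^ (q - 1) * w = - ul (k + m) \<mu>" using Suc by (simp add: d_def w_def)
  also have "(- ul (k + m) \<mu>) ^ q * X ^ (q - 1) = - ul (k + Suc m) \<mu>"
    by (simp add: frob_minus_q ul_Suc X_def)
  finally show ?case by (simp only: w_def)
qed simp

lemma eta_star_alt: "eta_star q N \<eta> = inverse (h (N - 1)) ^ (q - 1)"
  by (simp only: eta_star_def powi_1_minus_q conjg_minus_1)

lemma hayes_genT:
  assumes k: "k < N" and \<mu>: "\<mu> ^ W q N = 1" and n: "n < N"
  shows "hayes (ul k \<mu>) (genT \<rho> n) =
    smult (conjg q N \<eta> (int k - 1) ^ n)
      (skew_mult q (psi' q N \<sigma> \<theta> \<eta> u k \<mu> n) (psi'' q \<sigma> \<theta> \<eta> u k \<mu> (N - n)))"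
proof -
  define g where "g = - ul k \<mu> * (\<theta> - h k)"
  define l where "l = N - n"
  have ln: "l + n = N" using n by (simp add: l_def)
  have x: "ul k \<mu> ^ W q N = BB k N" by (rule ul_root[OF \<mu>])
  have g: "g \<noteq> 0" using ul_nz[OF \<mu>] by (simp add: g_def)
  have dd: "dd k g N = 1" unfolding g_def using dd_N_eq_1_iff x by blast
  have base: "dd k g m ^ (q - 1) * (g / (\<theta> - h k)) = - ul (k + m) \<mu>" for m
    using dd_ul[of k \<mu> m] by (simp add: g_def)
  have lower: "aa k g l i = - ul (k + i) \<mu>" if "i < l" for i
    using that by (simp only: aa_def base if_True mult_1_right)
  have upper: "aa k g l (l + i) = - (\<theta> * ul (k + N - n + i) (\<mu> * eta_star q N \<eta> ^ i) /
      conjg q N \<eta> (int (k + N - n + i)))" for i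
  proof -
    define m where "m = k + (l + i)"
    have m: "k + N - n + i = m" using n by (simp add: m_def l_def)
    have 1: "k + (l + i) + N - 1 = (N - 1) + m" unfolding m_def using N_ge_2 by linarith
    \<comment> \<open>Frobenius takes eta^(-1) to eta^(m-1), so this factor is the q^m-th power of
      eta_*^i. \<open>ul_mult\<close> absorbs it into the label.\<close>
    have "ee k l (l + i) ^ (q - 1) = (eta_star q N \<eta> ^ i) ^ (q ^ m)"
    proof -
      have "(eta_star q N \<eta> ^ i) ^ (q ^ m) = (inverse (h (N - 1)) ^ (q ^ m)) ^ ((q - 1) * i)"
        by (simp only: eta_star_alt power_mult[symmetric] mult_ac)
      also have "\<dots> = inverse (h ((N - 1) + m)) ^ ((q - 1) * i)" by (simp only: power_inverse h_frob)
      finally show ?thesis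
        by (simp only: ee_def 1 power_mult[symmetric] mult.commute add_diff_cancel_left')
    qed
    then show ?thesis
      unfolding m conjg_int ul_mult aa_def base by (simp add: m_def)
  qed
  have "hayes (ul k \<mu>) (genT \<rho> n) = smult (h (k + N - 1) ^ n) (skew_prod q (\<lambda>i. [:aa k g l i, 1:]) (l + n))"
    unfolding hayes_def kk_eq[OF k x] g_def[symmetric] ln
    using Dmod_genT[OF g, of n k] n dd by (simp add: l_def)
  also have "skew_prod q (\<lambda>i. [:aa k g l i, 1:]) (l + n) =
      skew_mult q (skew_prod q (\<lambda>i. [:aa k g l (l + i), 1:]) n) (skew_prod q (\<lambda>i. [:aa k g l i, 1:]) l)"
    by (rule skew_prod_add)
  also have "skew_prod q (\<lambda>i. [:aa k g l (l + i), 1:]) n = psi' q N \<sigma> \<theta> \<eta> u k \<mu> n"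
    unfolding psi'_def upper ..
  also have "skew_prod q (\<lambda>i. [:aa k g l i, 1:]) l = psi'' q \<sigma> \<theta> \<eta> u k \<mu> (N - n)"
    unfolding psi''_def l_def[symmetric] by (rule skew_prod_cong) (simp add: lower)
  finally show ?thesis by (simp only: conjg_pred)
qed

end

theorem theorem4:
  fixes emb :: "'f::{field,finite} \<Rightarrow> 'l::field"
    and \<rho> :: "'f poly" and \<theta> \<eta> \<Theta> :: 'l and \<sigma> :: "'l \<Rightarrow> 'l" and q N :: nat
  assumes "q = CARD('f)"
    and "field_embedding emb"
    and "irreducible \<rho>" and "lead_coeff \<rho> = 1" and "N = degree \<rho>" and "N \<ge> 2"
    and "\<And>p :: 'f poly. p \<noteq> 0 \<Longrightarrow> poly (map_poly emb p) \<theta> \<noteq> 0"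
    and "poly (map_poly emb \<rho>) \<eta> = 0"
    and "\<sigma> \<in> gal (adjoin emb {\<theta>, \<eta>}) (adjoin emb {\<theta>})" and "\<sigma> \<eta> = \<eta> ^ q"
    and "\<Theta> = 1 / (\<theta> - \<eta>)"
  shows
    "(\<exists>!\<Psi>. from_shtuka emb \<rho> \<theta> \<eta> (shtuka q N \<theta> \<eta> 0) \<Psi>) \<and>
     (\<forall>\<Psi>. from_shtuka emb \<rho> \<theta> \<eta> (shtuka q N \<theta> \<eta> 0) \<Psi> \<longrightarrow>
        standard_modules emb \<rho> \<theta> \<eta> = {twist \<rho> \<sigma> k \<Psi> |k. k < N} \<and>
        (\<forall>n<N. \<Psi> (genT \<rho> n) =
           smult (conjg q N \<eta> (- 1) ^ n * gexp \<sigma> \<Theta> (gam q N - [:int (W q N):]))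
             (skew_prod q (\<lambda>i. [:angle q N \<sigma> \<theta> \<eta> (N - n) i, 1:]) N))) \<and>
     (\<forall>u. u ^ W q N = gexp \<sigma> (- \<Theta>) (gam q N) \<longrightarrow>
        U_rho q N \<sigma> \<theta> \<eta> = {u_lab q \<sigma> \<theta> \<eta> u k \<mu> |k \<mu>. k < N \<and> \<mu> ^ W q N = 1} \<and>
        card (Hayes_modules emb \<rho> \<theta> \<eta> u) = N * W q N \<and>
        (\<exists>\<psi>. bij_betw \<psi> (U_rho q N \<sigma> \<theta> \<eta>) (Hayes_modules emb \<rho> \<theta> \<eta> u) \<and>
           (\<forall>k<N. \<forall>\<mu>. \<mu> ^ W q N = 1 \<longrightarrow>
              (\<forall>n<N. \<psi> (u_lab q \<sigma> \<theta> \<eta> u k \<mu>) (genT \<rho> n) =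
                 smult (conjg q N \<eta> (int k - 1) ^ n)
                   (skew_mult q (psi' q N \<sigma> \<theta> \<eta> u k \<mu> n) (psi'' q \<sigma> \<theta> \<eta> u k \<mu> (N - n)))))))"
proof -
  interpret sigma_place emb q \<rho> \<theta> \<eta> N \<sigma>
    using assms by unfold_locales
  have shtuka: "from_shtuka emb \<rho> \<theta> \<eta> (shtuka q N \<theta> \<eta> 0) \<Psi> \<longleftrightarrow> \<Psi> = Dmod 0 1" for \<Psi>
    using from_shtuka_iff[of 0] by simp
  have "U_rho q N \<sigma> \<theta> \<eta> = {u_lab q \<sigma> \<theta> \<eta> u k \<mu> |k \<mu>. k < N \<and> \<mu> ^ W q N = 1} \<and>
        card (Hayes_modules emb \<rho> \<theta> \<eta> u) = N * W q N \<and>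
        (\<exists>\<psi>. bij_betw \<psi> (U_rho q N \<sigma> \<theta> \<eta>) (Hayes_modules emb \<rho> \<theta> \<eta> u) \<and>
           (\<forall>k<N. \<forall>\<mu>. \<mu> ^ W q N = 1 \<longrightarrow>
              (\<forall>n<N. \<psi> (u_lab q \<sigma> \<theta> \<eta> u k \<mu>) (genT \<rho> n) =
                 smult (conjg q N \<eta> (int k - 1) ^ n)
                   (skew_mult q (psi' q N \<sigma> \<theta> \<eta> u k \<mu> n) (psi'' q \<sigma> \<theta> \<eta> u k \<mu> (N - n))))))"
    if "u ^ W q N = gexp \<sigma> (- \<Theta>) (gam q N)" for u
  proof -
    \<comment> \<open>In this form the hypothesis on u is the equation with k = 0.\<close>
    have "- \<Theta> = 1 / (h 0 - \<theta>)" using assms(11) by (simp add: minus_divide_right)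
    then interpret labelled_place emb q \<rho> \<theta> \<eta> N \<sigma> u
      using that by unfold_locales (simp add: BB_def)
    have bij: "bij_betw hayes (U_rho q N \<sigma> \<theta> \<eta>) (Hayes_modules emb \<rho> \<theta> \<eta> u)"
      using hayes_inj by (simp add: bij_betw_def Hayes_modules_eq)
    moreover have "card (Hayes_modules emb \<rho> \<theta> \<eta> u) = N * W q N"
      using bij_betw_same_card[OF bij] card_U_rho by simp
    ultimately show ?thesis using U_rho_labels hayes_genT by blast
  qed
  note hayes = this
  show ?thesis unfolding shtuka
  proof (rule conjI[OF _ conjI], goal_cases)
    case 2
    show ?case
      using standard_modules_eq standard_genT by (simp add: twist_Dmod assms(11))
  qed (simp, intro allI impI, rule hayes)
qed

end
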